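(* Assume that $\gamma:[0,\infty)\to[0,\infty)$ is a strictly increasing continuous function with $\gamma(0)=0$. Then, given any compact geodesic annulus $\mathscr A=\{x\in\mathbb H^3 : c_1\le d(e,x)\le c_2\}$ with $0<c_1<c_2<\infty$, there exists a radial function $f\in H^{1/2}(\mathbb H^3)$ such that its Schrödinger propagation $u$ is continuous in $\mathscr A\times(0,\infty)$ and $$\limsup_{\substack{(y,t)\to(x,0)\\ d(x,y)<\gamma(t),\ t>0}} |u(y,t)| = +\infty\quad\text{for all } x\in\mathscr A.$$
   Context: $\mathbb H^3\cong SL(2,\mathbb C)/SU(2)$ is the 3-dimensional real hyperbolic space of constant sectional curvature $-1$, $d$ is its geodesic distance, and $e$ is the identity coset (base point). A function on $\mathbb H^3$ is radial if it depends only on $s=d(e,x)$. The Riemannian measure in geodesic polar coordinates is (up to normalization) $\sinh^2 s\,ds$ times the rotation-invariant measure. The spherical functions are $\varphi_\lambda(x)=\varphi_\lambda(s)=\dfrac{\sin(\lambda s)}{\lambda\sinh s}$, $\lambda>0$, $s=d(e,x)$. The spherical Fourier transform of a radial $f$ is $\widehat f(\lambda)=\int_{\mathbb H^3} f(x)\varphi_\lambda(x)\,dx$, extended to radial $L^2$ functions by the Plancherel theorem, with Plancherel measure $\lambda^2\,d\lambda$ on $(0,\infty)$ (up to a positive constant). A radial function $f\in L^2(\mathbb H^3)$ belongs to $H^{1/2}(\mathbb H^3)$ if $\int_0^\infty(\lambda^2+1)^{1/2}|\widehat f(\lambda)|^2\lambda^2\,d\lambda<\infty$. The Schrödinger propagation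 of a radial $f$ (the solution of $i\,\partial_t u=\Delta u$, $u(0,\cdot)=f$, where $\Delta$ is the Laplace–Beltrami operator, up to the constant in the Plancherel formula) is $$u(x,t)=\int_0^\infty \varphi_\lambda(s)\,e^{it(\lambda^2+1)}\,\widehat f(\lambda)\,\lambda^2\,d\lambda,\qquad s=d(e,x).$$ For non-smooth $f$ the integral is understood as an improper integral $\lim_{R\to\infty}\int_0^R$; the continuity assertion includes convergence at all points of $\mathscr A\times(0,\infty)$. In the limsup, $|u(y,t)|$ is evaluated at points $(y,t)$ with $t>0$ in the approach region near $(x,0)$. *)

theory Defs
  imports "HOL-Analysis.Analysis"
begin

text \<open>
  \<open>SL(2,\<complex>)/SU(2)\<close> is realised as the Poincare ball: the open unit ball of \<open>\<real>\<^sup>3\<close> with the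
  Riemannian metric \<open>4 |dx|\<^sup>2 / (1 - |x|\<^sup>2)\<^sup>2\<close> of constant curvature \<open>-1\<close>. The identity coset,
  whose stabiliser \<open>SU(2)\<close> acts by rotations, is the origin. The manifold topology is the one
  induced from \<open>\<real>\<^sup>3\<close>.
\<close>

definition H3 :: "(real^3) set" where
  "H3 = ball 0 1"

definition H3_base :: "real^3" where
  "H3_base = 0"

definition H3_length :: "(real \<Rightarrow> real^3) \<Rightarrow> real" where
  "H3_length c =
     integral {0..1} (\<lambda>\<tau>. 2 / (1 - (norm (c \<tau>))\<^sup>2) * norm (vector_derivative c (at \<tau>)))"

text \<open>
  The curves are \<open>C\<^sup>1\<close> and not just piecewise \<open>C\<^sup>1\<close> in the sense of \<^const>\<open>valid_path\<close>: the latter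
  admits curves of infinite length, for which the integral above would be \<open>0\<close>.
\<close>

definition H3_dist :: "real^3 \<Rightarrow> real^3 \<Rightarrow> real" where
  "H3_dist x y =
     Inf (H3_length ` {c. c C1_differentiable_on {0..1} \<and> path_image c \<subseteq> H3 \<and>
                          pathstart c = x \<and> pathfinish c = y})"

definition H3_measure :: "(real^3) measure" where
  "H3_measure =
     density (restrict_space lborel H3) (\<lambda>x. ennreal ((2 / (1 - (norm x)\<^sup>2)) ^ 3))"

definition H3_annulus :: "real \<Rightarrow> real \<Rightarrow> (real^3) set" where
  "H3_annulus c1 c2 = {x \<in> H3. c1 \<le> H3_dist H3_base x \<and> H3_dist H3_base x \<le> c2}"

definition radial :: "(real^3 \<Rightarrow> complex) \<Rightarrow> bool" where
  "radial f \<longleftrightarrow>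
     (\<forall>x\<in>H3. \<forall>y\<in>H3. H3_dist H3_base x = H3_dist H3_base y \<longrightarrow> f x = f y)"

definition square_integrable :: "'a measure \<Rightarrow> ('a \<Rightarrow> complex) \<Rightarrow> bool" where
  "square_integrable M f \<longleftrightarrow>
     f \<in> borel_measurable M \<and> integrable M (\<lambda>x. (cmod (f x))\<^sup>2)"

text \<open>At \<open>s = 0\<close> the spherical function takes its limit value.\<close>

definition spherical_function :: "real \<Rightarrow> real \<Rightarrow> real" where
  "spherical_function l s = (if s = 0 then 1 else sin (l * s) / (l * sinh s))"

definition plancherel_measure :: "real measure" where
  "plancherel_measure = density (restrict_space lborel {0<..}) (\<lambda>l. ennreal (l\<^sup>2))"

definition spherical_transform_L1 :: "(real^3 \<Rightarrow> complex) \<Rightarrow> real \<Rightarrow> complex" where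
  "spherical_transform_L1 f l =
     (LINT x|H3_measure. f x * of_real (spherical_function l (H3_dist H3_base x)))"

text \<open>
  The \<open>L\<^sup>2\<close> transform is the extension by continuity of the integral transform from
  \<open>L\<^sup>1 \<inter> L\<^sup>2\<close>. It is a relation because a transform is only determined almost
  everywhere; that it is so determined is the Plancherel theorem.
\<close>

definition has_spherical_transform ::
  "(real^3 \<Rightarrow> complex) \<Rightarrow> (real \<Rightarrow> complex) \<Rightarrow> bool" where
  "has_spherical_transform f g \<longleftrightarrow>
     radial f \<and> square_integrable H3_measure f \<and> square_integrable plancherel_measure g \<and>
     (\<exists>F :: nat \<Rightarrow> real^3 \<Rightarrow> complex.
        (\<forall>n. radial (F n) \<and> integrable H3_measure (F n) \<and> square_integrable H3_measure (F n)) \<and>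
        (\<lambda>n. \<integral>\<^sup>+ x. ennreal ((cmod (F n x - f x))\<^sup>2) \<partial>H3_measure) \<longlonglongrightarrow> 0 \<and>
        (\<lambda>n. \<integral>\<^sup>+ l. ennreal ((cmod (spherical_transform_L1 (F n) l - g l))\<^sup>2)
               \<partial>plancherel_measure) \<longlonglongrightarrow> 0)"

text \<open>Radial elements of \<open>H\<^sup>1\<^sup>/\<^sup>2\<close>.\<close>

definition H_half_radial :: "(real^3 \<Rightarrow> complex) set" where
  "H_half_radial =
     {f. \<exists>g. has_spherical_transform f g \<and>
        (\<integral>\<^sup>+ l. ennreal ((l\<^sup>2 + 1) powr (1/2) * (cmod (g l))\<^sup>2) \<partial>plancherel_measure) < \<infinity>}"

text \<open>
  In the following, \<open>g\<close> is the spherical transform of the initial datum. The values do not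
  change when \<open>g\<close> is modified on a null set.
\<close>

definition propagation_upto ::
  "(real \<Rightarrow> complex) \<Rightarrow> real^3 \<Rightarrow> real \<Rightarrow> real \<Rightarrow> complex" where
  "propagation_upto g x t R =
     (LINT l:{0<..R}|lborel.
        of_real (spherical_function l (H3_dist H3_base x)) * exp (\<i> * of_real (t * (l\<^sup>2 + 1)))
        * g l * of_real (l\<^sup>2))"

definition propagation_converges :: "(real \<Rightarrow> complex) \<Rightarrow> real^3 \<Rightarrow> real \<Rightarrow> bool" where
  "propagation_converges g x t \<longleftrightarrow> (\<exists>w. (propagation_upto g x t \<longlongrightarrow> w) at_top)"

text \<open>
  If the improper integral diverges, the value is set to \<open>0\<close>; such points do not influence
  whether an upper limit of \<open>|u|\<close> is infinite.
\<close>

definition propagation :: "(real \<Rightarrow> complex) \<Rightarrow> real^3 \<Rightarrow> real \<Rightarrow> complex" where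
  "propagation g x t =
     (if propagation_converges g x t then Lim at_top (propagation_upto g x t) else 0)"

definition approach_region :: "(real \<Rightarrow> real) \<Rightarrow> real^3 \<Rightarrow> ((real^3) \<times> real) set" where
  "approach_region \<gamma> x = {(y, t). y \<in> H3 \<and> t > 0 \<and> H3_dist x y < \<gamma> t}"

end

theory Submission
  imports Defs "HOL-Probability.Sinc_Integral" "HOL-Real_Asymp.Real_Asymp"
begin

text \<open>
  In geodesic polar coordinates the problem is one-dimensional: with \<open>h(l) = l g(l)\<close>,
  \<open>sinh s * u(s,t) = e\<^bsup>it\<^esup> \<integral> sin(ls) e\<^bsup>itl\<^sup>2\<^esup> h(l) dl\<close>, and \<open>f \<in> H\<^sup>1\<^sup>/\<^sup>2\<close> means
  \<open>\<integral> (l\<^sup>2 + 1)\<^sup>1\<^sup>/\<^sup>2 |h|\<^sup>2 dl < \<infinity>\<close>. The modulus \<open>|h(l)| = 1/(l ln l)\<close> is admissible although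
  \<open>\<integral> |h|\<close> diverges. Choose points \<open>(\<sigma>\<^sub>k, t\<^sub>k)\<close> with \<open>t\<^sub>k\<close> strictly decreasing to \<open>0\<close> such that every
  \<open>s \<in> [c\<^sub>1, c\<^sub>2]\<close> satisfies \<open>|\<sigma>\<^sub>k - s| < \<gamma>(t\<^sub>k)\<close> infinitely often, and give \<open>h\<close> on the block \<open>[N\<^sub>k, N\<^sub>k\<^sub>+\<^sub>1)\<close> the
  phase \<open>- (t\<^sub>k l\<^sup>2 + \<sigma>\<^sub>k l)\<close>. At \<open>(\<sigma>\<^sub>k, t\<^sub>k)\<close> block \<open>k\<close> has no oscillation and contributes about
  \<open>(ln ln N\<^sub>k\<^sub>+\<^sub>1 - ln ln N\<^sub>k) / 2\<close>, which outweighs the trivial bound \<open>ln ln N\<^sub>k\<close> for all earlier blocks,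
  while later blocks contribute \<open>O(2\<^sup>-\<^sup>j)\<close> by integration by parts. The same bound holds locally
  uniformly for \<open>t > 0\<close>, which gives convergence and continuity, and at \<open>t = 0\<close>, where it yields the
  datum \<open>f\<close> as a pointwise limit; that \<open>g\<close> is the transform of \<open>f\<close> follows from Plancherel's formula
  for the sine transform.
\<close>

section \<open>Distances in the ball model\<close>

text \<open>Order 1/2 is borderline: the Sobolev weight turns the amplitude into
  \<open>1 / (l * (ln l)\<^sup>2)\<close>, which is integrable, while the modulus itself integrates
  only to \<open>ln ln\<close>. Focusing thus gains so slowly that the blocks have to grow faster
  than doubly exponentially.

  Separation of the blocks rests on time alone. The radii \<open>\<sigma> k\<close> come arbitrarily
  close to one another, so the quadratic phase, with derivative \<open>2 * (T - t k) * l\<close>,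
  must beat the linear one; this is why the times are distinct and \<open>N\<close> is chosen after
  them. A sine is a sum of two waves of which only one focuses at \<open>\<sigma> k\<close>; the
  lower bound \<open>c1\<close> keeps the other one oscillating.

  The datum is obtained by cutting off frequencies, but the transform is defined through integrable
  approximants, and volume on hyperbolic space grows exponentially. The approximants are therefore
  cut off in radius instead, and comparing their transforms with \<open>g\<close> amounts to
  inverting the sine transform in the mean. Abel damping proves Plancherel's formula on a class of
  functions that truncated transforms do not leave, so that it can be used in both
  directions.\<close>

lemma H3_length_nonneg:
  assumes "c C1_differentiable_on {0..1}" "path_image c \<subseteq> H3"
  shows "0 \<le> H3_length c"
    and "(\<lambda>\<tau>. 2 / (1 - (norm (c \<tau>))\<^sup>2) * norm (vector_derivative c (at \<tau>)))
           integrable_on {0..1}"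
proof -
  have lt: "norm (c \<tau>) < 1" if "\<tau> \<in> {0..1}" for \<tau>
    using assms(2) that by (force simp: path_image_def H3_def)
  hence pos: "0 < 1 - (norm (c \<tau>))\<^sup>2" if "\<tau> \<in> {0..1}" for \<tau>
    using that by (simp add: abs_square_less_1)
  have cont: "continuous_on {0..1} c"
    using assms(1) C1_diff_imp_diff differentiable_imp_continuous_on by blast
  have "continuous_on {0..1} (\<lambda>\<tau>. vector_derivative c (at \<tau>))"
    using assms(1) by (simp add: C1_differentiable_on_eq)
  thus int: "(\<lambda>\<tau>. 2 / (1 - (norm (c \<tau>))\<^sup>2) * norm (vector_derivative c (at \<tau>)))
           integrable_on {0..1}"
    using cont pos by (intro integrable_continuous_interval continuous_intros) force+
  show "0 \<le> H3_length c"
    unfolding H3_length_def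
    using pos by (intro integral_nonneg[OF int]) (simp add: less_imp_le)
qed

text \<open>Projecting the curve to the line through its endpoint shortens it and, unlike the
  radial coordinate \<open>norm\<close>, the projection is differentiable at the origin.\<close>

lemma H3_length_ge:
  assumes c: "c C1_differentiable_on {0..1}" "path_image c \<subseteq> H3"
    and "pathstart c = 0" "pathfinish c = x"
  shows "2 * artanh (norm x) \<le> H3_length c"
proof (cases "x = 0")
  case True
  thus ?thesis using H3_length_nonneg[OF c] by simp
next
  case False
  define u where "u = x /\<^sub>R norm x"
  define p where "p = (\<lambda>\<tau>. u \<bullet> c \<tau>)"
  define p' where "p' = (\<lambda>\<tau>. u \<bullet> vector_derivative c (at \<tau>))"
  have nu: "norm u = 1" using False by (simp add: u_def)
  have lt: "norm (c \<tau>) < 1" if "\<tau> \<in> {0..1}" for \<tau>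
    using c(2) that by (force simp: path_image_def H3_def)
  have ple: "\<bar>p \<tau>\<bar> \<le> norm (c \<tau>)" for \<tau>
    using Cauchy_Schwarz_ineq2[of u "c \<tau>"] nu by (simp add: p_def)
  have p'le: "\<bar>p' \<tau>\<bar> \<le> norm (vector_derivative c (at \<tau>))" for \<tau>
    using Cauchy_Schwarz_ineq2[of u "vector_derivative c (at \<tau>)"] nu by (simp add: p'_def)
  have deriv: "(p has_real_derivative p' \<tau>) (at \<tau>)" if "\<tau> \<in> {0..1}" for \<tau>
  proof -
    have "(c has_vector_derivative vector_derivative c (at \<tau>)) (at \<tau>)"
      using c(1) that by (simp add: C1_differentiable_on_eq vector_derivative_works)
    hence "(p has_vector_derivative p' \<tau>) (at \<tau>)"
      unfolding p_def p'_def has_vector_derivative_def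
      by (auto intro!: derivative_eq_intros)
    thus ?thesis by (simp add: has_real_derivative_iff_has_vector_derivative)
  qed
  have "((\<lambda>\<tau>. 2 / (1 - (p \<tau>)\<^sup>2) * p' \<tau>) has_integral
          2 * artanh (p 1) - 2 * artanh (p 0)) {0..1}"
  proof (rule fundamental_theorem_of_calculus)
    fix \<tau> :: real assume \<tau>: "\<tau> \<in> {0..1}"
    have "\<bar>p \<tau>\<bar> < 1" using ple[of \<tau>] lt[OF \<tau>] by simp
    hence "((\<lambda>\<tau>. 2 * artanh (p \<tau>)) has_real_derivative 2 / (1 - (p \<tau>)\<^sup>2) * p' \<tau>) (at \<tau>)"
      by (auto intro!: derivative_eq_intros DERIV_chain2[OF artanh_real_has_field_derivative] deriv \<tau>)
    thus "((\<lambda>\<tau>. 2 * artanh (p \<tau>)) has_vector_derivative 2 / (1 - (p \<tau>)\<^sup>2) * p' \<tau>)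
        (at \<tau> within {0..1})"
      by (simp add: has_real_derivative_iff_has_vector_derivative has_vector_derivative_at_within)
  qed simp
  moreover have "p 0 = 0" using assms(3) by (simp add: p_def pathstart_def)
  moreover have "p 1 = norm x"
    using assms(4) False
    by (simp add: p_def pathfinish_def u_def power2_norm_eq_inner[symmetric] power2_eq_square)
  ultimately have hi: "((\<lambda>\<tau>. 2 / (1 - (p \<tau>)\<^sup>2) * p' \<tau>) has_integral 2 * artanh (norm x)) {0..1}"
    by simp
  show ?thesis
    unfolding H3_length_def
  proof (rule has_integral_le[OF hi integrable_integral[OF H3_length_nonneg(2)[OF c]]])
    fix \<tau> :: real assume \<tau>: "\<tau> \<in> {0..1}"
    have "(p \<tau>)\<^sup>2 \<le> (norm (c \<tau>))\<^sup>2" using ple[of \<tau>] by (metis abs_le_square_iff abs_norm_cancel)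
    moreover have "(norm (c \<tau>))\<^sup>2 < 1" using lt[OF \<tau>] by (simp add: abs_square_less_1)
    ultimately have "2 / (1 - (p \<tau>)\<^sup>2) \<le> 2 / (1 - (norm (c \<tau>))\<^sup>2)" "0 \<le> 2 / (1 - (p \<tau>)\<^sup>2)"
      by (auto intro!: divide_left_mono)
    moreover have "p' \<tau> \<le> norm (vector_derivative c (at \<tau>))" using p'le[of \<tau>] by simp
    ultimately show "2 / (1 - (p \<tau>)\<^sup>2) * p' \<tau>
        \<le> 2 / (1 - (norm (c \<tau>))\<^sup>2) * norm (vector_derivative c (at \<tau>))"
      by (smt (verit, ccfv_SIG) mult_left_mono mult_right_mono norm_ge_zero)
  qed
qed

text \<open>Radial segments are the only explicit curves needed: those from the origin realise the
  distance, and those between two points of one ray bound it from above. The order of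
  \<open>a\<close> and \<open>b\<close> is left open because a focusing radius may lie on either
  side of the given one.\<close>

lemma H3_length_ray:
  fixes u :: "real^3"
  assumes "norm u = 1" "0 \<le> a" "a < 1" "0 \<le> b" "b < 1"
  defines "c \<equiv> \<lambda>\<tau>. (a + \<tau> * (b - a)) *\<^sub>R u"
  shows "c C1_differentiable_on {0..1}" "path_image c \<subseteq> H3"
    "H3_length c = \<bar>2 * artanh b - 2 * artanh a\<bar>"
proof -
  have vd: "(c has_vector_derivative (b - a) *\<^sub>R u) (at \<tau>)" for \<tau>
    unfolding c_def by (auto intro!: derivative_eq_intros)
  show "c C1_differentiable_on {0..1}"
    unfolding C1_differentiable_on_def using vd by (auto intro!: exI[of _ "\<lambda>_. (b - a) *\<^sub>R u"])
  have range: "0 \<le> a + \<tau> * (b - a)" "a + \<tau> * (b - a) < 1" if "\<tau> \<in> {0..1}" for \<tau>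
  proof -
    have eq: "a + \<tau> * (b - a) = (1 - \<tau>) * a + \<tau> * b" by (simp add: algebra_simps)
    show "0 \<le> a + \<tau> * (b - a)" using that assms unfolding eq by simp
    show "a + \<tau> * (b - a) < 1"
      using that assms unfolding eq
      by (cases "\<tau> = 0") (auto intro: convex_bound_lt)
  qed
  thus "path_image c \<subseteq> H3"
    using assms(1) by (auto simp: path_image_def H3_def c_def)
  have "((\<lambda>\<tau>. 2 / (1 - (a + \<tau> * (b - a))\<^sup>2) * (b - a)) has_integral
      2 * artanh (a + 1 * (b - a)) - 2 * artanh (a + 0 * (b - a))) {0..1}"
  proof (rule fundamental_theorem_of_calculus)
    fix \<tau> :: real assume \<tau>: "\<tau> \<in> {0..1}"
    have "\<bar>a + \<tau> * (b - a)\<bar> < 1" using range[OF \<tau>] by simp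
    hence "((\<lambda>\<tau>. 2 * artanh (a + \<tau> * (b - a))) has_real_derivative
        2 / (1 - (a + \<tau> * (b - a))\<^sup>2) * (b - a)) (at \<tau>)"
      by (auto intro!: derivative_eq_intros DERIV_chain2[OF artanh_real_has_field_derivative])
    thus "((\<lambda>\<tau>. 2 * artanh (a + \<tau> * (b - a))) has_vector_derivative
        2 / (1 - (a + \<tau> * (b - a))\<^sup>2) * (b - a)) (at \<tau> within {0..1})"
      by (simp add: has_real_derivative_iff_has_vector_derivative has_vector_derivative_at_within)
  qed simp
  hence hi: "((\<lambda>\<tau>. 2 / (1 - (a + \<tau> * (b - a))\<^sup>2) * (b - a)) has_integral
      2 * artanh b - 2 * artanh a) {0..1}" by simp
  \<comment> \<open>The factor \<open>sgn (b - a)\<close> turns the signed velocity of the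
    antiderivative into the speed.\<close>
  have hi': "((\<lambda>\<tau>. 2 / (1 - (a + \<tau> * (b - a))\<^sup>2) * \<bar>b - a\<bar>) has_integral
      sgn (b - a) * (2 * artanh b - 2 * artanh a)) {0..1}"
    using has_integral_mult_right[OF hi, of "sgn (b - a)"]
    by (simp add: algebra_simps abs_sgn)
  have mono: "artanh v \<le> artanh w" if "0 \<le> v" "v \<le> w" "w < 1" for v w :: real
  proof -
    have "(1 + v) / (1 - v) \<le> (1 + w) / (1 - w)" using that by (intro frac_le) auto
    thus ?thesis using that by (simp add: artanh_def)
  qed
  have "sgn (b - a) * (2 * artanh b - 2 * artanh a) = \<bar>2 * artanh b - 2 * artanh a\<bar>"
    using mono[of a b] mono[of b a] assms by (auto simp: sgn_if abs_if)
  moreover have "norm (c \<tau>) = a + \<tau> * (b - a)" if "\<tau> \<in> {0..1}" for \<tau>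
    using range[OF that] assms(1) by (simp add: c_def)
  moreover have "vector_derivative c (at \<tau>) = (b - a) *\<^sub>R u" for \<tau>
    using vd vector_derivative_at by blast
  ultimately have "((\<lambda>\<tau>. 2 / (1 - (norm (c \<tau>))\<^sup>2) * norm (vector_derivative c (at \<tau>)))
      has_integral \<bar>2 * artanh b - 2 * artanh a\<bar>) {0..1}"
    using assms(1) by (intro has_integral_eq[OF _ hi'[unfolded \<open>sgn _ * _ = _\<close>]]) simp
  thus "H3_length c = \<bar>2 * artanh b - 2 * artanh a\<bar>"
    unfolding H3_length_def by (rule integral_unique)
qed

lemma H3_dist_le:
  assumes "c C1_differentiable_on {0..1}" "path_image c \<subseteq> H3"
    "pathstart c = x" "pathfinish c = y"
  shows "H3_dist x y \<le> H3_length c"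
  unfolding H3_dist_def
  by (rule cInf_lower) (use assms H3_length_nonneg in \<open>auto intro!: bdd_belowI[of _ 0]\<close>)

text \<open>An upper bound is enough here: it only has to certify that a point lies in an approach
  region.\<close>

lemma H3_dist_ray_le:
  fixes u :: "real^3"
  assumes "norm u = 1" "0 \<le> a" "a < 1" "0 \<le> b" "b < 1"
  shows "H3_dist (a *\<^sub>R u) (b *\<^sub>R u) \<le> \<bar>2 * artanh b - 2 * artanh a\<bar>"
  using H3_dist_le[OF H3_length_ray(1,2)[OF assms]] H3_length_ray(3)[OF assms]
  by (simp add: pathstart_def pathfinish_def)

lemma H3_dist_base:
  assumes "x \<in> H3"
  shows "H3_dist H3_base x = 2 * artanh (norm x)"
proof (rule antisym)
  have lt: "norm x < 1" using assms by (simp add: H3_def)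
  obtain u :: "real^3" where u: "norm u = 1" "x = norm x *\<^sub>R u"
  proof (cases "x = 0")
    case True
    thus ?thesis using that[of "axis 1 1"] by simp
  next
    case False
    thus ?thesis using that[of "x /\<^sub>R norm x"] by simp
  qed
  have nn: "0 \<le> artanh (norm x)"
    using lt by (simp add: artanh_def)
  show "H3_dist H3_base x \<le> 2 * artanh (norm x)"
    using H3_dist_ray_le[OF u(1), of 0 "norm x"] lt u(2) nn by (simp add: H3_base_def)
  let ?C = "{c. c C1_differentiable_on {0..1} \<and> path_image c \<subseteq> H3 \<and>
                          pathstart c = H3_base \<and> pathfinish c = x}"
  have "(\<lambda>\<tau>. (0 + \<tau> * (norm x - 0)) *\<^sub>R u) \<in> ?C"
    using H3_length_ray(1,2)[OF u(1), of 0 "norm x"] lt u(2)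
    by (simp add: pathstart_def pathfinish_def H3_base_def)
  hence ne: "H3_length ` ?C \<noteq> {}" by blast
  show "2 * artanh (norm x) \<le> H3_dist H3_base x"
    unfolding H3_dist_def
    by (rule cInf_greatest[OF ne]) (use H3_length_ge in \<open>auto simp: H3_base_def\<close>)
qed

section \<open>The Riemannian measure in geodesic polar coordinates\<close>

text \<open>Agreement on the half-lines \<open>{a<..}\<close> suffices because both measures are
  finite there. On such a half-line one side is a difference of two ball volumes and the other
  integrates \<open>4 * pi * r\<^sup>2\<close>; clamping \<open>a\<close> to the unit interval
  treats all positions of \<open>a\<close> at once.\<close>

lemma distr_norm_unit_ball:
  "distr (restrict_space lborel (ball (0 :: real^3) 1)) borel norm =
     density lborel (\<lambda>r. ennreal (4 * pi * r\<^sup>2 * indicator {0<..<1} r))"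
    (is "?M = ?N")
proof (rule measure_eqI_lessThan)
  have M: "emeasure ?M {a<..} = ennreal (4 / 3 * pi * (1 - (max 0 (min a 1)) ^ 3))" for a
  proof -
    have "emeasure ?M {a<..} = emeasure (restrict_space lborel (ball (0 :: real^3) 1)) ({x. a < norm x} \<inter> ball 0 1)"
      by (subst emeasure_distr)
         (auto intro!: arg_cong2[where f = emeasure] measurable_restrict_space1 simp: space_restrict_space)
    also have "\<dots> = emeasure lborel ({x. a < norm x} \<inter> ball (0 :: real^3) 1)"
      by (subst emeasure_restrict_space) (auto)
    also have "\<dots> = ennreal (4 / 3 * pi * (1 - (max 0 (min a 1)) ^ 3))"
    proof -
      consider "a < 0" | "0 \<le> a" "a < 1" | "1 \<le> a" by linarith
      thus ?thesis
      proof cases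
        case 1
        have "norm x > a" for x :: "real^3" using 1 norm_ge_zero[of x] by linarith
        hence "{x. a < norm x} \<inter> ball (0 :: real^3) 1 = ball 0 1" by auto
        thus ?thesis using 1 by (simp add: emeasure_ball unit_ball_vol_numeral fact_numeral)
      next
        case 2
        have "{x. a < norm x} \<inter> ball (0 :: real^3) 1 = ball 0 1 - cball 0 a" by auto
        moreover have "cball (0 :: real^3) a \<subseteq> ball 0 1" using 2 by auto
        ultimately have "emeasure lborel ({x. a < norm x} \<inter> ball (0 :: real^3) 1) =
            emeasure lborel (ball (0 :: real^3) 1) - emeasure lborel (cball (0 :: real^3) a)"
          using 2 by (simp add: emeasure_Diff emeasure_cball)
        also have "\<dots> = ennreal (4 / 3 * pi * (1 - a ^ 3))"
          using 2 by (simp add: emeasure_ball emeasure_cball unit_ball_vol_numeral fact_numeral ennreal_minus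
              field_simps power3_eq_cube)
        finally show ?thesis using 2 by simp
      next
        case 3
        hence "{x. a < norm x} \<inter> ball (0 :: real^3) 1 = {}" by auto
        thus ?thesis using 3 by simp
      qed
    qed
    finally show ?thesis .
  qed
  show "emeasure ?M {a<..} < \<infinity>" for a by (simp add: M)
  show "emeasure ?M {a<..} = emeasure ?N {a<..}" for a
  proof -
    define b where "b = max 0 (min a 1)"
    have b: "0 \<le> b" "b \<le> 1" by (auto simp: b_def)
    have "emeasure ?N {a<..} = (\<integral>\<^sup>+r. ennreal (4 * pi * r\<^sup>2 * indicator {0<..<1} r) * indicator {a<..} r \<partial>lborel)"
      by (subst emeasure_density) auto
    also have "\<dots> = (\<integral>\<^sup>+r. ennreal (4 * pi * r\<^sup>2) * indicator {b..1} r \<partial>lborel)"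
      by (intro nn_integral_cong_AE eventually_mono[OF AE_lborel_singleton[of 1, THEN AE_conjI, OF AE_lborel_singleton[of b]]])
         (auto simp: b_def indicator_def)
    also have "\<dots> = ennreal (4 / 3 * pi * 1 ^ 3 - 4 / 3 * pi * b ^ 3)"
      using b by (intro nn_integral_FTC_Icc) (auto intro!: derivative_eq_intros)
    finally show ?thesis unfolding M b_def by (simp add: algebra_simps)
  qed
qed auto

lemma measurable_artanh [measurable]: "(artanh :: real \<Rightarrow> real) \<in> borel_measurable borel"
  unfolding artanh_def by measurable

lemma measurable_sinh [measurable]: "(sinh :: real \<Rightarrow> real) \<in> borel_measurable borel"
  by (intro borel_measurable_continuous_onI continuous_intros)

lemma H3_dist_measurable: "H3_dist H3_base \<in> H3_measure \<rightarrow>\<^sub>M borel"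
proof -
  have "(\<lambda>x. 2 * artanh (norm x)) \<in> restrict_space lborel H3 \<rightarrow>\<^sub>M borel"
    by (intro measurable_restrict_space1) measurable
  moreover have "H3_dist H3_base x = 2 * artanh (norm x)" if "x \<in> space (restrict_space lborel H3)" for x
    using that by (simp add: H3_dist_base space_restrict_space)
  ultimately have "H3_dist H3_base \<in> restrict_space lborel H3 \<rightarrow>\<^sub>M borel"
    by (subst measurable_cong)
  thus ?thesis
    unfolding H3_measure_def by simp
qed

text \<open>Substituting \<open>r = tanh (s / 2)\<close> gives
  \<open>2 / (1 - r\<^sup>2) = 2 * (cosh (s / 2))\<^sup>2\<close>, and the double-angle formula
  collects all factors into \<open>4 * pi * (sinh s)\<^sup>2\<close>. The substitution is made on
  compact intervals; monotone convergence reaches the end \<open>r = 1\<close>, which is infinity in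
  \<open>s\<close>.\<close>

lemma nn_integral_artanh_substitution:
  assumes [measurable]: "f \<in> borel_measurable borel"
  shows "(\<integral>\<^sup>+r. f (2 * artanh r) * ennreal ((2 / (1 - r\<^sup>2)) ^ 3 * (4 * pi * r\<^sup>2)) * indicator {0..<1} r \<partial>lborel) =
    (\<integral>\<^sup>+s. f s * ennreal (4 * pi * (sinh s)\<^sup>2) * indicator {0..} s \<partial>lborel)"
proof -
  define F where "F = (\<lambda>r. f (2 * artanh r) * ennreal ((2 / (1 - r\<^sup>2)) ^ 3 * (4 * pi * r\<^sup>2)))"
  define G where "G = (\<lambda>s. f s * ennreal (4 * pi * (sinh s)\<^sup>2))"
  have [measurable]: "F \<in> borel_measurable borel" "G \<in> borel_measurable borel"
    by (simp_all add: F_def G_def)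
  have deriv: "((\<lambda>s. tanh (s / 2)) has_real_derivative (1 - (tanh (s / 2))\<^sup>2) / 2) (at s)" for s :: real
    by (auto intro!: derivative_eq_intros)
  have FG: "F (tanh (s / 2)) * ennreal ((1 - (tanh (s / 2))\<^sup>2) / 2) = G s" for s
  proof -
    define C S where "C = cosh (s / 2)" and "S = sinh (s / 2)"
    have C: "C > 0" by (simp add: C_def)
    have CS: "C\<^sup>2 - S\<^sup>2 = 1" by (simp add: C_def S_def cosh_square_eq)
    have t: "tanh (s / 2) = S / C" by (simp add: tanh_def C_def S_def)
    have "1 - (S / C)\<^sup>2 = (C\<^sup>2 - S\<^sup>2) / C\<^sup>2"
      using C by (simp add: power_divide diff_divide_distrib)
    hence q: "1 - (S / C)\<^sup>2 = 1 / C\<^sup>2" unfolding CS .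
    have sh: "sinh s = 2 * S * C" using sinh_double[of "s / 2"] by (simp add: C_def S_def)
    have "(2 / (1 - (S / C)\<^sup>2)) ^ 3 * (4 * pi * (S / C)\<^sup>2) * ((1 - (S / C)\<^sup>2) / 2) = 4 * pi * (sinh s)\<^sup>2"
      unfolding q sh using C by (simp add: field_simps power_numeral_reduce)
    moreover have "0 \<le> (1 - (S / C)\<^sup>2) / 2" unfolding q by simp
    ultimately show ?thesis
      unfolding F_def G_def t[symmetric]
      by (simp add: artanh_tanh_real mult.assoc ennreal_mult''[symmetric])
  qed
  have eq: "(\<integral>\<^sup>+r. F r * indicator {0..tanh (real (Suc n) / 2)} r \<partial>lborel) =
      (\<integral>\<^sup>+s. G s * indicator {0..real (Suc n)} s \<partial>lborel)" for n
  proof -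
    have "(\<integral>\<^sup>+r. F r * indicator {tanh (0 / 2)..tanh (real (Suc n) / 2)} r \<partial>lborel) =
      (\<integral>\<^sup>+s. F (tanh (s / 2)) * ennreal ((1 - (tanh (s / 2))\<^sup>2) / 2) * indicator {0..real (Suc n)} s \<partial>lborel)"
    proof (rule nn_integral_substitution_aux)
      show "continuous_on {0..real (Suc n)} (\<lambda>s. (1 - (tanh (s / 2))\<^sup>2) / 2)"
        by (intro continuous_intros) auto
      show "0 \<le> (1 - (tanh (s / 2))\<^sup>2) / 2" for s :: real
        using tanh_real_bounds[of "s / 2"] by (simp add: abs_square_le_1 abs_le_iff)
    qed (use deriv in auto)
    thus ?thesis unfolding FG by simp
  qed
  have 1: "(\<lambda>n. \<integral>\<^sup>+r. F r * indicator {0..tanh (real (Suc n) / 2)} r \<partial>lborel)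
      \<longlonglongrightarrow> (\<integral>\<^sup>+r. F r * indicator {0..<1} r \<partial>lborel)"
  proof (rule nn_integral_LIMSEQ)
    show "incseq (\<lambda>n r. F r * indicator {0..tanh (real (Suc n) / 2)} r)"
      by (auto simp: incseq_def le_fun_def indicator_def intro: order_trans[OF _ tanh_real_le_iff[THEN iffD2]])
    show "(\<lambda>n. F r * indicator {0..tanh (real (Suc n) / 2)} r) \<longlonglongrightarrow> F r * indicator {0..<1} r" for r
    proof (cases "0 \<le> r \<and> r < 1")
      case True
      have "((\<lambda>n. tanh (real (Suc n) / 2)) \<longlonglongrightarrow> 1)"
        by (rule filterlim_compose[OF tanh_real_at_top]) real_asymp
      hence "eventually (\<lambda>n. r < tanh (real (Suc n) / 2)) sequentially"
        using True by (intro order_tendstoD) auto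
      hence "eventually (\<lambda>n. F r * indicator {0..tanh (real (Suc n) / 2)} r = F r * indicator {0..<1} r) sequentially"
        by eventually_elim (use True in auto)
      thus ?thesis by (rule tendsto_eventually)
    next
      case False
      have "\<not> (0 \<le> r \<and> r \<le> tanh (real (Suc n) / 2))" for n
        using False tanh_real_lt_1[of "real (Suc n) / 2"] by linarith
      thus ?thesis using False by simp
    qed
  qed auto
  have 2: "(\<lambda>n. \<integral>\<^sup>+s. G s * indicator {0..real (Suc n)} s \<partial>lborel)
      \<longlonglongrightarrow> (\<integral>\<^sup>+s. G s * indicator {0..} s \<partial>lborel)"
  proof (rule nn_integral_LIMSEQ)
    show "incseq (\<lambda>n s. G s * indicator {0..real (Suc n)} s)"
      by (auto simp: incseq_def le_fun_def indicator_def)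
    show "(\<lambda>n. G s * indicator {0..real (Suc n)} s) \<longlonglongrightarrow> G s * indicator {0..} s" for s
    proof -
      have "eventually (\<lambda>n. s \<le> real (Suc n)) sequentially" by real_asymp
      hence "eventually (\<lambda>n. G s * indicator {0..real (Suc n)} s = G s * indicator {0..} s) sequentially"
        by eventually_elim (auto simp: indicator_def)
      thus ?thesis by (rule tendsto_eventually)
    qed
  qed auto
  from LIMSEQ_unique[OF 1 2[folded eq]] show ?thesis unfolding F_def G_def .
qed

lemma distr_H3_dist:
  "distr H3_measure borel (H3_dist H3_base) =
     density lborel (\<lambda>s. ennreal (4 * pi * (sinh s)\<^sup>2 * indicator {0<..} s))" (is "?M = ?N")
proof (rule measure_eqI)
  fix A assume "A \<in> sets ?M"
  hence [measurable]: "A \<in> sets borel" by simp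
  let ?f = "indicator A :: real \<Rightarrow> ennreal"
  let ?w = "\<lambda>r::real. ennreal ((2 / (1 - r\<^sup>2)) ^ 3)"
  have "emeasure ?M A = (\<integral>\<^sup>+x. ?f (H3_dist H3_base x) \<partial>H3_measure)"
    by (subst nn_integral_distr[symmetric, OF H3_dist_measurable]) auto
  also have "\<dots> = (\<integral>\<^sup>+x. ?f (2 * artanh (norm x)) \<partial>H3_measure)"
    by (intro nn_integral_cong) (simp add: H3_measure_def space_restrict_space H3_dist_base)
  also have "\<dots> = (\<integral>\<^sup>+x. ?w (norm x) * ?f (2 * artanh (norm x)) \<partial>restrict_space lborel H3)"
    unfolding H3_measure_def
    by (subst nn_integral_density) (auto intro!: measurable_restrict_space1)
  also have "\<dots> = (\<integral>\<^sup>+r. ?w r * ?f (2 * artanh r) \<partial>distr (restrict_space lborel H3) borel norm)"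
    by (subst nn_integral_distr) (auto intro!: measurable_restrict_space1)
  also have "\<dots> = (\<integral>\<^sup>+r. ennreal (4 * pi * r\<^sup>2 * indicator {0<..<1} r) * (?w r * ?f (2 * artanh r)) \<partial>lborel)"
    unfolding H3_def distr_norm_unit_ball by (subst nn_integral_density) auto
  also have "\<dots> = (\<integral>\<^sup>+r. ?f (2 * artanh r) * ennreal ((2 / (1 - r\<^sup>2)) ^ 3 * (4 * pi * r\<^sup>2)) * indicator {0..<1} r \<partial>lborel)"
    by (intro nn_integral_cong)
       (auto simp: indicator_def abs_square_less_1 ennreal_mult'[symmetric] mult_ac less_le)
  also have "\<dots> = (\<integral>\<^sup>+s. ?f s * ennreal (4 * pi * (sinh s)\<^sup>2) * indicator {0..} s \<partial>lborel)"
    by (rule nn_integral_artanh_substitution) simp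
  also have "\<dots> = (\<integral>\<^sup>+s. ennreal (4 * pi * (sinh s)\<^sup>2 * indicator {0<..} s) * ?f s \<partial>lborel)"
    by (intro nn_integral_cong_AE eventually_mono[OF AE_lborel_singleton[of 0]])
       (auto simp: indicator_def)
  also have "\<dots> = emeasure ?N A" by (subst emeasure_density) auto
  finally show "emeasure ?M A = emeasure ?N A" .
qed simp

section \<open>Plancherel formula for the sine transform\<close>

lemma measurable_cnj [measurable]: "cnj \<in> borel_measurable borel"
  by (intro borel_measurable_continuous_onI continuous_intros)

text \<open>A bounded kernel keeps the product of two integrable functions absolutely integrable on
  the plane, although the kernel itself need not decay. It is applied to the sine kernel, with
  \<open>B = 1\<close>.\<close>

lemma Fubini_bounded_kernel:
  fixes u v :: "real \<Rightarrow> complex" and K :: "real \<Rightarrow> real \<Rightarrow> complex"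
  assumes u: "integrable lborel u" and v: "integrable lborel v"
    and K [measurable]: "case_prod K \<in> borel_measurable (borel \<Otimes>\<^sub>M borel)"
    and B: "\<And>x y. cmod (K x y) \<le> B"
  shows "(LINT x|lborel. u x * (LINT y|lborel. v y * K x y)) =
         (LINT y|lborel. v y * (LINT x|lborel. u x * K x y))"
proof -
  have [measurable]: "u \<in> borel_measurable borel" "v \<in> borel_measurable borel"
    using u v by (auto dest: borel_measurable_integrable)
  have "integrable (lborel \<Otimes>\<^sub>M lborel) (\<lambda>(x, y). u x * v y)"
  proof (rule lborel_pair.Fubini_integrable)
    show "integrable lborel (\<lambda>x. LINT y|lborel. norm (case (x, y) of (x, y) \<Rightarrow> u x * v y))"
      using u by (simp add: norm_mult)
    show "AE x in lborel. integrable lborel (\<lambda>y. case (x, y) of (x, y) \<Rightarrow> u x * v y)"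
      using v by simp
  qed simp
  hence int: "integrable (lborel \<Otimes>\<^sub>M lborel) (\<lambda>p. B *\<^sub>R (case p of (x, y) \<Rightarrow> u x * v y))"
    by (intro integrable_scaleR_right)
  have "integrable (lborel \<Otimes>\<^sub>M lborel) (\<lambda>(x, y). u x * v y * K x y)"
  proof (rule Bochner_Integration.integrable_bound[OF int])
    show "AE p in lborel \<Otimes>\<^sub>M lborel. norm (case p of (x, y) \<Rightarrow> u x * v y * K x y)
      \<le> norm (B *\<^sub>R (case p of (x, y) \<Rightarrow> u x * v y))"
    proof (intro AE_I2, clarify)
      fix x y
      have "cmod (K x y) \<le> \<bar>B\<bar>" using B[of x y] by linarith
      thus "norm (u x * v y * K x y) \<le> norm (B *\<^sub>R (u x * v y))"
        using mult_left_mono[of "cmod (K x y)" "\<bar>B\<bar>" "cmod (u x * v y)"]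
        by (simp add: norm_mult mult_ac)
    qed
  qed simp
  from lborel_pair.Fubini_integral[OF this] show ?thesis
    by (simp add: mult.assoc mult.left_commute[of "u _"] flip: integral_mult_right_zero)
qed

definition sine_transform :: "(real \<Rightarrow> complex) \<Rightarrow> real \<Rightarrow> complex" where
  "sine_transform h s = (LINT l|lborel. h l * of_real (sin (l * s)))"

text \<open>Continuity almost everywhere is what lets Poisson integrals recover \<open>h\<close>
  almost everywhere by dominated convergence. Jumps must be allowed, since the profile jumps at the
  ends of its blocks and a truncated transform may jump at \<open>T\<close>. Truncated sine
  transforms are again in this class.\<close>

definition tame :: "(real \<Rightarrow> complex) \<Rightarrow> bool" where
  "tame h \<longleftrightarrow> h \<in> borel_measurable borel \<and> (\<exists>C. \<forall>x. cmod (h x) \<le> C) \<and>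
     (\<exists>L. \<forall>x. x \<notin> {0..L} \<longrightarrow> h x = 0) \<and> (AE x in lborel. isCont h x)"

lemma tame_integrable:
  assumes "tame h"
  shows "integrable lborel h" "integrable lborel (\<lambda>x. (cmod (h x))\<^sup>2)"
proof -
  obtain C L where [measurable]: "h \<in> borel_measurable borel"
    and C: "\<And>x. cmod (h x) \<le> C" and L: "\<And>x. x \<notin> {0..L} \<Longrightarrow> h x = 0"
    using assms unfolding tame_def by blast
  have C2: "(cmod (h x))\<^sup>2 \<le> C\<^sup>2" for x
    using C[of x] by (intro power_mono) auto
  show "integrable lborel h"
    by (rule integrableI_bounded_set[where A = "{0..L}" and B = C]) (use C L in \<open>auto simp: emeasure_lborel_Icc_eq\<close>)
  show "integrable lborel (\<lambda>x. (cmod (h x))\<^sup>2)"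
    by (rule integrableI_bounded_set[where A = "{0..L}" and B = "C\<^sup>2"]) (use C2 L in \<open>auto simp: emeasure_lborel_Icc_eq\<close>)
qed

lemma sine_transform_bound:
  assumes "integrable lborel h"
  shows "cmod (sine_transform h s) \<le> (LINT l|lborel. cmod (h l))"
proof -
  have [measurable]: "h \<in> borel_measurable borel"
    using assms by (auto dest: borel_measurable_integrable)
  have "cmod (h l * of_real (sin (l * s))) \<le> cmod (h l)" for l
    using mult_left_mono[OF abs_sin_le_one[of "l * s"], of "cmod (h l)"] by (simp add: norm_mult)
  hence "integrable lborel (\<lambda>l. h l * of_real (sin (l * s)))"
    by (intro Bochner_Integration.integrable_bound[OF assms]) auto
  moreover have "cmod (sine_transform h s) \<le> (LINT l|lborel. cmod (h l * of_real (sin (l * s))))"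
    unfolding sine_transform_def by (rule integral_norm_bound)
  moreover have "\<dots> \<le> (LINT l|lborel. cmod (h l))"
    using \<open>integrable lborel (\<lambda>l. h l * _ l)\<close> assms \<open>\<And>l. cmod (h l * _) \<le> _\<close>
    by (intro integral_mono) auto
  ultimately show ?thesis by linarith
qed

lemma isCont_sine_transform:
  assumes "integrable lborel h"
  shows "isCont (sine_transform h) s"
  unfolding continuous_at_sequentially
proof (intro allI impI)
  have [measurable]: "h \<in> borel_measurable borel"
    using assms by (auto dest: borel_measurable_integrable)
  fix x :: "nat \<Rightarrow> real" assume x: "x \<longlonglongrightarrow> s"
  show "(sine_transform h \<circ> x) \<longlonglongrightarrow> sine_transform h s"
    unfolding sine_transform_def o_def
  proof (rule integral_dominated_convergence)
    show "integrable lborel (\<lambda>l. cmod (h l))" using assms by simp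
    show "AE l in lborel. (\<lambda>i. h l * complex_of_real (sin (l * x i))) \<longlonglongrightarrow> h l * complex_of_real (sin (l * s))"
      using x by (intro AE_I2 tendsto_intros)
    show "AE l in lborel. cmod (h l * complex_of_real (sin (l * x i))) \<le> cmod (h l)" for i
    proof (rule AE_I2)
      show "cmod (h l * complex_of_real (sin (l * x i))) \<le> cmod (h l)" for l
        using mult_left_mono[OF abs_sin_le_one[of "l * x i"], of "cmod (h l)"] by (simp add: norm_mult)
    qed
  qed auto
qed

lemma measurable_sine_transform [measurable]:
  assumes "integrable lborel h"
  shows "sine_transform h \<in> borel_measurable borel"
  by (intro borel_measurable_continuous_onI continuous_at_imp_continuous_on ballI isCont_sine_transform assms)

lemma tame_truncated_sine_transform:
  assumes "integrable lborel h"
  shows "tame (\<lambda>s. indicator {0..T} s *\<^sub>R sine_transform h s)"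
  unfolding tame_def
proof (intro conjI)
  have [measurable]: "sine_transform h \<in> borel_measurable borel"
    by (rule measurable_sine_transform) fact
  show "(\<lambda>s. indicator {0..T} s *\<^sub>R sine_transform h s) \<in> borel_measurable borel" by simp
  have "cmod (indicator {0..T} s *\<^sub>R sine_transform h s) \<le> (LINT l|lborel. cmod (h l))" for s
    using order_trans[OF norm_ge_zero sine_transform_bound[OF assms, of s]]
          sine_transform_bound[OF assms, of s]
    by (auto simp: indicator_def)
  thus "\<exists>C. \<forall>x. cmod (indicator {0..T} x *\<^sub>R sine_transform h x) \<le> C" by blast
  show "\<exists>L. \<forall>x. x \<notin> {0..L} \<longrightarrow> indicator {0..T} x *\<^sub>R sine_transform h x = 0"
    by (intro exI[of _ T]) (simp add: indicator_def)
  have "isCont (\<lambda>s. indicator {0..T} s *\<^sub>R sine_transform h s) s" if "s \<noteq> 0" "s \<noteq> T" for s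
  proof -
    have "frontier {0..T} \<subseteq> {0, T}" by (cases "0 \<le> T") (auto simp: frontier_def)
    hence "isCont (indicator {0..T} :: real \<Rightarrow> real) s" using that by (auto simp: isCont_indicator)
    thus ?thesis by (intro isCont_scaleR isCont_sine_transform assms)
  qed
  moreover have "AE s in lborel. s \<noteq> 0 \<and> s \<noteq> T"
    using AE_lborel_singleton[of 0] AE_lborel_singleton[of T] by (rule AE_conjI)
  ultimately show "AE s in lborel. isCont (\<lambda>s. indicator {0..T} s *\<^sub>R sine_transform h s) s"
    by (auto elim!: eventually_mono simp del: AE_conj_iff)
qed

section \<open>Abel damping and the Poisson kernel\<close>

lemma integrable_exp_weight:
  assumes "\<epsilon> > 0"
  shows "integrable lborel (\<lambda>s::real. indicator {0<..} s * exp (- \<epsilon> * s))"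
proof -
  have "(\<integral>\<^sup>+s. ennreal (exp (- \<epsilon> * s)) * indicator {0..} s \<partial>lborel) = ennreal (0 - (- exp (- \<epsilon> * 0) / \<epsilon>))"
  proof (rule nn_integral_FTC_atLeast)
    show "((\<lambda>s. - exp (- \<epsilon> * s) / \<epsilon>) \<longlongrightarrow> 0) at_top" using assms by real_asymp
    show "DERIV (\<lambda>s. - exp (- \<epsilon> * s) / \<epsilon>) s :> exp (- \<epsilon> * s)" for s
      using assms by (auto intro!: derivative_eq_intros)
  qed auto
  hence fin: "(\<integral>\<^sup>+s. ennreal (exp (- \<epsilon> * s)) * indicator {0..} s \<partial>lborel) < \<infinity>" by simp
  have "(\<integral>\<^sup>+s. ennreal (indicator {0<..} s * exp (- \<epsilon> * s)) \<partial>lborel)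
      \<le> (\<integral>\<^sup>+s. ennreal (exp (- \<epsilon> * s)) * indicator {0..} s \<partial>lborel)"
    by (intro nn_integral_mono) (auto simp: indicator_def)
  thus ?thesis
    using fin by (intro integrableI_nonneg) (auto simp: indicator_def)
qed

text \<open>The Poisson kernel of the half-plane without its factor \<open>1 / pi\<close>; its total
  mass is therefore \<open>pi\<close>.\<close>

definition poisson :: "real \<Rightarrow> real \<Rightarrow> real" where
  "poisson \<epsilon> a = \<epsilon> / (\<epsilon>\<^sup>2 + a\<^sup>2)"

lemma measurable_poisson [measurable]: "poisson \<epsilon> \<in> borel_measurable borel"
  unfolding poisson_def by measurable

lemma laplace_cos:
  assumes "\<epsilon> > 0"
  shows "integrable lborel (\<lambda>s. indicator {0<..} s * exp (- \<epsilon> * s) * cos (a * s))"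
    and "(LINT s|lborel. indicator {0<..} s * exp (- \<epsilon> * s) * cos (a * s)) = poisson \<epsilon> a"
proof -
  have nz: "\<epsilon>\<^sup>2 + a\<^sup>2 \<noteq> 0" using assms by (simp add: sum_power2_eq_zero_iff)
  show int: "integrable lborel (\<lambda>s. indicator {0<..} s * exp (- \<epsilon> * s) * cos (a * s))"
    by (rule Bochner_Integration.integrable_bound[OF integrable_exp_weight[OF assms]])
       (auto simp: indicator_def abs_mult mult_left_le)
  \<comment> \<open>The real part of \<open>- exp (- (\<epsilon> - \<i> * a) * s) / (\<epsilon> -
    \<i> * a)\<close>.\<close>
  define F where "F = (\<lambda>s. exp (- \<epsilon> * s) * (a * sin (a * s) - \<epsilon> * cos (a * s)) / (\<epsilon>\<^sup>2 + a\<^sup>2))"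
  have ein: "einterval 0 \<infinity> = {0<..}" by (auto simp: einterval_def zero_ereal_def)
  have "(LBINT s=0..\<infinity>. exp (- \<epsilon> * s) * cos (a * s)) = 0 - (- \<epsilon> / (\<epsilon>\<^sup>2 + a\<^sup>2))"
  proof (rule interval_integral_FTC_integrable)
    show "(F has_vector_derivative exp (- \<epsilon> * s) * cos (a * s)) (at s)" for s
    proof -
      have "((\<lambda>s. exp (- \<epsilon> * s) * (a * sin (a * s) - \<epsilon> * cos (a * s))) has_real_derivative
          exp (- \<epsilon> * s) * cos (a * s) * (\<epsilon>\<^sup>2 + a\<^sup>2)) (at s)"
        by (auto intro!: derivative_eq_intros simp: algebra_simps power2_eq_square)
      from DERIV_cdivide[OF this, of "\<epsilon>\<^sup>2 + a\<^sup>2"]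
      have "(F has_real_derivative exp (- \<epsilon> * s) * cos (a * s) * (\<epsilon>\<^sup>2 + a\<^sup>2) / (\<epsilon>\<^sup>2 + a\<^sup>2)) (at s)"
        unfolding F_def .
      thus ?thesis using nz assms by (simp add: has_real_derivative_iff_has_vector_derivative)
    qed
    show "set_integrable lborel (einterval 0 \<infinity>) (\<lambda>s. exp (- \<epsilon> * s) * cos (a * s))"
      using int unfolding ein set_integrable_def by (simp add: mult.assoc)
    have "isCont F 0" unfolding F_def by (intro continuous_intros) (use nz in auto)
    hence "(F \<longlongrightarrow> F 0) (at_right 0)"
      by (simp add: continuous_at filterlim_at_split)
    thus "((F \<circ> real_of_ereal) \<longlongrightarrow> - \<epsilon> / (\<epsilon>\<^sup>2 + a\<^sup>2)) (at_right 0)"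
      unfolding zero_ereal_def by (simp add: ereal_tendsto_simps F_def)
    have "(F \<longlongrightarrow> 0) at_top"
    proof (rule Lim_null_comparison)
      show "((\<lambda>s. exp (- \<epsilon> * s) * ((\<bar>a\<bar> + \<epsilon>) / (\<epsilon>\<^sup>2 + a\<^sup>2))) \<longlongrightarrow> 0) at_top"
        using assms by (intro tendsto_mult_left_zero) real_asymp
      show "eventually (\<lambda>s. norm (F s) \<le> exp (- \<epsilon> * s) * ((\<bar>a\<bar> + \<epsilon>) / (\<epsilon>\<^sup>2 + a\<^sup>2))) at_top"
      proof (rule always_eventually, rule allI)
        fix s
        have "\<bar>a * sin (a * s)\<bar> \<le> \<bar>a\<bar>" "\<bar>\<epsilon> * cos (a * s)\<bar> \<le> \<epsilon>"
          using assms by (auto simp: abs_mult mult_left_le)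
        hence "\<bar>a * sin (a * s) - \<epsilon> * cos (a * s)\<bar> \<le> \<bar>a\<bar> + \<epsilon>" by linarith
        thus "norm (F s) \<le> exp (- \<epsilon> * s) * ((\<bar>a\<bar> + \<epsilon>) / (\<epsilon>\<^sup>2 + a\<^sup>2))"
          by (simp add: F_def abs_mult divide_right_mono)
      qed
    qed
    thus "((F \<circ> real_of_ereal) \<longlongrightarrow> 0) (at_left \<infinity>)"
      by (simp add: ereal_tendsto_simps)
  qed (auto intro!: continuous_intros)
  thus "(LINT s|lborel. indicator {0<..} s * exp (- \<epsilon> * s) * cos (a * s)) = poisson \<epsilon> a"
    by (simp add: interval_lebesgue_integral_def set_lebesgue_integral_def ein poisson_def mult.assoc)
qed

text \<open>The product formula \<open>2 sin x sin y = cos (x - y) - cos (x + y)\<close> reduces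
  this to two damped cosines. Composed with itself, the damped sine kernel is thus an approximate
  identity minus its reflection at the origin.\<close>

lemma laplace_sin_sin:
  assumes "\<epsilon> > 0"
  shows "(LINT s|lborel. complex_of_real (indicator {0<..} s * exp (- \<epsilon> * s)) * of_real (sin (l * s)) * of_real (sin (m * s))) =
     of_real ((poisson \<epsilon> (l - m) - poisson \<epsilon> (l + m)) / 2)"
proof -
  have "(LINT s|lborel. indicator {0<..} s * exp (- \<epsilon> * s) * sin (l * s) * sin (m * s)) =
    (LINT s|lborel. (indicator {0<..} s * exp (- \<epsilon> * s) * cos ((l - m) * s)
       - indicator {0<..} s * exp (- \<epsilon> * s) * cos ((l + m) * s)) / 2)"
    by (intro Bochner_Integration.integral_cong)
       (auto simp: cos_diff cos_add algebra_simps)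
  also have "\<dots> = (poisson \<epsilon> (l - m) - poisson \<epsilon> (l + m)) / 2"
    using laplace_cos[OF assms] by simp
  finally show ?thesis
    by (simp only: of_real_mult[symmetric] integral_complex_of_real)
qed

lemma integrable_poisson_one: "integrable lborel (poisson 1)"
  and integral_poisson_one: "(LINT v|lborel. poisson 1 v) = pi"
  using integrable_inverse_1_plus_square LBINT_inverse_1_plus_square
  by (simp_all add: poisson_def[abs_def] set_integrable_def interval_lebesgue_integral_def
       set_lebesgue_integral_def divide_inverse)

text \<open>Scaling moves \<open>\<epsilon>\<close> from the kernel into the argument of
  \<open>k\<close>. A bounded \<open>k\<close> then has a multiple of the fixed function
  \<open>poisson 1\<close> as majorant for all \<open>\<epsilon>\<close>.\<close>

lemma poisson_integral_rescale:
  fixes k :: "real \<Rightarrow> complex"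
  assumes "\<epsilon> > 0"
  shows "(LINT m|lborel. k m * of_real (poisson \<epsilon> (x - m))) =
         (LINT v|lborel. k (x + \<epsilon> * v) * of_real (poisson 1 v))"
proof -
  have "\<epsilon> * poisson \<epsilon> (- (\<epsilon> * v)) = poisson 1 v" for v
  proof -
    have "1 + v\<^sup>2 \<noteq> 0" by (simp add: add_nonneg_eq_0_iff)
    moreover have "\<epsilon>\<^sup>2 + (\<epsilon> * v)\<^sup>2 = \<epsilon>\<^sup>2 * (1 + v\<^sup>2)" by (simp add: algebra_simps)
    ultimately show ?thesis using assms by (simp add: poisson_def power2_eq_square)
  qed
  hence *: "\<epsilon> *\<^sub>R (k (x + \<epsilon> * v) * of_real (poisson \<epsilon> (- (\<epsilon> * v)))) =
      k (x + \<epsilon> * v) * of_real (poisson 1 v)" for v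
    by (simp add: scaleR_conv_of_real mult.left_commute flip: of_real_mult)
  show ?thesis
    using assms
    by (subst lborel_integral_real_affine[where c = \<epsilon> and t = x])
       (simp_all add: * flip: integral_scaleR_right)
qed

lemma norm_poisson_integral_le:
  fixes k :: "real \<Rightarrow> complex"
  assumes [measurable]: "k \<in> borel_measurable borel" and C: "\<And>x. cmod (k x) \<le> C" and "\<epsilon> > 0"
  shows "cmod (LINT m|lborel. k m * of_real (poisson \<epsilon> (x - m))) \<le> C * pi"
proof -
  have p: "0 \<le> poisson 1 v" for v by (simp add: poisson_def)
  have b: "cmod (k (x + \<epsilon> * v) * of_real (poisson 1 v)) \<le> C * poisson 1 v" for v
    using C[of "x + \<epsilon> * v"] p[of v] by (simp add: norm_mult mult_right_mono)
  have "cmod (LINT v|lborel. k (x + \<epsilon> * v) * of_real (poisson 1 v)) \<le> (LINT v|lborel. C * poisson 1 v)"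
  proof (rule Bochner_Integration.integral_norm_bound_integral)
    show i: "integrable lborel (\<lambda>v. C * poisson 1 v)" using integrable_poisson_one by simp
    show "integrable lborel (\<lambda>v. k (x + \<epsilon> * v) * of_real (poisson 1 v))"
      by (rule Bochner_Integration.integrable_bound[OF i])
         (auto intro!: AE_I2 order_trans[OF b])
  qed (use b in auto)
  thus ?thesis
    unfolding poisson_integral_rescale[OF assms(3)] by (simp add: integral_poisson_one)
qed

lemma poisson_integral_tendsto:
  fixes k :: "real \<Rightarrow> complex" and \<epsilon> :: "nat \<Rightarrow> real"
  assumes [measurable]: "k \<in> borel_measurable borel" and C: "\<And>x. cmod (k x) \<le> C"
    and "isCont k x" and "\<And>n. \<epsilon> n > 0" and "\<epsilon> \<longlonglongrightarrow> 0"
  shows "(\<lambda>n. LINT m|lborel. k m * of_real (poisson (\<epsilon> n) (x - m))) \<longlonglongrightarrow> of_real pi * k x"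
proof -
  have p: "0 \<le> poisson 1 v" for v by (simp add: poisson_def)
  have "(\<lambda>n. LINT v|lborel. k (x + \<epsilon> n * v) * of_real (poisson 1 v)) \<longlonglongrightarrow> (LINT v|lborel. k x * of_real (poisson 1 v))"
  proof (rule integral_dominated_convergence)
    show "integrable lborel (\<lambda>v. C * poisson 1 v)" using integrable_poisson_one by simp
    show "AE v in lborel. (\<lambda>n. k (x + \<epsilon> n * v) * of_real (poisson 1 v)) \<longlonglongrightarrow> k x * of_real (poisson 1 v)"
    proof (intro AE_I2 tendsto_intros isCont_tendsto_compose[OF assms(3)])
      fix v
      show "(\<lambda>n. x + \<epsilon> n * v) \<longlonglongrightarrow> x"
        using tendsto_add[OF tendsto_const[of x] tendsto_mult_left_zero[OF assms(5), of v]] by simp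
    qed
    show "AE v in lborel. cmod (k (x + \<epsilon> n * v) * of_real (poisson 1 v)) \<le> C * poisson 1 v" for n
      using C p by (auto simp: norm_mult mult_right_mono)
  qed auto
  thus ?thesis
    by (simp add: poisson_integral_rescale assms(4) integral_poisson_one mult.commute)
qed

text \<open>The factor \<open>exp (- \<epsilon> * s)\<close> makes all integrals absolutely
  convergent, and Fubini turns the damped square norm into \<open>h\<close> paired with the Poisson
  integral of its conjugate at \<open>l\<close> minus that at \<open>- l\<close>. As
  \<open>\<epsilon>\<close> tends to 0 the former tends to \<open>pi * cnj (h l)\<close> almost
  everywhere; the latter vanishes because \<open>h\<close> is carried by the positive half-line. On
  the other side monotone convergence removes the damping and yields integrability along with the
  value.\<close>

lemma sine_transform_plancherel:
  assumes "tame h"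
  shows "integrable lborel (\<lambda>s. indicator {0<..} s * (cmod (sine_transform h s))\<^sup>2)"
    and "(LINT s|lborel. indicator {0<..} s * (cmod (sine_transform h s))\<^sup>2) =
         pi / 2 * (LINT l|lborel. (cmod (h l))\<^sup>2)"
proof -
  obtain C L where [measurable]: "h \<in> borel_measurable borel"
    and C: "\<And>x. cmod (h x) \<le> C" and L: "\<And>x. x \<notin> {0..L} \<Longrightarrow> h x = 0"
    and cont: "AE x in lborel. isCont h x"
    using assms unfolding tame_def by blast
  note hint = tame_integrable(1)[OF assms]
  define S where "S = sine_transform h"
  have [measurable]: "S \<in> borel_measurable borel"
    unfolding S_def by (rule measurable_sine_transform) fact
  define D where "D = (LINT l|lborel. cmod (h l))"
  have D: "cmod (S s) \<le> D" for s
    unfolding S_def D_def by (rule sine_transform_bound[OF hint])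
  have cnjS: "cnj (S s) = (LINT m|lborel. cnj (h m) * of_real (sin (m * s)))" for s
  proof -
    have "cnj (S s) = (LINT m|lborel. cnj (h m * of_real (sin (m * s))))"
      unfolding S_def sine_transform_def by (rule Bochner_Integration.integral_cnj[symmetric])
    thus ?thesis by simp
  qed
  have cnjh: "integrable lborel (\<lambda>m. cnj (h m))" using hint by simp
  define w where "w = (\<lambda>\<epsilon> s::real. complex_of_real (indicator {0<..} s * exp (- \<epsilon> * s)))"
  have [measurable]: "w \<epsilon> \<in> borel_measurable borel" for \<epsilon> unfolding w_def by measurable
  have w_int: "integrable lborel (w \<epsilon>)" if "\<epsilon> > 0" for \<epsilon>
    unfolding w_def using integrable_exp_weight[OF that] by (rule integrable_of_real)
  have w_mult: "integrable lborel (\<lambda>s. w \<epsilon> s * k s)"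
    if "\<epsilon> > 0" and [measurable]: "k \<in> borel_measurable borel" and "\<And>s. cmod (k s) \<le> B" for \<epsilon> k B
  proof (rule Bochner_Integration.integrable_bound)
    show "integrable lborel (\<lambda>s. B *\<^sub>R w \<epsilon> s)" using w_int[OF that(1)] by simp
    show "AE s in lborel. norm (w \<epsilon> s * k s) \<le> norm (B *\<^sub>R w \<epsilon> s)"
    proof (rule AE_I2)
      fix s
      have "cmod (k s) \<le> \<bar>B\<bar>" using that(3)[of s] by linarith
      thus "norm (w \<epsilon> s * k s) \<le> norm (B *\<^sub>R w \<epsilon> s)"
        using mult_left_mono[of "cmod (k s)" "\<bar>B\<bar>" "cmod (w \<epsilon> s)"] by (simp add: norm_mult mult.commute)
    qed
  qed simp
  have sin_le: "cmod (of_real (sin x)) \<le> 1" for x by simp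
  define b where "b = (\<lambda>\<epsilon> l. LINT m|lborel. cnj (h m) * of_real (poisson \<epsilon> (l - m)))"
  have reg: "(LINT s|lborel. w \<epsilon> s * (S s * cnj (S s))) =
     (LINT l|lborel. h l * ((b \<epsilon> l - b \<epsilon> (- l)) / 2))" if \<epsilon>: "\<epsilon> > 0" for \<epsilon>
  proof -
    have "(LINT s|lborel. w \<epsilon> s * (S s * cnj (S s))) =
      (LINT s|lborel. (w \<epsilon> s * cnj (S s)) * (LINT l|lborel. h l * of_real (sin (l * s))))"
      by (simp add: S_def sine_transform_def mult_ac)
    also have "\<dots> = (LINT l|lborel. h l * (LINT s|lborel. (w \<epsilon> s * cnj (S s)) * of_real (sin (l * s))))"
      by (rule Fubini_bounded_kernel[OF w_mult hint, where B = 1]) (use \<epsilon> D in auto)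
    also have "\<dots> = (LINT l|lborel. h l * ((b \<epsilon> l - b \<epsilon> (- l)) / 2))"
    proof (intro Bochner_Integration.integral_cong refl arg_cong2[where f = "(*)"])
      fix l
      have "(LINT s|lborel. (w \<epsilon> s * cnj (S s)) * of_real (sin (l * s))) =
        (LINT s|lborel. (w \<epsilon> s * of_real (sin (l * s))) * (LINT m|lborel. cnj (h m) * of_real (sin (m * s))))"
        by (simp add: cnjS mult_ac)
      also have "\<dots> = (LINT m|lborel. cnj (h m) * (LINT s|lborel. (w \<epsilon> s * of_real (sin (l * s))) * of_real (sin (m * s))))"
        by (rule Fubini_bounded_kernel[OF w_mult[where B = 1] cnjh, where B = 1]) (use \<epsilon> in auto)
      also have "\<dots> = (LINT m|lborel. (cnj (h m) * of_real (poisson \<epsilon> (l - m)) - cnj (h m) * of_real (poisson \<epsilon> (- l - m))) / 2)"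
      proof (rule Bochner_Integration.integral_cong[OF refl])
        fix m
        have "poisson \<epsilon> (l + m) = poisson \<epsilon> (- l - m)"
          by (simp add: poisson_def power2_eq_square algebra_simps)
        thus "cnj (h m) * (LINT s|lborel. (w \<epsilon> s * of_real (sin (l * s))) * of_real (sin (m * s))) =
           (cnj (h m) * of_real (poisson \<epsilon> (l - m)) - cnj (h m) * of_real (poisson \<epsilon> (- l - m))) / 2"
          unfolding w_def laplace_sin_sin[OF \<epsilon>] by (simp add: algebra_simps)
      qed
      also have "\<dots> = (b \<epsilon> l - b \<epsilon> (- l)) / 2"
      proof -
        have "integrable lborel (\<lambda>m. cnj (h m) * of_real (poisson \<epsilon> (x - m)))" for x
        proof (rule Bochner_Integration.integrable_bound)
          show "integrable lborel (\<lambda>m. (1 / \<epsilon>) *\<^sub>R cnj (h m))" using cnjh by simp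
          have "poisson \<epsilon> a \<le> 1 / \<epsilon>" "0 \<le> poisson \<epsilon> a" for a
          proof -
            have "\<epsilon> / (\<epsilon>\<^sup>2 + a\<^sup>2) \<le> \<epsilon> / \<epsilon>\<^sup>2"
              using \<epsilon> by (intro divide_left_mono) (auto intro!: mult_pos_pos add_pos_nonneg)
            thus "poisson \<epsilon> a \<le> 1 / \<epsilon>" using \<epsilon> by (simp add: poisson_def power2_eq_square)
            show "0 \<le> poisson \<epsilon> a" using \<epsilon> by (simp add: poisson_def)
          qed
          hence "cmod (cnj (h m)) * poisson \<epsilon> a \<le> cmod (cnj (h m)) * (1 / \<epsilon>)" "\<bar>poisson \<epsilon> a\<bar> = poisson \<epsilon> a" for m a
            using mult_left_mono[of "poisson \<epsilon> a" "1 / \<epsilon>" "cmod (cnj (h m))"] by auto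
          thus "AE m in lborel. norm (cnj (h m) * of_real (poisson \<epsilon> (x - m))) \<le> norm ((1 / \<epsilon>) *\<^sub>R cnj (h m))"
            using \<epsilon> by (auto simp: norm_mult)
        qed simp
        thus ?thesis unfolding b_def by simp
      qed
      finally show "(LINT s|lborel. (w \<epsilon> s * cnj (S s)) * of_real (sin (l * s))) = (b \<epsilon> l - b \<epsilon> (- l)) / 2" .
    qed
    finally show ?thesis .
  qed
  \<comment> \<open>A decreasing sequence, so that the damped integrands increase with
    \<open>n\<close>.\<close>
  define e where "e = (\<lambda>n. inverse (real (Suc n)))"
  have e: "e n > 0" for n by (simp add: e_def)
  have e0: "e \<longlonglongrightarrow> 0" unfolding e_def by (rule LIMSEQ_inverse_real_of_nat)
  have "(\<lambda>n. LINT l|lborel. h l * ((b (e n) l - b (e n) (- l)) / 2))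
      \<longlonglongrightarrow> (LINT l|lborel. h l * (of_real pi * cnj (h l) / 2))"
  proof (rule integral_dominated_convergence)
    show "integrable lborel (\<lambda>l. cmod (h l) * (C * pi))" using hint by simp
    have bb: "cmod (b (e n) x) \<le> C * pi" for n x
      unfolding b_def by (rule norm_poisson_integral_le) (use C e in auto)
    show "AE l in lborel. cmod (h l * ((b (e n) l - b (e n) (- l)) / 2)) \<le> cmod (h l) * (C * pi)" for n
    proof (rule AE_I2)
      fix l
      have "cmod ((b (e n) l - b (e n) (- l)) / 2) \<le> C * pi"
        using norm_triangle_ineq4[of "b (e n) l" "b (e n) (- l)"] bb[of n l] bb[of n "- l"]
        by (simp add: norm_divide)
      thus "cmod (h l * ((b (e n) l - b (e n) (- l)) / 2)) \<le> cmod (h l) * (C * pi)"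
        unfolding norm_mult by (intro mult_left_mono) auto
    qed
    show "AE l in lborel. (\<lambda>n. h l * ((b (e n) l - b (e n) (- l)) / 2)) \<longlonglongrightarrow> h l * (of_real pi * cnj (h l) / 2)"
      using cont AE_lborel_singleton[of 0]
    proof eventually_elim
      case (elim l)
      show ?case
      proof (cases "l < 0")
        case True
        hence "h l = 0" using L by auto
        thus ?thesis by simp
      next
        case False
        hence l: "l > 0" using elim by simp
        \<comment> \<open>The function may jump at 0, but it vanishes in a whole neighbourhood of
          \<open>- l\<close>, so the reflected Poisson integral converges to 0.\<close>
        have "eventually (\<lambda>x. x \<in> {..<0}) (nhds (- l))"
          using l by (intro eventually_nhds_in_open) auto
        hence "eventually (\<lambda>x. cnj (h x) = 0) (nhds (- l))"
          by eventually_elim (use L in auto)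
        hence "isCont (\<lambda>x. cnj (h x)) (- l)"
          by (subst isCont_cong[where g = "\<lambda>_. 0"]) auto
        hence "(\<lambda>n. b (e n) (- l)) \<longlonglongrightarrow> of_real pi * cnj (h (- l))"
          unfolding b_def by (intro poisson_integral_tendsto[where C = C]) (use C e e0 in auto)
        moreover have "(\<lambda>n. b (e n) l) \<longlonglongrightarrow> of_real pi * cnj (h l)"
          unfolding b_def using elim by (intro poisson_integral_tendsto[where C = C]) (use C e e0 in auto)
        moreover have "h (- l) = 0" using L l by auto
        ultimately show ?thesis
          by (auto intro!: tendsto_eq_intros)
      qed
    qed
  qed (auto simp: b_def)
  moreover have "(LINT l|lborel. h l * (of_real pi * cnj (h l) / 2)) =
     of_real (pi / 2 * (LINT l|lborel. (cmod (h l))\<^sup>2))"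
  proof -
    have "(LINT l|lborel. h l * (of_real pi * cnj (h l) / 2)) = (LINT l|lborel. of_real (pi / 2 * (cmod (h l))\<^sup>2))"
      by (intro Bochner_Integration.integral_cong refl) (simp add: complex_norm_square del: of_real_power)
    thus ?thesis by (simp only: integral_complex_of_real integral_mult_right_zero)
  qed
  moreover have "(LINT s|lborel. w (e n) s * (S s * cnj (S s))) =
     of_real (LINT s|lborel. indicator {0<..} s * exp (- e n * s) * (cmod (S s))\<^sup>2)" for n
    unfolding w_def complex_norm_square[symmetric] of_real_mult[symmetric] integral_complex_of_real ..
  ultimately have "(\<lambda>n. complex_of_real (LINT s|lborel. indicator {0<..} s * exp (- e n * s) * (cmod (S s))\<^sup>2))
      \<longlonglongrightarrow> of_real (pi / 2 * (LINT l|lborel. (cmod (h l))\<^sup>2))"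
    by (simp add: reg[OF e])
  hence lim: "(\<lambda>n. LINT s|lborel. indicator {0<..} s * exp (- e n * s) * (cmod (S s))\<^sup>2)
      \<longlonglongrightarrow> pi / 2 * (LINT l|lborel. (cmod (h l))\<^sup>2)"
    by (simp only: tendsto_of_real_iff)
  have int: "integrable lborel (\<lambda>s. indicator {0<..} s * exp (- e n * s) * (cmod (S s))\<^sup>2)" for n
  proof (rule Bochner_Integration.integrable_bound)
    show "integrable lborel (\<lambda>s. indicator {0<..} s * exp (- e n * s) * D\<^sup>2)"
      using integrable_exp_weight[OF e] by simp
    have "(cmod (S s))\<^sup>2 \<le> D\<^sup>2" for s using D[of s] by (intro power_mono) auto
    thus "AE s in lborel. norm (indicator {0<..} s * exp (- e n * s) * (cmod (S s))\<^sup>2)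
       \<le> norm (indicator {0<..} s * exp (- e n * s) * D\<^sup>2)"
      by (auto simp: abs_mult intro!: mult_left_mono)
  qed simp
  have mono: "AE s in lborel. mono (\<lambda>n. indicator {0<..} s * exp (- e n * s) * (cmod (S s))\<^sup>2)"
  proof (intro AE_I2 monoI)
    fix s :: real and m n :: nat assume "m \<le> n"
    hence "e n \<le> e m" by (simp add: e_def)
    thus "indicator {0<..} s * exp (- e m * s) * (cmod (S s))\<^sup>2 \<le> indicator {0<..} s * exp (- e n * s) * (cmod (S s))\<^sup>2"
      by (auto simp: indicator_def intro!: mult_right_mono)
  qed
  have pw: "AE s in lborel. (\<lambda>n. indicator {0<..} s * exp (- e n * s) * (cmod (S s))\<^sup>2) \<longlonglongrightarrow> indicator {0<..} s * (cmod (S s))\<^sup>2"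
  proof (rule AE_I2)
    fix s
    have "(\<lambda>n. indicator {0<..} s * exp (- e n * s) * (cmod (S s))\<^sup>2) \<longlonglongrightarrow> indicator {0<..} s * exp (- 0 * s) * (cmod (S s))\<^sup>2"
      by (intro tendsto_intros e0)
    thus "(\<lambda>n. indicator {0<..} s * exp (- e n * s) * (cmod (S s))\<^sup>2) \<longlonglongrightarrow> indicator {0<..} s * (cmod (S s))\<^sup>2"
      by simp
  qed
  show "integrable lborel (\<lambda>s. indicator {0<..} s * (cmod (sine_transform h s))\<^sup>2)"
    unfolding S_def[symmetric]
    by (rule integrable_monotone_convergence[OF int mono pw lim]) measurable
  show "(LINT s|lborel. indicator {0<..} s * (cmod (sine_transform h s))\<^sup>2) =
         pi / 2 * (LINT l|lborel. (cmod (h l))\<^sup>2)"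
    unfolding S_def[symmetric]
    by (rule integral_monotone_convergence[OF int mono pw lim]) measurable
qed

lemma nn_sine_transform_plancherel:
  assumes "tame h"
  shows "(\<integral>\<^sup>+s. ennreal (indicator {0<..} s * (cmod (sine_transform h s))\<^sup>2) \<partial>lborel) =
         ennreal (pi / 2) * (\<integral>\<^sup>+l. ennreal ((cmod (h l))\<^sup>2) \<partial>lborel)"
  using sine_transform_plancherel[OF assms] tame_integrable(2)[OF assms]
  by (simp add: nn_integral_eq_integral ennreal_mult'[symmetric])

text \<open>Since the sine transform is symmetric, Plancherel's formula for the truncated transform
  already gives the \<open>L\<^sup>2\<close> distance between the truncated inversion integral and \<open>h\<close>.\<close>

lemma sine_transform_inversion_error:
  assumes h: "tame h" and T: "0 \<le> T"
  defines "\<Psi> \<equiv> \<lambda>s. indicator {0..T} s *\<^sub>R sine_transform h s"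
  shows "(\<integral>\<^sup>+l. ennreal (indicator {0<..} l * (cmod (sine_transform \<Psi> l - of_real (pi / 2) * h l))\<^sup>2) \<partial>lborel) =
         ennreal (pi / 2) * (\<integral>\<^sup>+s. ennreal (indicator {T<..} s * (cmod (sine_transform h s))\<^sup>2) \<partial>lborel)"
proof -
  define S where "S = sine_transform h"
  define Q where "Q = sine_transform \<Psi>"
  note hint = tame_integrable(1)[OF h]
  have \<Psi>: "tame \<Psi>" unfolding \<Psi>_def by (rule tame_truncated_sine_transform[OF hint])
  note \<Psi>int = tame_integrable(1)[OF \<Psi>]
  obtain L where [measurable]: "h \<in> borel_measurable borel" and L: "\<And>x. x \<notin> {0..L} \<Longrightarrow> h x = 0"
    using h unfolding tame_def by blast
  have [measurable]: "Q \<in> borel_measurable borel" "S \<in> borel_measurable borel"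
    using hint \<Psi>int by (auto simp: Q_def S_def)
  note PS = sine_transform_plancherel[OF h, folded S_def]
  note PQ = sine_transform_plancherel[OF \<Psi>, folded Q_def]
  have \<Psi>S: "(cmod (\<Psi> s))\<^sup>2 = indicator {0..T} s * (cmod (S s))\<^sup>2" for s
    by (simp add: \<Psi>_def S_def indicator_def)
  have cnjS: "cnj (S s) = (LINT m|lborel. cnj (h m) * of_real (sin (m * s)))" for s
  proof -
    have "cnj (S s) = (LINT m|lborel. cnj (h m * of_real (sin (m * s))))"
      unfolding S_def sine_transform_def by (rule Bochner_Integration.integral_cnj[symmetric])
    thus ?thesis by simp
  qed
  \<comment> \<open>The mixed term of the square: by symmetry of the kernel, the pairing of
    \<open>h\<close> with the transform of \<open>\<Psi>\<close> is the pairing of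
    \<open>\<Psi>\<close> with the transform of \<open>h\<close>, and \<open>\<Psi>\<close> is a
    restriction of the latter.\<close>
  have "(LINT l|lborel. cnj (h l) * Q l) = (LINT l|lborel. cnj (h l) * (LINT s|lborel. \<Psi> s * of_real (sin (l * s))))"
    by (simp add: Q_def sine_transform_def mult.commute[of _ "_ :: real"])
  also have "\<dots> = (LINT s|lborel. \<Psi> s * (LINT l|lborel. cnj (h l) * of_real (sin (l * s))))"
    by (rule Fubini_bounded_kernel[where B = 1]) (use hint \<Psi>int in auto)
  also have "\<dots> = (LINT s|lborel. of_real ((cmod (\<Psi> s))\<^sup>2))"
  proof (rule Bochner_Integration.integral_cong[OF refl])
    fix s
    have "\<Psi> s * (LINT l|lborel. cnj (h l) * of_real (sin (l * s))) = \<Psi> s * cnj (S s)"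
      by (simp add: cnjS)
    also have "\<dots> = \<Psi> s * cnj (\<Psi> s)" by (auto simp: \<Psi>_def S_def indicator_def)
    finally show "\<Psi> s * (LINT l|lborel. cnj (h l) * of_real (sin (l * s))) = of_real ((cmod (\<Psi> s))\<^sup>2)"
      by (simp add: complex_norm_square del: of_real_power)
  qed
  also have "\<dots> = of_real (LINT s|lborel. (cmod (\<Psi> s))\<^sup>2)" by (rule integral_complex_of_real)
  finally have cross: "(LINT l|lborel. cnj (h l) * Q l) = of_real (LINT s|lborel. (cmod (\<Psi> s))\<^sup>2)" .
  have cint: "integrable lborel (\<lambda>l. cnj (h l) * Q l)"
  proof (rule Bochner_Integration.integrable_bound)
    show "integrable lborel (\<lambda>l. (LINT l|lborel. cmod (\<Psi> l)) *\<^sub>R h l)" using hint by simp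
    show "AE l in lborel. norm (cnj (h l) * Q l) \<le> norm ((LINT l|lborel. cmod (\<Psi> l)) *\<^sub>R h l)"
    proof (rule AE_I2)
      fix l
      have "cmod (Q l) \<le> \<bar>LINT l|lborel. cmod (\<Psi> l)\<bar>"
        using sine_transform_bound[OF \<Psi>int, of l] unfolding Q_def by linarith
      thus "norm (cnj (h l) * Q l) \<le> norm ((LINT l|lborel. cmod (\<Psi> l)) *\<^sub>R h l)"
        using mult_right_mono[of "cmod (Q l)" "\<bar>LINT l|lborel. cmod (\<Psi> l)\<bar>" "cmod (h l)"]
        by (simp add: norm_mult mult.commute)
    qed
  qed simp
  have Reint: "integrable lborel (\<lambda>l. Re (cnj (h l) * Q l))"
    and Recross: "(LINT l|lborel. Re (cnj (h l) * Q l)) = (LINT s|lborel. (cmod (\<Psi> s))\<^sup>2)"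
    using integrable_Re[OF cint] integral_Re[OF cint] by (simp_all only: cross Re_complex_of_real)
  \<comment> \<open>For negative \<open>l\<close> both sides are 0 since \<open>h\<close> vanishes;
    at 0 the value of \<open>h\<close> is arbitrary, hence the exception.\<close>
  have expand: "indicator {0<..} l * (cmod (Q l - of_real (pi / 2) * h l))\<^sup>2 =
      indicator {0<..} l * (cmod (Q l))\<^sup>2 - pi * Re (cnj (h l) * Q l) + pi\<^sup>2 / 4 * (cmod (h l))\<^sup>2"
    if "l \<noteq> 0" for l
  proof (cases "l > 0")
    case True
    thus ?thesis
      by (simp add: cmod_power2) (simp add: power2_eq_square algebra_simps)
  next
    case False
    hence "h l = 0" using L[of l] that by auto
    thus ?thesis using False by simp
  qed
  have int1: "integrable lborel (\<lambda>l. indicator {0<..} l * (cmod (Q l))\<^sup>2 - pi * Re (cnj (h l) * Q l) + pi\<^sup>2 / 4 * (cmod (h l))\<^sup>2)"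
    using PQ(1) Reint tame_integrable(2)[OF h] by simp
  have \<Psi>2: "integrable lborel (\<lambda>s. (cmod (\<Psi> s))\<^sup>2)" by (rule tame_integrable(2)[OF \<Psi>])
  have tail: "indicator {T<..} s * (cmod (S s))\<^sup>2 = indicator {0<..} s * (cmod (S s))\<^sup>2 - (cmod (\<Psi> s))\<^sup>2"
    if "s \<noteq> 0" for s
    using that T by (auto simp: \<Psi>S indicator_def)
  have "(\<integral>\<^sup>+l. ennreal (indicator {0<..} l * (cmod (Q l - of_real (pi / 2) * h l))\<^sup>2) \<partial>lborel) =
     (\<integral>\<^sup>+l. ennreal (indicator {0<..} l * (cmod (Q l))\<^sup>2 - pi * Re (cnj (h l) * Q l) + pi\<^sup>2 / 4 * (cmod (h l))\<^sup>2) \<partial>lborel)"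
    by (intro nn_integral_cong_AE eventually_mono[OF AE_lborel_singleton[of 0]]) (rule arg_cong[where f = ennreal, OF expand])
  also have "\<dots> = ennreal (LINT l|lborel. (indicator {0<..} l * (cmod (Q l))\<^sup>2 - pi * Re (cnj (h l) * Q l) + pi\<^sup>2 / 4 * (cmod (h l))\<^sup>2))"
  proof (rule nn_integral_eq_integral[OF int1])
    show "AE l in lborel. 0 \<le> indicator {0<..} l * (cmod (Q l))\<^sup>2 - pi * Re (cnj (h l) * Q l) + pi\<^sup>2 / 4 * (cmod (h l))\<^sup>2"
      by (intro eventually_mono[OF AE_lborel_singleton[of 0]]) (subst expand[symmetric], auto)
  qed
  also have "(LINT l|lborel. (indicator {0<..} l * (cmod (Q l))\<^sup>2 - pi * Re (cnj (h l) * Q l) + pi\<^sup>2 / 4 * (cmod (h l))\<^sup>2)) =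
     (LINT l|lborel. indicator {0<..} l * (cmod (Q l))\<^sup>2) - pi * (LINT l|lborel. Re (cnj (h l) * Q l)) + pi\<^sup>2 / 4 * (LINT l|lborel. (cmod (h l))\<^sup>2)"
    using PQ(1) Reint tame_integrable(2)[OF h] by simp
  \<comment> \<open>With \<open>X\<close> the square norm of \<open>\<Psi>\<close> and
    \<open>Y\<close> that of the transform on the half-line, the three terms are
    \<open>pi / 2 * X - pi * X + pi / 2 * Y\<close>.\<close>
  also have "\<dots> = pi / 2 * ((LINT s|lborel. indicator {0<..} s * (cmod (S s))\<^sup>2) - (LINT s|lborel. (cmod (\<Psi> s))\<^sup>2))"
    unfolding PQ(2) PS(2) Recross by (simp add: field_simps power2_eq_square)
  also have "\<dots> = pi / 2 * (LINT s|lborel. (indicator {0<..} s * (cmod (S s))\<^sup>2 - (cmod (\<Psi> s))\<^sup>2))"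
    using PS(1) \<Psi>2 by simp
  also have "ennreal \<dots> = ennreal (pi / 2) * (\<integral>\<^sup>+s. ennreal (indicator {0<..} s * (cmod (S s))\<^sup>2 - (cmod (\<Psi> s))\<^sup>2) \<partial>lborel)"
  proof (subst nn_integral_eq_integral)
    show "integrable lborel (\<lambda>s. indicator {0<..} s * (cmod (S s))\<^sup>2 - (cmod (\<Psi> s))\<^sup>2)"
      using PS(1) \<Psi>2 by simp
    show "AE s in lborel. 0 \<le> indicator {0<..} s * (cmod (S s))\<^sup>2 - (cmod (\<Psi> s))\<^sup>2"
      by (intro eventually_mono[OF AE_lborel_singleton[of 0]]) (subst tail[symmetric], auto)
  qed (rule ennreal_mult', simp)
  also have "\<dots> = ennreal (pi / 2) * (\<integral>\<^sup>+s. ennreal (indicator {T<..} s * (cmod (S s))\<^sup>2) \<partial>lborel)"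
    by (intro arg_cong2[where f = "(*)"] refl nn_integral_cong_AE eventually_mono[OF AE_lborel_singleton[of 0]])
       (rule arg_cong[where f = ennreal, OF tail[symmetric]])
  finally show ?thesis unfolding Q_def S_def .
qed

section \<open>Focusing points, growth of the blocks, oscillatory integrals\<close>

text \<open>The points come in rounds. Round \<open>n\<close> runs through a grid of
  \<open>[c1, c2]\<close> with mesh below \<open>\<delta> n = \<gamma> (1 / (n + 2))\<close>, and
  its times decrease within \<open>(1 / (n + 2), 1 / (n + 1)]\<close>. By monotonicity the aperture
  stays above \<open>\<delta> n\<close> throughout the round, so every radius is hit once per round,
  however thin the region is.\<close>

lemma focusing_sequence:
  fixes \<gamma> :: "real \<Rightarrow> real"
  assumes mono: "strict_mono_on {0..} \<gamma>" and "\<gamma> 0 = 0" and "c1 < c2"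
  obtains \<sigma> t :: "nat \<Rightarrow> real" where
    "\<And>k. c1 \<le> \<sigma> k" "\<And>k. \<sigma> k \<le> c2" "\<And>k. 0 < t k" "\<And>k. t (Suc k) < t k" "t \<longlonglongrightarrow> 0"
    "\<And>s K. s \<in> {c1..c2} \<Longrightarrow> \<exists>k\<ge>K. \<bar>\<sigma> k - s\<bar> < \<gamma> (t k)"
proof -
  define \<delta> where "\<delta> = (\<lambda>n. \<gamma> (1 / (real n + 2)))"
  have \<delta>: "\<delta> n > 0" for n
    using strict_mono_onD[OF mono, of 0 "1 / (real n + 2)"] \<open>\<gamma> 0 = 0\<close> by (simp add: \<delta>_def)
  define m where "m = (\<lambda>n. Suc (nat \<lceil>(c2 - c1) / \<delta> n\<rceil>))"
  have m: "(c2 - c1) / real (m n) < \<delta> n" for n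
  proof -
    have "(c2 - c1) / \<delta> n < real (m n)" unfolding m_def by linarith
    thus ?thesis using \<delta>[of n] by (simp add: m_def field_simps)
  qed
  \<comment> \<open>Lexicographic enumeration of the pairs of a round \<open>n\<close> and a grid
    index \<open>i < m n\<close>.\<close>
  define q where "q = rec_nat (0::nat, 0::nat)
      (\<lambda>_ (n, i). if Suc i < m n then (n, Suc i) else (Suc n, 0))"
  have q0: "q 0 = (0, 0)" by (simp add: q_def)
  have qS: "q (Suc k) = (case q k of (n, i) \<Rightarrow> if Suc i < m n then (n, Suc i) else (Suc n, 0))" for k
    by (simp add: q_def)
  have im: "snd (q k) < m (fst (q k))" for k
    by (induction k) (auto simp: q0 qS m_def split: prod.splits)
  have hit: "\<exists>k. q k = (n, i)" if "i < m n" for n i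
    using that
  proof (induction n arbitrary: i)
    case 0
    thus ?case
    proof (induction i)
      case (Suc i)
      then obtain k where "q k = (0, i)" by force
      thus ?case using Suc by (intro exI[of _ "Suc k"]) (simp add: qS)
    qed (use q0 in blast)
  next
    case (Suc n)
    show ?case using Suc.prems
    proof (induction i)
      case 0
      have "m n - 1 < m n" by (simp add: m_def)
      then obtain k where "q k = (n, m n - 1)" using Suc.IH by blast
      thus ?case by (intro exI[of _ "Suc k"]) (simp add: qS m_def)
    next
      case (Suc i)
      then obtain k where "q k = (Suc n, i)" by force
      thus ?case using Suc by (intro exI[of _ "Suc k"]) (simp add: qS)
    qed
  qed
  define \<sigma> where "\<sigma> = (\<lambda>k. case q k of (n, i) \<Rightarrow> c1 + (c2 - c1) * (real i / real (m n)))"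
  define t where "t = (\<lambda>k. case q k of (n, i) \<Rightarrow> 1 / (1 + real n + real i / real (m n)))"
  have m0: "m n > 0" for n by (simp add: m_def)
  have frac: "0 \<le> real i / real (m n)" "real i / real (m n) < 1" if "i < m n" for i n
    using that by simp_all
  have \<sigma>1: "c1 \<le> \<sigma> k" and \<sigma>2: "\<sigma> k \<le> c2" for k
  proof -
    obtain n i where qk: "q k = (n, i)" by fastforce
    have "i < m n" using im[of k] qk by simp
    from frac[OF this] \<open>c1 < c2\<close> show "c1 \<le> \<sigma> k"
      by (simp add: \<sigma>_def qk)
    have "(c2 - c1) * (real i / real (m n)) \<le> (c2 - c1) * 1"
      using frac[OF \<open>i < m n\<close>] \<open>c1 < c2\<close> by (intro mult_left_mono) auto
    thus "\<sigma> k \<le> c2" by (simp add: \<sigma>_def qk)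
  qed
  have tpos: "0 < t k" for k
    by (auto simp: t_def intro!: add_pos_nonneg split: prod.splits)
  have inv_mono: "1 / b < 1 / a" if "0 < a" "a < b" for a b :: real
    using that by (simp add: frac_less2)
  have tdec: "t (Suc k) < t k" for k
  proof -
    obtain n i where qk: "q k = (n, i)" by fastforce
    have i: "i < m n" using im[of k] qk by simp
    show ?thesis
    proof (cases "Suc i < m n")
      case True
      hence "t (Suc k) = 1 / (1 + real n + real (Suc i) / real (m n))" by (simp add: t_def qS qk)
      moreover have "real i / real (m n) < real (Suc i) / real (m n)"
        using m0 by (simp add: divide_strict_right_mono)
      ultimately show ?thesis using frac(1)[OF i]
        inv_mono[of "1 + real n + real i / real (m n)" "1 + real n + real (Suc i) / real (m n)"]
        unfolding t_def qk case_prod_conv by linarith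
    next
      case False
      hence "t (Suc k) = 1 / (1 + real (Suc n))" by (simp add: t_def qS qk)
      moreover have "1 / (1 + real (Suc n)) < 1 / (1 + real n + real i / real (m n))"
        using frac[OF i] by (intro inv_mono) linarith+
      ultimately show ?thesis by (simp add: t_def qk)
    qed
  qed
  have tmono: "t k \<le> t j" if "j \<le> k" for j k
    using that by (rule lift_Suc_antimono_le[of t, rotated]) (rule less_imp_le[OF tdec])
  have tlim: "t \<longlonglongrightarrow> 0"
  proof (rule LIMSEQ_I)
    fix r :: real assume "0 < r"
    then obtain n where n: "inverse (real (Suc n)) < r" using reals_Archimedean by blast
    obtain k where "q k = (n, 0)" using hit m0 by blast
    hence "t k < r" using n by (simp add: t_def inverse_eq_divide)
    thus "\<exists>no. \<forall>j\<ge>no. norm (t j - 0) < r"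
      using tmono tpos by (intro exI[of _ k]) (smt (verit) real_norm_def)
  qed
  have cover: "\<exists>k\<ge>K. \<bar>\<sigma> k - s\<bar> < \<gamma> (t k)" if s: "s \<in> {c1..c2}" for s K
  proof -
    \<comment> \<open>All times of round \<open>n\<close> are at most \<open>1 / (n + 1)\<close>,
      hence below \<open>t K\<close>; since the times decrease, the whole round comes after index
      \<open>K\<close>.\<close>
    obtain n where n: "inverse (real (Suc n)) < t K" using reals_Archimedean tpos by blast
    define x where "x = real (m n) * ((s - c1) / (c2 - c1))"
    have x: "0 \<le> x" "x \<le> real (m n)"
      using s \<open>c1 < c2\<close> mult_left_le[of "(s - c1) / (c2 - c1)" "real (m n)"] by (auto simp: x_def)
    \<comment> \<open>At the right end \<open>s = c2\<close> the floor is \<open>m n\<close>, which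
      is not a grid index; the last grid point is still within one mesh.\<close>
    define i where "i = min (nat \<lfloor>x\<rfloor>) (m n - 1)"
    have i: "i < m n" using m0[of n] by (auto simp: i_def)
    have ix: "\<bar>real i - x\<bar> \<le> 1"
      using x m0[of n] unfolding i_def by linarith
    obtain k where k: "q k = (n, i)" using hit[OF i] by blast
    have "\<sigma> k - s = (c2 - c1) * (real i - x) / real (m n)"
      using \<open>c1 < c2\<close> m0[of n] by (simp add: \<sigma>_def k x_def field_simps)
    hence "\<bar>\<sigma> k - s\<bar> = (c2 - c1) * \<bar>real i - x\<bar> / real (m n)"
      using \<open>c1 < c2\<close> by (simp add: abs_mult)
    also have "\<dots> \<le> (c2 - c1) / real (m n)"
      using ix \<open>c1 < c2\<close> by (intro divide_right_mono) (auto simp: mult_left_le)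
    also have "\<dots> < \<delta> n" by (rule m)
    also have "\<delta> n < \<gamma> (t k)"
    proof -
      have "1 / (real n + 2) < t k" using frac[OF i]
        unfolding t_def k case_prod_conv by (intro inv_mono) linarith+
      thus ?thesis using strict_mono_onD[OF mono, of "1 / (real n + 2)" "t k"] tpos[of k]
        by (simp add: \<delta>_def)
    qed
    finally have "\<bar>\<sigma> k - s\<bar> < \<gamma> (t k)" .
    moreover have "K \<le> k"
    proof (rule ccontr)
      assume "\<not> K \<le> k"
      hence "t K \<le> t k" using tmono by simp
      also have "t k \<le> 1 / (1 + real n)" using frac[OF i]
        unfolding t_def k case_prod_conv by (intro frac_le) auto
      finally show False using n by (simp add: inverse_eq_divide)
    qed
    ultimately show ?thesis by blast
  qed
  from that[OF \<sigma>1 \<sigma>2 tpos tdec tlim cover] show thesis by blast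
qed

text \<open>In the variable \<open>L = ln (ln N)\<close> the growth condition becomes an affine
  recursion. The summand \<open>\<bar>D (Suc k)\<bar>\<close> gives
  \<open>D k \<le> L k \<le> N k\<close>, and the summand 1 makes the sequence strictly
  increasing.\<close>

lemma rapid_growth:
  fixes D :: "nat \<Rightarrow> real" and C :: real
  obtains N :: "nat \<Rightarrow> real" where "exp 1 \<le> N 0" "\<And>k. N k < N (Suc k)" "\<And>k. D k \<le> N k"
    "\<And>k. 3 * ln (ln (N k)) + 2 * real k + C \<le> ln (ln (N (Suc k)))"
proof -
  define L where "L = rec_nat \<bar>D 0\<bar> (\<lambda>k l. 3 * l + 2 * real k + \<bar>C\<bar> + \<bar>D (Suc k)\<bar> + 1)"
  have L0: "L 0 = \<bar>D 0\<bar>" and LS: "L (Suc k) = 3 * L k + 2 * real k + \<bar>C\<bar> + \<bar>D (Suc k)\<bar> + 1" for k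
    by (simp_all add: L_def)
  have L: "0 \<le> L k" for k by (induction k) (auto simp: L0 LS)
  have LD: "D k \<le> L k" for k
  proof (cases k)
    case (Suc j)
    thus ?thesis using L[of j] by (simp add: LS)
  qed (simp add: L0)
  define N where "N = (\<lambda>k. exp (exp (L k)))"
  show thesis
  proof (rule that)
    show "exp 1 \<le> N 0" using L[of 0] by (simp add: N_def)
    show "N k < N (Suc k)" for k using L[of k] by (simp add: N_def LS)
    show "D k \<le> N k" for k
      using LD[of k] exp_ge_add_one_self[of "L k"] exp_ge_add_one_self[of "exp (L k)"]
      unfolding N_def by linarith
    show "3 * ln (ln (N k)) + 2 * real k + C \<le> ln (ln (N (Suc k)))" for k
      by (simp add: N_def LS)
  qed
qed

text \<open>One integration by parts against the phase derivative \<open>p\<close>. For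
  \<open>\<tau> \<ge> 0\<close> the quotient \<open>q = a / p\<close> of a decreasing function by an
  increasing one decreases, so the integral of \<open>\<bar>q'\<bar>\<close> telescopes to
  \<open>q A - q B\<close>. Together with the boundary terms this gives \<open>2 * q A\<close>,
  independently of \<open>B\<close>.\<close>

lemma oscillatory_integral_bound_pos:
  fixes a a' :: "real \<Rightarrow> real"
  assumes AB: "A \<le> B"
    and deriv: "\<And>l. l \<in> {A..B} \<Longrightarrow> (a has_real_derivative a' l) (at l)"
    and a': "\<And>l. l \<in> {A..B} \<Longrightarrow> a' l \<le> 0" and a: "\<And>l. l \<in> {A..B} \<Longrightarrow> 0 \<le> a l"
    and \<tau>: "0 \<le> \<tau>" and d: "0 < d" "d \<le> c + 2 * \<tau> * A"
  shows "cmod (integral {A..B} (\<lambda>l. of_real (a l) * cis (c * l + \<tau> * l\<^sup>2))) \<le> 2 * a A / d"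
proof -
  define p where "p = (\<lambda>l. c + 2 * \<tau> * l)"
  have p: "d \<le> p l" if "l \<in> {A..B}" for l
    using d(2) mult_left_mono[of A l "2 * \<tau>"] \<tau> that by (simp add: p_def)
  define q where "q = (\<lambda>l. a l / p l)"
  define q' where "q' = (\<lambda>l. (a' l * p l - a l * (2 * \<tau>)) / (p l)\<^sup>2)"
  define e where "e = (\<lambda>l. cis (c * l + \<tau> * l\<^sup>2))"
  have ne: "cmod (e l) = 1" for l by (simp add: e_def)
  have q': "(q has_real_derivative q' l) (at l)" if "l \<in> {A..B}" for l
    using p[OF that] d(1) unfolding q_def q'_def p_def
    by (auto intro!: derivative_eq_intros deriv that simp: power2_eq_square)
  have q'le: "q' l \<le> 0" if "l \<in> {A..B}" for l
  proof -
    have "a' l * p l \<le> 0" using p[OF that] d(1) a'[OF that] by (simp add: mult_nonpos_nonneg)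
    moreover have "0 \<le> a l * (2 * \<tau>)" using a[OF that] \<tau> by simp
    ultimately have "a' l * p l - a l * (2 * \<tau>) \<le> 0" by linarith
    thus ?thesis unfolding q'_def by (rule divide_nonpos_nonneg) simp
  qed
  have e': "(e has_vector_derivative (\<i> * of_real (p l) * e l)) (at l)" for l
  proof -
    have "((\<lambda>l. c * l + \<tau> * l\<^sup>2) has_real_derivative p l) (at l)"
      unfolding p_def by (auto intro!: derivative_eq_intros)
    hence "((\<lambda>l. \<i> * complex_of_real (c * l + \<tau> * l\<^sup>2)) has_vector_derivative \<i> * of_real (p l)) (at l)"
      by (intro has_vector_derivative_mult_right has_vector_derivative_of_real)
         (simp add: has_real_derivative_iff_has_vector_derivative)
    from field_vector_diff_chain_at[OF this DERIV_exp]
    show ?thesis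
      by (simp add: e_def[abs_def] cis_conv_exp o_def)
  qed
  define G where "G = (\<lambda>l. - \<i> * of_real (q l) * e l)"
  have G: "(G has_vector_derivative (of_real (a l) * e l - \<i> * of_real (q' l) * e l)) (at l within {A..B})" if l: "l \<in> {A..B}" for l
  proof -
    have "((\<lambda>l. complex_of_real (q l)) has_vector_derivative of_real (q' l)) (at l within {A..B})"
      using q'[OF l] by (intro has_vector_derivative_of_real has_vector_derivative_at_within)
         (simp add: has_real_derivative_iff_has_vector_derivative)
    from has_vector_derivative_mult[OF this has_vector_derivative_at_within[OF e'[of l]]]
    have "((\<lambda>l. - \<i> * (of_real (q l) * e l)) has_vector_derivative
       - \<i> * (of_real (q l) * (\<i> * of_real (p l) * e l) + of_real (q' l) * e l)) (at l within {A..B})"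
      by (intro has_vector_derivative_mult_right) simp
    moreover have qp: "complex_of_real (a l) = of_real (q l) * of_real (p l)"
      using p[OF l] d(1) by (auto simp: q_def)
    have "- \<i> * (of_real (q l) * (\<i> * of_real (p l) * e l) + of_real (q' l) * e l) = of_real (a l) * e l - \<i> * of_real (q' l) * e l"
      unfolding qp by (simp add: algebra_simps)
    ultimately show ?thesis by (simp add: G_def mult.assoc)
  qed
  have hG: "((\<lambda>l. of_real (a l) * e l - \<i> * of_real (q' l) * e l) has_integral (G B - G A)) {A..B}"
    by (rule fundamental_theorem_of_calculus[OF AB G])
  have "continuous_on {A..B} a"
    by (intro continuous_at_imp_continuous_on ballI) (use deriv DERIV_isCont in blast)
  hence "continuous_on {A..B} (\<lambda>l. of_real (a l) * e l)"
    unfolding e_def by (intro continuous_intros)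
  hence i1: "(\<lambda>l. of_real (a l) * e l) integrable_on {A..B}"
    by (rule integrable_continuous_interval)
  from integrable_diff[OF i1 has_integral_integrable[OF hG]]
  have i2: "(\<lambda>l. \<i> * of_real (q' l) * e l) integrable_on {A..B}" by simp
  have hq: "((\<lambda>l. - q' l) has_integral - (q B - q A)) {A..B}"
    by (intro has_integral_neg fundamental_theorem_of_calculus[OF AB])
       (auto simp flip: has_real_derivative_iff_has_vector_derivative intro!: DERIV_subset[OF q' subset_UNIV])
  have eq: "integral {A..B} (\<lambda>l. of_real (a l) * e l) = G B - G A + integral {A..B} (\<lambda>l. \<i> * of_real (q' l) * e l)"
    using trans[OF sym[OF Henstock_Kurzweil_Integration.integral_diff[OF i1 i2]] integral_unique[OF hG]]
    by (simp only: diff_eq_eq)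
  have "cmod (integral {A..B} (\<lambda>l. \<i> * of_real (q' l) * e l)) \<le> q A - q B"
    using Henstock_Kurzweil_Integration.integral_norm_bound_integral[OF i2 has_integral_integrable[OF hq]]
      integral_unique[OF hq] q'le by (simp add: norm_mult ne)
  moreover have "cmod (G B) = q B" "cmod (G A) = q A"
    using AB p[of A] p[of B] d(1) a[of A] a[of B] by (simp_all add: G_def norm_mult norm_divide ne q_def)
  moreover have "q A \<le> a A / d"
    using AB p[of A] d(1) a[of A] unfolding q_def by (intro divide_left_mono mult_pos_pos) auto
  ultimately have "cmod (integral {A..B} (\<lambda>l. of_real (a l) * e l)) \<le> 2 * (a A / d)"
    unfolding eq using norm_triangle_ineq[of "G B - G A" "integral {A..B} (\<lambda>l. \<i> * of_real (q' l) * e l)"]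
      norm_triangle_ineq4[of "G B" "G A"] by linarith
  thus ?thesis unfolding e_def by simp
qed

text \<open>A negative \<open>\<tau>\<close> is reduced to a positive one by complex conjugation,
  which also flips \<open>c\<close>; the condition on \<open>d\<close> is therefore stated with
  absolute values.\<close>

lemma oscillatory_integral_bound:
  fixes a a' :: "real \<Rightarrow> real"
  assumes AB: "A \<le> B" "0 \<le> A"
    and deriv: "\<And>l. l \<in> {A..B} \<Longrightarrow> (a has_real_derivative a' l) (at l)"
    and a': "\<And>l. l \<in> {A..B} \<Longrightarrow> a' l \<le> 0" and a: "\<And>l. l \<in> {A..B} \<Longrightarrow> 0 \<le> a l"
    and d: "0 < d" "d \<le> 2 * \<bar>\<tau>\<bar> * A - \<bar>c\<bar>"
  shows "cmod (integral {A..B} (\<lambda>l. of_real (a l) * cis (c * l + \<tau> * l\<^sup>2))) \<le> 2 * a A / d"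
proof (cases "0 \<le> \<tau>")
  case True
  thus ?thesis using d
    by (intro oscillatory_integral_bound_pos[OF AB(1) deriv a' a]) auto
next
  case False
  have "cmod (integral {A..B} (\<lambda>l. of_real (a l) * cis (c * l + \<tau> * l\<^sup>2))) =
        cmod (cnj (integral {A..B} (\<lambda>l. of_real (a l) * cis (c * l + \<tau> * l\<^sup>2))))" by simp
  also have "cnj (integral {A..B} (\<lambda>l. of_real (a l) * cis (c * l + \<tau> * l\<^sup>2))) =
      integral {A..B} (\<lambda>l. of_real (a l) * cis ((- c) * l + (- \<tau>) * l\<^sup>2))"
    unfolding Henstock_Kurzweil_Integration.integral_cnj by (simp add: cis_cnj)
  also have "cmod \<dots> \<le> 2 * a A / d"
    using False d by (intro oscillatory_integral_bound_pos[OF AB(1) deriv a' a]) auto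
  finally show ?thesis .
qed

section \<open>The frequency profile and its blocks\<close>

definition amp :: "real \<Rightarrow> real" where
  "amp l = 1 / (l * ln l)"

lemma ln_ge_1:
  assumes "exp 1 \<le> (l::real)"
  shows "1 \<le> ln l" "1 \<le> l" "1 < l"
proof -
  have "0 < l" using assms exp_gt_zero[of "1::real"] by linarith
  thus "1 \<le> ln l" using assms by (simp add: ln_ge_iff)
  show "1 < l" "1 \<le> l" using assms exp_ge_add_one_self[of "1::real"] by linarith+
qed

lemma amp_bounds:
  assumes "exp 1 \<le> l"
  shows "0 < amp l" "amp l \<le> 1"
proof -
  have "1 * 1 \<le> l * ln l" using ln_ge_1[OF assms] by (intro mult_mono) auto
  thus "0 < amp l" "amp l \<le> 1" by (auto simp: amp_def)
qed

lemma amp_deriv: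
  assumes "exp 1 \<le> l"
  shows "(amp has_real_derivative - ((ln l + 1) / (l * ln l)\<^sup>2)) (at l)"
  unfolding amp_def using ln_ge_1[OF assms]
  by (auto intro!: derivative_eq_intros simp: power2_eq_square minus_divide_left)

lemma amp_antideriv:
  assumes "exp 1 \<le> l"
  shows "((\<lambda>l. ln (ln l)) has_real_derivative amp l) (at l)"
  unfolding amp_def using ln_ge_1[OF assms]
  by (auto intro!: derivative_eq_intros simp: divide_simps)

lemma amp_has_integral:
  assumes "exp 1 \<le> A" "A \<le> B"
  shows "(amp has_integral (ln (ln B) - ln (ln A))) {A..B}"
  using assms
  by (intro fundamental_theorem_of_calculus)
     (auto simp flip: has_real_derivative_iff_has_vector_derivative intro!: DERIV_subset[OF amp_antideriv subset_UNIV])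

lemma measurable_amp [measurable]: "amp \<in> borel_measurable borel"
  unfolding amp_def by measurable

text \<open>Bounds from below the distance of \<open>t k\<close> from time 0 and from all earlier
  focusing times. Later times need no separation: seen from there block \<open>k\<close> is an
  earlier block and falls under the trivial bound.\<close>

definition gap :: "(nat \<Rightarrow> real) \<Rightarrow> nat \<Rightarrow> real" where
  "gap t k = (case k of 0 \<Rightarrow> t 0 | Suc j \<Rightarrow> min (t (Suc j)) (t j - t (Suc j)))"

text \<open>In \<open>N_gap\<close> the power of two produces the decay of block \<open>k\<close>,
  and \<open>2 * c2 + k\<close> absorbs the linear phase \<open>\<bar>s\<bar> + \<sigma> k\<close>
  for \<open>\<bar>s\<bar> \<le> c2 + k\<close>; the range of \<open>s\<close> widens with
  \<open>k\<close> so that the datum is controlled at every radius. In \<open>N_growth\<close> the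
  factor 3 pays for all earlier blocks, since the focused block yields only half of the difference
  of the \<open>ln ln\<close> values; \<open>1 / c1\<close> pays for the reflected wave, 2 for the
  later blocks, and \<open>2 * k\<close> is the surplus that makes the peaks unbounded.\<close>

locale focusing =
  fixes c1 c2 :: real and \<sigma> t N :: "nat \<Rightarrow> real"
  assumes c1: "0 < c1"
    and \<sigma>: "c1 \<le> \<sigma> k" "\<sigma> k \<le> c2"
    and t_pos: "0 < t k" and t_dec: "t (Suc k) < t k" and t_lim: "t \<longlonglongrightarrow> 0"
    and N_0: "exp 1 \<le> N 0" and N_Suc: "N k < N (Suc k)"
    and N_gap: "2 ^ Suc k + 2 * c2 + real k \<le> N k * gap t k"
    and N_growth: "3 * ln (ln (N k)) + 2 * real k + (2 + 1 / c1) \<le> ln (ln (N (Suc k)))"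
begin

lemma N_strict_mono: "strict_mono N"
  by (simp add: strict_mono_Suc_iff N_Suc)

lemma N_ge: "exp 1 \<le> N k"
  using N_0 strict_mono_less_eq[OF N_strict_mono, of 0 k] by simp

lemma N_pos: "0 < N k"
  using ln_ge_1(2)[OF N_ge[of k]] by simp

lemma t_antimono: "j \<le> k \<Longrightarrow> t k \<le> t j"
  by (rule lift_Suc_antimono_le[of t]) (auto intro: less_imp_le t_dec)

lemma gap_le: "gap t k \<le> t k"
  by (auto simp: gap_def split: nat.split)

lemma gap_le_diff: "j < k \<Longrightarrow> gap t k \<le> t j - t k"
  using t_antimono[of j "k - 1"] by (auto simp: gap_def split: nat.split)

lemma filterlim_N: "filterlim N at_top sequentially"
proof (rule filterlim_at_top_mono)
  show "filterlim (\<lambda>k. real k / t 0) at_top sequentially"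
    using t_pos[of 0] by real_asymp
  have "real k / t 0 \<le> N k" for k
  proof -
    have "0 \<le> c2" using \<sigma>[of 0] c1 by linarith
    hence "real k \<le> N k * gap t k" using N_gap[of k] zero_le_power[of "2::real" "Suc k"] by linarith
    also have "\<dots> \<le> N k * t 0"
      using gap_le[of k] t_antimono[of 0 k] N_pos[of k] by (intro mult_left_mono) auto
    finally show ?thesis using t_pos[of 0] by (simp add: field_simps)
  qed
  thus "eventually (\<lambda>k. real k / t 0 \<le> N k) sequentially" by simp
qed

lemma block_exists:
  assumes "N j \<le> l"
  obtains k where "j \<le> k" "N k \<le> l" "l < N (Suc k)"
proof -
  have "eventually (\<lambda>k. l < N k) sequentially"
    using filterlim_N by (simp add: filterlim_at_top_dense)
  hence ex: "\<exists>k. l < N k" by (auto simp: eventually_sequentially)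
  define k where "k = (LEAST k. l < N k)"
  have k: "l < N k" unfolding k_def by (rule LeastI_ex[OF ex])
  hence "j < k" using assms strict_mono_less[OF N_strict_mono, of j k] by linarith
  moreover have "\<not> l < N (k - 1)"
    using \<open>j < k\<close> not_less_Least[of "k - 1" "\<lambda>k. l < N k"] by (simp add: k_def)
  ultimately show thesis using that[of "k - 1"] k by simp
qed

definition blk :: "real \<Rightarrow> nat" where
  "blk l = (LEAST k. l < N (Suc k))"

lemma blk_eq:
  assumes "N k \<le> l" "l < N (Suc k)"
  shows "blk l = k"
  unfolding blk_def
proof (rule Least_equality)
  show "k \<le> j" if "l < N (Suc j)" for j
  proof -
    have "N k < N (Suc j)" using assms that by linarith
    thus ?thesis using strict_mono_less[OF N_strict_mono, of k "Suc j"] by simp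
  qed
qed fact

lemma measurable_blk [measurable]: "blk \<in> borel \<rightarrow>\<^sub>M count_space UNIV"
  unfolding blk_def by measurable

definition h :: "real \<Rightarrow> complex" where
  "h l = (if l < N 0 then 0 else of_real (amp l) * cis (- (t (blk l) * l\<^sup>2 + \<sigma> (blk l) * l)))"

lemma measurable_h [measurable]: "h \<in> borel_measurable borel"
proof -
  have [measurable]: "cis \<in> borel_measurable borel"
    by (intro borel_measurable_continuous_onI continuous_intros)
  have [measurable]: "(\<lambda>l. t (blk l)) \<in> borel_measurable borel" "(\<lambda>l. \<sigma> (blk l)) \<in> borel_measurable borel"
    by (rule measurable_compose[OF measurable_blk]; simp)+
  show ?thesis unfolding h_def by measurable
qed

lemma h_block:
  assumes "N k \<le> l" "l < N (Suc k)"
  shows "h l = of_real (amp l) * cis (- (t k * l\<^sup>2 + \<sigma> k * l))"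
  using assms strict_mono_less_eq[OF N_strict_mono, of 0 k] by (simp add: h_def blk_eq)

lemma cmod_h: "cmod (h l) = (if l < N 0 then 0 else amp l)"
  using amp_bounds[of l] N_0 by (auto simp: h_def norm_mult)

lemma cmod_h_le: "cmod (h l) \<le> 1"
  using amp_bounds[of l] N_0 by (auto simp: cmod_h)

text \<open>Up to the factor \<open>cis T / sinh s\<close>, the propagation with frequencies cut off
  at \<open>R\<close>. At \<open>T = 0\<close> it is the sine transform of the cut-off
  profile.\<close>

definition E :: "real \<Rightarrow> real \<Rightarrow> real \<Rightarrow> complex" where
  "E s T R = (LINT l:{0<..R}|lborel. h l * of_real (sin (l * s)) * cis (T * l\<^sup>2))"

lemma E_integrable: "set_integrable lborel {a<..b} (\<lambda>l. h l * of_real (sin (l * s)) * cis (T * l\<^sup>2))"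
  unfolding set_integrable_def
proof (rule integrableI_bounded_set[where A = "{a<..b}" and B = 1])
  have [measurable]: "cis \<in> borel_measurable borel"
    by (intro borel_measurable_continuous_onI continuous_intros)
  show "(\<lambda>l. indicator {a<..b} l *\<^sub>R (h l * of_real (sin (l * s)) * cis (T * l\<^sup>2))) \<in> borel_measurable lborel"
    by measurable
  have "cmod (h l) * \<bar>sin (l * s)\<bar> \<le> 1" for l
    using mult_mono[OF cmod_h_le[of l] abs_sin_le_one[of "l * s"]] by simp
  thus "AE l in lborel. l \<in> {a<..b} \<longrightarrow> norm (indicator {a<..b} l *\<^sub>R (h l * of_real (sin (l * s)) * cis (T * l\<^sup>2))) \<le> 1"
    by (auto simp: norm_mult)
  show "emeasure lborel {a<..b} < \<infinity>" by (cases "a \<le> b") auto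
qed (auto simp: indicator_def)

lemma E_diff:
  assumes "0 \<le> A" "A \<le> R"
  shows "E s T R - E s T A = (LINT l:{A<..R}|lborel. h l * of_real (sin (l * s)) * cis (T * l\<^sup>2))"
proof -
  have "{0<..R} = {0<..A} \<union> {A<..R}" using assms by auto
  thus ?thesis
    unfolding E_def by (simp add: set_integral_Un E_integrable)
qed

definition osc :: "nat \<Rightarrow> real \<Rightarrow> real \<Rightarrow> real \<Rightarrow> complex" where
  "osc k R \<tau> c = integral {N k..R} (\<lambda>l. of_real (amp l) * cis (c * l + \<tau> * l\<^sup>2))"

lemma continuous_on_amp: "continuous_on {N k..R} amp"
  unfolding amp_def using ln_ge_1[OF order_trans[OF N_ge[of k]]]
  by (intro continuous_intros) force+

text \<open>The sine splits into an outgoing and a reflected wave. The phase of the block shifts the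
  origin of both to the focusing point, so each term depends only on the offsets
  \<open>T - t k\<close> and \<open>s - \<sigma> k\<close> or
  \<open>- s - \<sigma> k\<close>.\<close>

lemma E_block:
  assumes "N k \<le> R" "R \<le> N (Suc k)"
  shows "E s T R - E s T (N k) = (osc k R (T - t k) (s - \<sigma> k) - osc k R (T - t k) (- s - \<sigma> k)) / (2 * \<i>)"
proof -
  define G where "G = (\<lambda>c l. complex_of_real (amp l) * cis (c * l + (T - t k) * l\<^sup>2))"
  define F where "F = (\<lambda>l. (G (s - \<sigma> k) l - G (- s - \<sigma> k) l) / (2 * \<i>))"
  have contG: "continuous_on {N k..R} (G c)" for c
    unfolding G_def by (intro continuous_intros continuous_on_amp)
  have osc: "osc k R (T - t k) c = integral {N k..R} (G c)" for c
    by (simp add: osc_def G_def[abs_def])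
  from contG have contF: "continuous_on {N k..R} F"
    unfolding F_def by (intro continuous_intros) auto
  have hF: "h l * of_real (sin (l * s)) * cis (T * l\<^sup>2) = F l" if "N k \<le> l" "l < N (Suc k)" for l
  proof -
    have sin: "complex_of_real (sin (l * s)) = (cis (l * s) - cis (- (l * s))) / (2 * \<i>)"
      by (simp add: complex_eq_iff)
    have "h l * of_real (sin (l * s)) * cis (T * l\<^sup>2) =
        of_real (amp l) * (cis (- (t k * l\<^sup>2 + \<sigma> k * l)) * cis (l * s) * cis (T * l\<^sup>2)
           - cis (- (t k * l\<^sup>2 + \<sigma> k * l)) * cis (- (l * s)) * cis (T * l\<^sup>2)) / (2 * \<i>)"
      unfolding h_block[OF that] sin by (simp add: algebra_simps diff_divide_distrib)
    also have "\<dots> = F l"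
      unfolding F_def G_def cis_mult by (simp add: algebra_simps)
    finally show ?thesis .
  qed
  have "E s T R - E s T (N k) = (LINT l:{N k<..R}|lborel. h l * of_real (sin (l * s)) * cis (T * l\<^sup>2))"
    using assms N_pos[of k] by (intro E_diff) auto
  also have "\<dots> = (LINT l:{N k..R}|lborel. F l)"
    unfolding set_lebesgue_integral_def
  proof (rule integral_cong_AE)
    \<comment> \<open>The two endpoints are discarded: the interval is closed on the left, and for
      \<open>R = N (Suc k)\<close> the value of \<open>h\<close> there belongs to the next
      block.\<close>
    have "AE l in lborel. l \<noteq> N k \<and> l \<noteq> N (Suc k)"
      by (intro AE_conjI AE_lborel_singleton)
    thus "AE l in lborel. indicator {N k<..R} l *\<^sub>R (h l * of_real (sin (l * s)) * cis (T * l\<^sup>2)) = indicator {N k..R} l *\<^sub>R F l"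
      by (rule eventually_mono) (use assms hF in \<open>auto simp: indicator_def\<close>)
    show "(\<lambda>l. indicator {N k..R} l *\<^sub>R F l) \<in> borel_measurable lborel"
      using borel_integrable_atLeastAtMost'[OF contF] unfolding set_integrable_def
      by (rule borel_measurable_integrable)
    show "(\<lambda>l. indicator {N k<..R} l *\<^sub>R (h l * of_real (sin (l * s)) * cis (T * l\<^sup>2))) \<in> borel_measurable lborel"
      using E_integrable unfolding set_integrable_def by (rule borel_measurable_integrable)
  qed
  also have "\<dots> = integral {N k..R} F"
    by (rule set_borel_integral_eq_integral(2)[OF borel_integrable_atLeastAtMost'[OF contF]])
  also have "\<dots> = (osc k R (T - t k) (s - \<sigma> k) - osc k R (T - t k) (- s - \<sigma> k)) / (2 * \<i>)"
    unfolding F_def osc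
    by (simp add: Henstock_Kurzweil_Integration.integral_diff integrable_continuous_interval contG)
  finally show ?thesis .
qed

lemma osc_crude:
  assumes "N k \<le> R"
  shows "cmod (osc k R \<tau> c) \<le> ln (ln R) - ln (ln (N k))"
proof -
  have i: "(amp has_integral (ln (ln R) - ln (ln (N k)))) {N k..R}"
    by (rule amp_has_integral[OF N_ge assms])
  have "cmod (osc k R \<tau> c) \<le> integral {N k..R} amp"
    unfolding osc_def
  proof (rule Henstock_Kurzweil_Integration.integral_norm_bound_integral)
    show "(\<lambda>l. of_real (amp l) * cis (c * l + \<tau> * l\<^sup>2)) integrable_on {N k..R}"
      by (intro integrable_continuous_interval continuous_intros continuous_on_amp)
    show "amp integrable_on {N k..R}" using i by blast
    show "cmod (of_real (amp l) * cis (c * l + \<tau> * l\<^sup>2)) \<le> amp l" if "l \<in> {N k..R}" for l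
      using amp_bounds[of l] N_ge[of k] that by (simp add: norm_mult)
  qed
  thus ?thesis using i by (simp add: integral_unique)
qed

lemma osc_bound:
  assumes "N k \<le> R" "0 < d" "d \<le> 2 * \<bar>\<tau>\<bar> * N k - \<bar>c\<bar>"
  shows "cmod (osc k R \<tau> c) \<le> 2 / d"
proof -
  have "cmod (osc k R \<tau> c) \<le> 2 * amp (N k) / d"
    unfolding osc_def
  proof (rule oscillatory_integral_bound[where a' = "\<lambda>l. - ((ln l + 1) / (l * ln l)\<^sup>2)"])
    fix l assume "l \<in> {N k..R}"
    hence l: "exp 1 \<le> l" using N_ge[of k] by simp
    show "(amp has_real_derivative - ((ln l + 1) / (l * ln l)\<^sup>2)) (at l)" by (rule amp_deriv[OF l])
    show "0 \<le> amp l" using amp_bounds[OF l] by simp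
    show "- ((ln l + 1) / (l * ln l)\<^sup>2) \<le> 0" using ln_ge_1[OF l] by simp
  qed (use assms N_pos[of k] in auto)
  also have "\<dots> \<le> 2 * 1 / d"
    using amp_bounds[OF N_ge[of k]] assms(2) by (intro divide_right_mono mult_left_mono) auto
  finally show ?thesis by simp
qed

text \<open>At the focusing time the quadratic phase is gone, and the reflected wave has only its
  linear phase left to oscillate with. Conjugation makes that phase increasing.\<close>

lemma osc_bound_stationary:
  assumes "N k \<le> R" "0 < d" "d \<le> c"
  shows "cmod (osc k R 0 (- c)) \<le> 2 / d"
proof -
  have "osc k R 0 (- c) = cnj (osc k R 0 c)"
    unfolding osc_def Henstock_Kurzweil_Integration.integral_cnj by (simp add: cis_cnj)
  hence "cmod (osc k R 0 (- c)) = cmod (osc k R 0 c)" by simp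
  also have "\<dots> \<le> 2 * amp (N k) / d"
    unfolding osc_def
  proof (rule oscillatory_integral_bound_pos[where a' = "\<lambda>l. - ((ln l + 1) / (l * ln l)\<^sup>2)"])
    fix l assume "l \<in> {N k..R}"
    hence l: "exp 1 \<le> l" using N_ge[of k] by simp
    show "(amp has_real_derivative - ((ln l + 1) / (l * ln l)\<^sup>2)) (at l)" by (rule amp_deriv[OF l])
    show "0 \<le> amp l" using amp_bounds[OF l] by simp
    show "- ((ln l + 1) / (l * ln l)\<^sup>2) \<le> 0" using ln_ge_1[OF l] by simp
  qed (use assms in auto)
  also have "\<dots> \<le> 2 * 1 / d"
    using amp_bounds[OF N_ge[of k]] assms(2) by (intro divide_right_mono mult_left_mono) auto
  finally show ?thesis by simp
qed

text \<open>By \<open>N_gap\<close> the phase derivative of either wave is at least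
  \<open>2 ^ Suc k\<close> in modulus from the start of the block, so each contributes at most
  \<open>2 / 2 ^ Suc k\<close>. The denominator \<open>2 * \<i>\<close> of the sine compensates for
  there being two.\<close>

lemma E_block_small:
  assumes "N k \<le> R" "R \<le> N (Suc k)" and gap: "gap t k \<le> \<bar>T - t k\<bar>" and s: "\<bar>s\<bar> \<le> c2 + real k"
  shows "cmod (E s T R - E s T (N k)) \<le> (1 / 2) ^ k"
proof -
  have small: "cmod (osc k R (T - t k) c) \<le> (1 / 2) ^ k" if "\<bar>c\<bar> \<le> 2 * c2 + real k" for c
  proof -
    have "N k * gap t k \<le> \<bar>T - t k\<bar> * N k" using gap N_pos[of k] by (simp add: mult.commute)
    hence "2 ^ Suc k + 2 * c2 + real k \<le> \<bar>T - t k\<bar> * N k" using N_gap[of k] by linarith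
    moreover have "0 \<le> \<bar>T - t k\<bar> * N k" using N_pos[of k] by simp
    ultimately have "2 ^ Suc k \<le> 2 * \<bar>T - t k\<bar> * N k - \<bar>c\<bar>" using that by linarith
    hence "cmod (osc k R (T - t k) c) \<le> 2 / 2 ^ Suc k"
      using assms by (intro osc_bound) auto
    thus ?thesis by (simp add: power_one_over)
  qed
  have "cmod (osc k R (T - t k) (s - \<sigma> k)) \<le> (1 / 2) ^ k" "cmod (osc k R (T - t k) (- s - \<sigma> k)) \<le> (1 / 2) ^ k"
    using s \<sigma>[of k] c1 by (intro small; linarith)+
  thus ?thesis
    unfolding E_block[OF assms(1,2)] norm_divide
    using norm_triangle_ineq4[of "osc k R (T - t k) (s - \<sigma> k)" "osc k R (T - t k) (- s - \<sigma> k)"]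
    by (simp add: norm_mult)
qed

lemma E_crude: "cmod (E s T (N k)) \<le> ln (ln (N k))"
proof (induction k)
  case 0
  have "E s T (N 0) = 0"
    unfolding E_def set_lebesgue_integral_def
    using AE_lborel_singleton[of "N 0"]
    by (intro integral_eq_zero_AE) (auto elim!: eventually_mono simp: h_def indicator_def)
  thus ?case using ln_ge_1(1)[OF N_0] by simp
next
  case (Suc k)
  have le: "N k \<le> N (Suc k)" using N_Suc[of k] by simp
  have "cmod (E s T (N (Suc k)) - E s T (N k)) \<le> ln (ln (N (Suc k))) - ln (ln (N k))"
    unfolding E_block[OF le order_refl] norm_divide
    using norm_triangle_ineq4[of "osc k (N (Suc k)) (T - t k) (s - \<sigma> k)" "osc k (N (Suc k)) (T - t k) (- s - \<sigma> k)"]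
      osc_crude[OF le, of "T - t k" "s - \<sigma> k"] osc_crude[OF le, of "T - t k" "- s - \<sigma> k"]
    by (simp add: norm_mult)
  thus ?case using Suc norm_triangle_sub[of "E s T (N (Suc k))" "E s T (N k)"] by linarith
qed

text \<open>The outgoing wave has no phase left and integrates \<open>amp\<close> exactly. The
  reflected one has phase derivative \<open>- 2 * \<sigma> k\<close>, whose modulus is at least
  \<open>2 * c1\<close>, and costs at most \<open>1 / c1\<close>.\<close>

lemma E_peak:
  "(ln (ln (N (Suc k))) - ln (ln (N k)) - 1 / c1) / 2 \<le> cmod (E (\<sigma> k) (t k) (N (Suc k)) - E (\<sigma> k) (t k) (N k))"
proof -
  have le: "N k \<le> N (Suc k)" using N_Suc[of k] by simp
  have "osc k (N (Suc k)) 0 0 = of_real (ln (ln (N (Suc k))) - ln (ln (N k)))"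
  proof -
    have "((\<lambda>l. complex_of_real (amp l)) has_integral of_real (ln (ln (N (Suc k))) - ln (ln (N k)))) {N k..N (Suc k)}"
      by (intro has_integral_of_real amp_has_integral N_ge le)
    thus ?thesis unfolding osc_def by (simp add: integral_unique)
  qed
  moreover have "cmod (osc k (N (Suc k)) 0 (- (2 * \<sigma> k))) \<le> 2 / (2 * c1)"
    using \<sigma>(1)[of k] c1 by (intro osc_bound_stationary le) auto
  ultimately have "ln (ln (N (Suc k))) - ln (ln (N k)) - 1 / c1 \<le>
      cmod (osc k (N (Suc k)) 0 0 - osc k (N (Suc k)) 0 (- (2 * \<sigma> k)))"
    using norm_triangle_ineq2[of "osc k (N (Suc k)) 0 0" "osc k (N (Suc k)) 0 (- (2 * \<sigma> k))"]
    by (simp del: of_real_diff)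
  moreover have "E (\<sigma> k) (t k) (N (Suc k)) - E (\<sigma> k) (t k) (N k) =
      (osc k (N (Suc k)) 0 0 - osc k (N (Suc k)) 0 (- (2 * \<sigma> k))) / (2 * \<i>)"
    using E_block[OF le order_refl, of "\<sigma> k" "t k"] by simp
  ultimately show ?thesis by (simp add: norm_divide norm_mult)
qed

end

section \<open>The oscillatory integral off the focusing points\<close>

context focusing
begin

text \<open>From block \<open>j\<close> on, the point \<open>(s, T)\<close> is so far from the focusing points that the blocks contribute
  geometrically little.\<close>

definition unfocused :: "nat \<Rightarrow> real \<Rightarrow> real \<Rightarrow> bool" where
  "unfocused j s T \<longleftrightarrow> \<bar>s\<bar> \<le> c2 + real j \<and> (\<forall>k\<ge>j. gap t k \<le> \<bar>T - t k\<bar>)"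

lemma unfocused_mono: "unfocused i s T \<Longrightarrow> i \<le> j \<Longrightarrow> unfocused j s T"
  by (auto simp: unfocused_def)

text \<open>Time 0 keeps the distance \<open>t k\<close> from each focusing time. Every
  \<open>s\<close> satisfies the hypothesis for large \<open>j\<close>, so the integral at time 0
  converges at all radii and not only in the annulus.\<close>

lemma unfocused_0:
  assumes "\<bar>s\<bar> \<le> c2 + real j"
  shows "unfocused j s 0"
  using assms gap_le by (auto simp: unfocused_def intro: order_trans[OF _ abs_ge_self])

text \<open>The gaps of the blocks after \<open>k\<close> were measured against \<open>t k\<close>
  too. Block \<open>k\<close> itself is in focus at that time, hence the start at
  \<open>Suc k\<close>.\<close>

lemma unfocused_focal_time:
  assumes "\<bar>s\<bar> \<le> c2"
  shows "unfocused (Suc k) s (t k)"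
  using assms gap_le_diff[of k] by (auto simp: unfocused_def intro: order_trans[OF _ abs_ge_self])

text \<open>Once \<open>t k < T0 / 2\<close>, every \<open>T \<ge> T0\<close> is farther than
  \<open>t k\<close> from \<open>t k\<close>. The index depends on \<open>T0\<close> alone, which
  makes the later convergence uniform.\<close>

lemma unfocused_ex:
  assumes "0 < T0"
  obtains j where "\<And>s T. \<bar>s\<bar> \<le> c2 \<Longrightarrow> T0 \<le> T \<Longrightarrow> unfocused j s T"
proof -
  have "eventually (\<lambda>k. t k < T0 / 2) sequentially"
    using t_lim assms by (intro order_tendstoD) auto
  then obtain j where j: "t j < T0 / 2" by (auto simp: eventually_sequentially)
  have "unfocused j s T" if "\<bar>s\<bar> \<le> c2" "T0 \<le> T" for s T
  proof -
    have "gap t k \<le> \<bar>T - t k\<bar>" if "j \<le> k" for k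
      using gap_le[of k] t_antimono[OF that] j \<open>T0 \<le> T\<close> by linarith
    thus ?thesis using that(1) by (simp add: unfocused_def)
  qed
  thus thesis using that by blast
qed

lemma E_tail:
  assumes u: "unfocused j s T" and R: "N j \<le> R"
  shows "cmod (E s T R - E s T (N j)) \<le> 2 * (1 / 2) ^ j"
proof -
  have step: "cmod (E s T R - E s T (N j)) \<le> 2 * (1 / 2) ^ j - 2 * (1 / 2) ^ (j + m)"
    if "N j \<le> R" "R \<le> N (j + m)" for m R
    using that
  proof (induction m arbitrary: R)
    case 0
    thus ?case by simp
  next
    case (Suc m)
    show ?case
    proof (cases "R \<le> N (j + m)")
      case True
      have "(1 / 2 :: real) ^ (j + Suc m) \<le> (1 / 2) ^ (j + m)" by simp
      thus ?thesis using Suc.IH[OF Suc.prems(1) True] by linarith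
    next
      case False
      have "N j \<le> N (j + m)" using strict_mono_less_eq[OF N_strict_mono, of j "j + m"] by simp
      hence 1: "cmod (E s T (N (j + m)) - E s T (N j)) \<le> 2 * (1 / 2) ^ j - 2 * (1 / 2) ^ (j + m)"
        using Suc.IH by simp
      have 2: "cmod (E s T R - E s T (N (j + m))) \<le> (1 / 2) ^ (j + m)"
        using False Suc.prems u by (intro E_block_small) (auto simp: unfocused_def)
      have "E s T R - E s T (N j) = (E s T R - E s T (N (j + m))) + (E s T (N (j + m)) - E s T (N j))" by simp
      hence "cmod (E s T R - E s T (N j)) \<le> (1 / 2) ^ (j + m) + (2 * (1 / 2) ^ j - 2 * (1 / 2) ^ (j + m))"
        using norm_triangle_mono[OF 2 1] by simp
      thus ?thesis by simp
    qed
  qed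
  obtain k where k: "j \<le> k" "R < N (Suc k)" using block_exists[OF R] by blast
  have "cmod (E s T R - E s T (N j)) \<le> 2 * (1 / 2) ^ j - 2 * (1 / 2) ^ (j + (Suc k - j))"
    using k R by (intro step) auto
  also have "\<dots> \<le> 2 * (1 / 2) ^ j" by simp
  finally show ?thesis .
qed

text \<open>A limit along block ends only; the tail bound, valid for cut-offs inside a block as
  well, later extends it to the full improper integral.\<close>

definition U :: "real \<Rightarrow> real \<Rightarrow> complex" where
  "U s T = lim (\<lambda>n. E s T (N n))"

lemma half_power_less:
  assumes "0 < e"
  obtains i where "j \<le> i" "4 * (1 / 2) ^ i < (e::real)"
proof -
  have "((\<lambda>i. 4 * (1 / 2 :: real) ^ i) \<longlongrightarrow> 0) sequentially" by real_asymp
  hence "eventually (\<lambda>i. 4 * (1 / 2 :: real) ^ i < e) sequentially"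
    using assms by (intro order_tendstoD) auto
  hence "eventually (\<lambda>i. j \<le> i \<and> 4 * (1 / 2 :: real) ^ i < e) sequentially"
    using eventually_ge_at_top[of j] by eventually_elim auto
  thus thesis using that by (auto simp: eventually_sequentially)
qed

lemma E_N_tendsto:
  assumes u: "unfocused j s T"
  shows "(\<lambda>n. E s T (N n)) \<longlonglongrightarrow> U s T"
proof -
  have "Cauchy (\<lambda>n. E s T (N n))"
  proof (rule metric_CauchyI)
    fix e :: real assume "0 < e"
    then obtain i where i: "j \<le> i" "4 * (1 / 2) ^ i < e" by (rule half_power_less)
    have "dist (E s T (N n)) (E s T (N i)) \<le> 2 * (1 / 2) ^ i" if "i \<le> n" for n
      using E_tail[OF unfocused_mono[OF u i(1)], of "N n"] that
        strict_mono_less_eq[OF N_strict_mono, of i n] by (simp add: dist_norm)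
    hence "dist (E s T (N m)) (E s T (N n)) < e" if "i \<le> m" "i \<le> n" for m n
      using that i(2) by (smt (verit) dist_triangle2)
    thus "\<exists>M. \<forall>m\<ge>M. \<forall>n\<ge>M. dist (E s T (N m)) (E s T (N n)) < e" by blast
  qed
  thus ?thesis unfolding U_def by (simp add: Cauchy_convergent_iff convergent_LIMSEQ_iff)
qed

lemma U_tail:
  assumes u: "unfocused j s T"
  shows "cmod (U s T - E s T (N j)) \<le> 2 * (1 / 2) ^ j"
proof (rule tendsto_upperbound)
  show "(\<lambda>n. cmod (E s T (N n) - E s T (N j))) \<longlonglongrightarrow> cmod (U s T - E s T (N j))"
    by (intro tendsto_intros E_N_tendsto[OF u])
  show "eventually (\<lambda>n. cmod (E s T (N n) - E s T (N j)) \<le> 2 * (1 / 2) ^ j) sequentially"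
    using eventually_ge_at_top[of j]
    by eventually_elim (use E_tail[OF u] strict_mono_less_eq[OF N_strict_mono] in auto)
qed simp

lemma E_tendsto:
  assumes u: "unfocused j s T"
  shows "(E s T \<longlongrightarrow> U s T) at_top"
proof (rule tendstoI)
  fix e :: real assume "0 < e"
  then obtain i where i: "j \<le> i" "4 * (1 / 2) ^ i < e" by (rule half_power_less)
  note u' = unfocused_mono[OF u i(1)]
  show "eventually (\<lambda>R. dist (E s T R) (U s T) < e) at_top"
    using eventually_ge_at_top[of "N i"]
  proof eventually_elim
    case (elim R)
    have "dist (E s T R) (U s T) \<le> cmod (E s T R - E s T (N i)) + cmod (U s T - E s T (N i))"
      using dist_triangle2[of "E s T R" "U s T" "E s T (N i)"] by (simp add: dist_norm)
    thus ?case using E_tail[OF u' elim] U_tail[OF u'] i(2) by linarith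
  qed
qed

text \<open>Half the gain of block \<open>k\<close> minus the loss from its reflected wave is at
  least \<open>ln (ln (N k)) + k + 1\<close> by \<open>N_growth\<close>. The earlier blocks take
  away at most \<open>ln (ln (N k))\<close> and the later ones at most 1.\<close>

lemma U_peak: "real k \<le> cmod (U (\<sigma> k) (t k))"
proof -
  let ?E = "\<lambda>n. E (\<sigma> k) (t k) (N n)" and ?U = "U (\<sigma> k) (t k)" and ?L = "\<lambda>n. ln (ln (N n))"
  have "\<bar>\<sigma> k\<bar> \<le> c2" using \<sigma>[of k] c1 by linarith
  hence "cmod (?U - ?E (Suc k)) \<le> 2 * (1 / 2) ^ Suc k"
    by (intro U_tail unfocused_focal_time)
  also have "\<dots> \<le> 1" by (simp add: power_le_one)
  finally have "cmod (?U - ?E (Suc k)) \<le> 1" .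
  moreover have "?L k + real k + 1 \<le> (?L (Suc k) - ?L k - 1 / c1) / 2"
    using N_growth[of k] by (simp add: field_simps)
  moreover have "(?L (Suc k) - ?L k - 1 / c1) / 2 \<le> cmod (?E (Suc k) - ?E k)" by (rule E_peak)
  moreover have "cmod (?E k) \<le> ?L k" by (rule E_crude)
  moreover have "cmod (?E (Suc k) - ?E k) \<le> cmod (?U - ?E (Suc k)) + cmod ?U + cmod (?E k)"
  proof -
    have "?E (Suc k) - ?E k = (?U - ?E k) - (?U - ?E (Suc k))" by simp
    thus ?thesis
      using norm_triangle_ineq4[of "?U - ?E k" "?U - ?E (Suc k)"] norm_triangle_ineq4[of ?U "?E k"]
      by simp
  qed
  ultimately show ?thesis by linarith
qed

section \<open>Joint continuity of the limit in radius and time\<close>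

lemma continuous_on_E: "continuous_on A (\<lambda>(s, T). E s T R)"
proof (rule continuous_at_imp_continuous_on, rule ballI)
  fix p :: "real \<times> real"
  have [measurable]: "cis \<in> borel_measurable borel"
    by (intro borel_measurable_continuous_onI continuous_intros)
  have "(\<lambda>n. E (fst (x n)) (snd (x n)) R) \<longlonglongrightarrow> E (fst p) (snd p) R" if x: "x \<longlonglongrightarrow> p" for x
    unfolding E_def set_lebesgue_integral_def
  proof (rule integral_dominated_convergence)
    show "integrable lborel (\<lambda>l. indicator {0<..R} l :: real)"
      by (rule integrable_real_indicator) (cases "0 \<le> R"; simp)+
    show "AE l in lborel. (\<lambda>n. indicator {0<..R} l *\<^sub>R (h l * of_real (sin (l * fst (x n))) * cis (snd (x n) * l\<^sup>2)))
        \<longlonglongrightarrow> indicator {0<..R} l *\<^sub>R (h l * of_real (sin (l * fst p)) * cis (snd p * l\<^sup>2))"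
      by (intro AE_I2 tendsto_intros x)
    fix n
    have "cmod (h l) * \<bar>sin (l * s)\<bar> \<le> 1" for l s
      using mult_mono[OF cmod_h_le[of l] abs_sin_le_one[of "l * s"]] by simp
    thus "AE l in lborel. norm (indicator {0<..R} l *\<^sub>R (h l * of_real (sin (l * fst (x n))) * cis (snd (x n) * l\<^sup>2)))
        \<le> indicator {0<..R} l"
      by (auto simp: norm_mult indicator_def)
  qed measurable
  thus "isCont (\<lambda>(s, T). E s T R) p"
    by (auto simp: continuous_at_sequentially o_def case_prod_beta)
qed

text \<open>The tail bound is uniform only for times bounded away from 0, because the focusing
  points accumulate there. Continuity being local, each point is treated with \<open>T0\<close>
  equal to half its time.\<close>

lemma continuous_on_U: "continuous_on ({-c2..c2} \<times> {0<..}) (\<lambda>(s, T). U s T)"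
proof -
  have loc: "continuous_on ({-c2..c2} \<times> {T0<..}) (\<lambda>(s, T). U s T)" if T0: "T0 > 0" for T0
  proof (rule uniform_limit_theorem)
    show "eventually (\<lambda>n. continuous_on ({-c2..c2} \<times> {T0<..}) (\<lambda>(s, T). E s T (N n))) sequentially"
      by (simp add: continuous_on_E)
    obtain j where j: "\<And>s T. \<bar>s\<bar> \<le> c2 \<Longrightarrow> T0 \<le> T \<Longrightarrow> unfocused j s T"
      using unfocused_ex[OF T0] by blast
    show "uniform_limit ({-c2..c2} \<times> {T0<..}) (\<lambda>n (s, T). E s T (N n)) (\<lambda>(s, T). U s T) sequentially"
    proof (rule uniform_limitI)
      fix e :: real assume "0 < e"
      then obtain i where i: "j \<le> i" "4 * (1 / 2) ^ i < e" by (rule half_power_less)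
      show "\<forall>\<^sub>F n in sequentially. \<forall>x\<in>{-c2..c2} \<times> {T0<..}.
          dist (case x of (s, T) \<Rightarrow> E s T (N n)) (case x of (s, T) \<Rightarrow> U s T) < e"
        using eventually_ge_at_top[of i]
      proof eventually_elim
        case (elim n)
        have "dist (E s T (N n)) (U s T) < e" if "s \<in> {-c2..c2}" "T0 < T" for s T
        proof -
          have "unfocused n s T"
            by (rule unfocused_mono[OF j]) (use that i elim in auto)
          hence "cmod (U s T - E s T (N n)) \<le> 2 * (1 / 2) ^ n" by (rule U_tail)
          also have "\<dots> \<le> 2 * (1 / 2) ^ i" using elim by (intro mult_left_mono power_decreasing) auto
          also have "\<dots> < e" using i(2) zero_less_power[of "1 / 2 :: real" i] by linarith
          finally show ?thesis by (simp add: dist_norm norm_minus_commute)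
        qed
        thus ?case by auto
      qed
    qed
  qed simp
  show ?thesis
  proof (rule continuous_on_eq_continuous_within[THEN iffD2], rule ballI)
    fix p :: "real \<times> real" assume p: "p \<in> {-c2..c2} \<times> {0<..}"
    define T0 where "T0 = snd p / 2"
    have T0: "T0 > 0" "T0 < snd p" using p by (auto simp: T0_def)
    have "continuous (at p within {-c2..c2} \<times> {T0<..}) (\<lambda>(s, T). U s T)"
      using loc[OF T0(1)] p T0 by (auto simp: continuous_on_eq_continuous_within)
    moreover have "at p within {-c2..c2} \<times> {T0<..} = at p within {-c2..c2} \<times> {0<..}"
    proof (rule at_within_nhd)
      show "p \<in> UNIV \<times> {T0<..}" using T0 by (cases p) auto
      show "open (UNIV \<times> {T0<..} :: (real \<times> real) set)" by (intro open_Times) auto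
      show "{-c2..c2} \<times> {T0<..} \<inter> UNIV \<times> {T0<..} - {p} = {-c2..c2} \<times> {0<..} \<inter> UNIV \<times> {T0<..} - {p}"
        using T0 by auto
    qed
    ultimately show "continuous (at p within {-c2..c2} \<times> {0<..}) (\<lambda>(s, T). U s T)" by simp
  qed
qed

text \<open>The weight is at most \<open>2 * l\<close> on the support of \<open>h\<close>, which
  leaves \<open>2 / (l * (ln l)\<^sup>2)\<close> with antiderivative \<open>- 2 / ln l\<close>: the
  second logarithm is what makes the integral converge.\<close>

lemma sobolev_finite:
  "(\<integral>\<^sup>+l. ennreal ((l\<^sup>2 + 1) powr (1/2) * (cmod (h l))\<^sup>2) \<partial>lborel) < \<infinity>"
proof -
  have "(\<integral>\<^sup>+l. ennreal ((l\<^sup>2 + 1) powr (1/2) * (cmod (h l))\<^sup>2) \<partial>lborel)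
      \<le> (\<integral>\<^sup>+l. ennreal (2 / (l * (ln l)\<^sup>2)) * indicator {N 0..} l \<partial>lborel)"
  proof (rule nn_integral_mono)
    fix l
    show "ennreal ((l\<^sup>2 + 1) powr (1/2) * (cmod (h l))\<^sup>2) \<le> ennreal (2 / (l * (ln l)\<^sup>2)) * indicator {N 0..} l"
    proof (cases "l < N 0")
      case False
      hence "exp 1 \<le> l" using N_0 by simp
      note l = ln_ge_1[OF this]
      have "l\<^sup>2 + 1 \<le> (2 * l)\<^sup>2" using mult_mono[of 1 l 1 l] l(2) by (simp add: power2_eq_square)
      hence "sqrt (l\<^sup>2 + 1) \<le> 2 * l" using l by (intro real_le_lsqrt) auto
      hence "(l\<^sup>2 + 1) powr (1/2) * (amp l)\<^sup>2 \<le> 2 * l * (amp l)\<^sup>2"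
        using powr_half_sqrt[of "l\<^sup>2 + 1"] by (intro mult_right_mono) auto
      also have "\<dots> = 2 / (l * (ln l)\<^sup>2)"
        using l by (simp add: amp_def power2_eq_square field_simps)
      finally show ?thesis using False by (simp add: cmod_h ennreal_leI)
    qed (simp add: cmod_h)
  qed
  also have "\<dots> = ennreal (0 - (- 2 / ln (N 0)))"
  proof (rule nn_integral_FTC_atLeast[where F = "\<lambda>l. - 2 / ln l"])
    show "((\<lambda>l::real. - 2 / ln l) \<longlongrightarrow> 0) at_top" by real_asymp
  next
    fix l assume "N 0 \<le> l"
    hence "exp 1 \<le> l" using N_0 by simp
    note l = ln_ge_1[OF this]
    show "((\<lambda>l. - 2 / ln l) has_real_derivative 2 / (l * (ln l)\<^sup>2)) (at l)"
      using l by (auto intro!: derivative_eq_intros simp: power2_eq_square divide_simps)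
    show "0 \<le> 2 / (l * (ln l)\<^sup>2)" using l by simp
  qed measurable
  also have "\<dots> < \<infinity>" by simp
  finally show ?thesis .
qed

lemma h_L2: "(\<integral>\<^sup>+l. ennreal ((cmod (h l))\<^sup>2) \<partial>lborel) < \<infinity>"
proof (rule le_less_trans[OF nn_integral_mono sobolev_finite])
  fix l :: real
  have "1 \<le> (l\<^sup>2 + 1) powr (1/2)" by (intro ge_one_powr_ge_zero) auto
  thus "ennreal ((cmod (h l))\<^sup>2) \<le> ennreal ((l\<^sup>2 + 1) powr (1/2) * (cmod (h l))\<^sup>2)"
    using mult_right_mono[of 1 "(l\<^sup>2 + 1) powr (1/2)" "(cmod (h l))\<^sup>2"] by (intro ennreal_leI) simp
qed

section \<open>Frequency cut-offs of the profile and the limit at time 0\<close>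

lemma isCont_h:
  assumes "l \<notin> range N"
  shows "isCont h l"
proof (cases "l < N 0")
  case True
  hence "eventually (\<lambda>x. x \<in> {..<N 0}) (nhds l)" by (intro eventually_nhds_in_open) auto
  hence "eventually (\<lambda>x. h x = 0) (nhds l)" by eventually_elim (simp add: h_def)
  thus ?thesis by (subst isCont_cong[where g = "\<lambda>_. 0"]) auto
next
  case False
  then obtain k where k: "N k \<le> l" "l < N (Suc k)" using block_exists[of 0 l] by auto
  have "l \<noteq> N k" using assms by blast
  hence "eventually (\<lambda>x. x \<in> {N k<..<N (Suc k)}) (nhds l)"
    using k by (intro eventually_nhds_in_open) auto
  hence ev: "eventually (\<lambda>x. h x = of_real (amp x) * cis (- (t k * x\<^sup>2 + \<sigma> k * x))) (nhds l)"
    by eventually_elim (intro h_block, auto)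
  have "isCont amp l" using amp_deriv[of l] N_ge[of k] k by (intro DERIV_isCont) auto
  thus ?thesis
    unfolding isCont_cong[OF ev] cis_conv_exp by (intro continuous_intros)
qed

definition hN :: "nat \<Rightarrow> real \<Rightarrow> complex" where
  "hN n l = indicator {0<..N n} l *\<^sub>R h l"

lemma measurable_hN [measurable]: "hN n \<in> borel_measurable borel"
  unfolding hN_def by measurable

lemma tame_hN_diff: "tame (\<lambda>l. hN m l - hN n l)" and tame_hN: "tame (hN n)"
proof -
  have AE: "AE l in lborel. l \<notin> insert 0 (range N)"
    by (intro AE_not_in countable_imp_null_set_lborel) auto
  have cont: "isCont (hN n) l" if "l \<notin> insert 0 (range N)" for n l
  proof -
    have "frontier {0<..N n} \<subseteq> {0, N n}"
      using N_pos[of n] by (simp add: frontier_def)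
    hence "isCont (indicator {0<..N n} :: real \<Rightarrow> real) l" using that by (auto simp: isCont_indicator)
    thus ?thesis using isCont_h[of l] that unfolding hN_def by (intro isCont_scaleR) auto
  qed
  have b: "cmod (hN n l) \<le> 1" for n l
    using cmod_h_le[of l] by (auto simp: hN_def indicator_def)
  have z: "hN n l = 0" if "l \<notin> {0..N n}" for n l
    using that by (auto simp: hN_def indicator_def)
  show "tame (hN n)"
    unfolding tame_def
  proof (intro conjI)
    show "\<exists>C. \<forall>l. cmod (hN n l) \<le> C" using b by blast
    show "\<exists>L. \<forall>l. l \<notin> {0..L} \<longrightarrow> hN n l = 0" using z by blast
    show "AE l in lborel. isCont (hN n) l"
      using AE by (rule eventually_mono) (rule cont)
  qed measurable
  show "tame (\<lambda>l. hN m l - hN n l)"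
    unfolding tame_def
  proof (intro conjI)
    show "\<exists>C. \<forall>l. cmod (hN m l - hN n l) \<le> C"
      by (intro exI[of _ 2] allI order_trans[OF norm_triangle_ineq4]) (use b[of m] b[of n] in \<open>smt (verit)\<close>)
    show "\<exists>L. \<forall>l. l \<notin> {0..L} \<longrightarrow> hN m l - hN n l = 0"
    proof (intro exI[of _ "max (N m) (N n)"] allI impI)
      fix l assume "l \<notin> {0..max (N m) (N n)}"
      hence "l \<notin> {0..N m}" "l \<notin> {0..N n}" by auto
      thus "hN m l - hN n l = 0" using z[of l m] z[of l n] by simp
    qed
    show "AE l in lborel. isCont (\<lambda>l. hN m l - hN n l) l"
      using AE by (rule eventually_mono) (intro continuous_intros cont)
  qed measurable
qed

text \<open>The sine transform of the full profile, defined as a pointwise limit because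
  \<open>h\<close> is not integrable. Up to a constant it is \<open>sinh s\<close> times the initial
  datum.\<close>

definition \<Phi> :: "real \<Rightarrow> complex" where
  "\<Phi> s = U s 0"

definition \<Phi>N :: "nat \<Rightarrow> real \<Rightarrow> complex" where
  "\<Phi>N n s = E s 0 (N n)"

lemma sine_transform_hN: "sine_transform (hN n) = \<Phi>N n"
  by (rule ext) (simp add: sine_transform_def hN_def \<Phi>N_def E_def set_lebesgue_integral_def)

lemma measurable_\<Phi>N [measurable]: "\<Phi>N n \<in> borel_measurable borel"
  unfolding sine_transform_hN[symmetric] by (rule measurable_sine_transform[OF tame_integrable(1)[OF tame_hN]])

lemma \<Phi>N_tendsto: "(\<lambda>n. \<Phi>N n s) \<longlonglongrightarrow> \<Phi> s"
proof -
  have "\<bar>s\<bar> \<le> c2 + real (nat \<lceil>\<bar>s\<bar>\<rceil>)" using \<sigma>[of 0] c1 by linarith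
  from E_N_tendsto[OF unfocused_0[OF this]] show ?thesis by (simp add: \<Phi>N_def \<Phi>_def)
qed

lemma measurable_\<Phi> [measurable]: "\<Phi> \<in> borel_measurable borel"
  by (rule borel_measurable_LIMSEQ_metric[OF measurable_\<Phi>N \<Phi>N_tendsto])

text \<open>Supplies the majorant for letting the frequency cut-off tend to infinity on a bounded
  range of radii. At time 0 the blocks from \<open>j\<close> on form a convergent series on that
  range; the earlier ones are bounded trivially.\<close>

lemma \<Phi>N_bounded:
  obtains B where "\<And>n s. \<bar>s\<bar> \<le> T \<Longrightarrow> cmod (\<Phi>N n s) \<le> B"
proof -
  define j where "j = nat \<lceil>T\<rceil>"
  have "cmod (\<Phi>N n s) \<le> ln (ln (N j)) + 2" if "\<bar>s\<bar> \<le> T" for n s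
  proof (cases "j \<le> n")
    case True
    have "\<bar>s\<bar> \<le> c2 + real j" using \<sigma>[of 0] c1 that unfolding j_def by linarith
    from E_tail[OF unfocused_0[OF this], of "N n"] True
    have "cmod (\<Phi>N n s - \<Phi>N j s) \<le> 2 * (1 / 2) ^ j"
      using strict_mono_less_eq[OF N_strict_mono, of j n] by (simp add: \<Phi>N_def)
    moreover have "2 * (1 / 2 :: real) ^ j \<le> 2" by (simp add: power_le_one)
    moreover have "cmod (\<Phi>N j s) \<le> ln (ln (N j))" unfolding \<Phi>N_def by (rule E_crude)
    ultimately show ?thesis using norm_triangle_sub[of "\<Phi>N n s" "\<Phi>N j s"] by linarith
  next
    case False
    have "ln (ln (N n)) \<le> ln (ln (N j))"
      using False strict_mono_less_eq[OF N_strict_mono, of n j] ln_ge_1[OF N_ge[of n]] ln_ge_1[OF N_ge[of j]]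
      by simp
    moreover have "cmod (\<Phi>N n s) \<le> ln (ln (N n))" unfolding \<Phi>N_def by (rule E_crude)
    ultimately show ?thesis by linarith
  qed
  thus thesis using that by blast
qed

end

section \<open>\<open>L\<^sup>2\<close> theory of the profile\<close>

lemma nn_integral_Fatou_le:
  fixes u :: "nat \<Rightarrow> 'a \<Rightarrow> ennreal"
  assumes u: "\<And>n. u n \<in> borel_measurable M"
    and lim: "\<And>x. x \<in> space M \<Longrightarrow> (\<lambda>n. u n x) \<longlonglongrightarrow> v x"
    and le: "\<And>n. (\<integral>\<^sup>+x. u n x \<partial>M) \<le> b n" and b: "b \<longlonglongrightarrow> B"
  shows "(\<integral>\<^sup>+x. v x \<partial>M) \<le> B"
proof -
  have "(\<integral>\<^sup>+x. v x \<partial>M) = (\<integral>\<^sup>+x. liminf (\<lambda>n. u n x) \<partial>M)"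
    using lim by (intro nn_integral_cong lim_imp_Liminf[symmetric]) auto
  also have "\<dots> \<le> liminf (\<lambda>n. \<integral>\<^sup>+x. u n x \<partial>M)" by (rule nn_integral_liminf[OF u])
  also have "\<dots> \<le> liminf b" using le by (intro Liminf_mono) auto
  also have "\<dots> = B" using b by (simp add: lim_imp_Liminf)
  finally show ?thesis .
qed

lemma nn_integral_tail_tendsto_0:
  fixes k X :: "_ \<Rightarrow> real"
  assumes [measurable]: "k \<in> borel_measurable borel"
    and fin: "(\<integral>\<^sup>+l. ennreal (k l) \<partial>lborel) < \<infinity>" and X: "filterlim X at_top sequentially"
  shows "(\<lambda>n. \<integral>\<^sup>+l. ennreal (indicator {X n<..} l * k l) \<partial>lborel) \<longlonglongrightarrow> 0"
proof -
  have "(\<lambda>n. \<integral>\<^sup>+l. ennreal (indicator {X n<..} l * k l) \<partial>lborel) \<longlonglongrightarrow> (\<integral>\<^sup>+l. (0::ennreal) \<partial>(lborel :: real measure))"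
  proof (rule nn_integral_dominated_convergence[where w = "\<lambda>l. ennreal (k l)"])
    show "AE l in lborel. (\<lambda>n. ennreal (indicator {X n<..} l * k l)) \<longlonglongrightarrow> 0"
    proof (rule AE_I2)
      fix l
      have "eventually (\<lambda>n. l \<le> X n) sequentially" using X by (simp add: filterlim_at_top)
      hence "eventually (\<lambda>n. ennreal (indicator {X n<..} l * k l) = 0) sequentially"
        by eventually_elim simp
      thus "(\<lambda>n. ennreal (indicator {X n<..} l * k l)) \<longlonglongrightarrow> 0" by (rule tendsto_eventually)
    qed
  qed (use fin in \<open>auto simp: indicator_def\<close>)
  thus ?thesis by simp
qed

lemma cmod_diff_square_le: "(cmod (a - b))\<^sup>2 \<le> 2 * (cmod a)\<^sup>2 + 2 * (cmod b)\<^sup>2"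
proof -
  have "(cmod (a - b))\<^sup>2 \<le> (cmod a + cmod b)\<^sup>2" by (intro power_mono norm_triangle_ineq4) simp
  also have "\<dots> \<le> 2 * (cmod a)\<^sup>2 + 2 * (cmod b)\<^sup>2"
    using zero_le_power2[of "cmod a - cmod b"] by (simp add: power2_eq_square algebra_simps)
  finally show ?thesis .
qed

lemma half_pi_mult_le:
  assumes "P = ennreal (pi / 2) * X" and "X \<le> ennreal 2 * A + ennreal 2 * B"
  shows "P \<le> ennreal pi * A + ennreal pi * B"
proof -
  have "ennreal (pi / 2) * ennreal 2 = ennreal pi" by (subst ennreal_mult'[symmetric]) auto
  hence "ennreal (pi / 2) * (ennreal 2 * A + ennreal 2 * B) = ennreal pi * A + ennreal pi * B"
    by (simp only: distrib_left mult.assoc[symmetric])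
  thus ?thesis using assms mult_left_mono[OF assms(2), of "ennreal (pi / 2)"] by simp
qed

context focusing
begin

definition h_tail :: "nat \<Rightarrow> ennreal" where
  "h_tail n = (\<integral>\<^sup>+l. ennreal (indicator {N n<..} l * (cmod (h l))\<^sup>2) \<partial>lborel)"

lemma h_tail_tendsto: "h_tail \<longlonglongrightarrow> 0"
  unfolding h_tail_def by (intro nn_integral_tail_tendsto_0 filterlim_N h_L2) measurable

lemma sine_transform_hN_diff:
  assumes "n \<le> m"
  shows "sine_transform (\<lambda>l. hN m l - hN n l) = (\<lambda>s. \<Phi>N m s - \<Phi>N n s)"
    and "hN m l - hN n l = indicator {N n<..N m} l *\<^sub>R h l"
proof -
  have le: "N n \<le> N m" using assms strict_mono_less_eq[OF N_strict_mono, of n m] by simp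
  show *: "hN m l - hN n l = indicator {N n<..N m} l *\<^sub>R h l" for l
    using le N_pos[of n] by (auto simp: hN_def indicator_def)
  show "sine_transform (\<lambda>l. hN m l - hN n l) = (\<lambda>s. \<Phi>N m s - \<Phi>N n s)"
    unfolding \<Phi>N_def using le N_pos[of n]
    by (intro ext) (simp add: E_diff sine_transform_def * set_lebesgue_integral_def)
qed

lemma \<Phi>N_diff_le:
  assumes "n \<le> m"
  shows "(\<integral>\<^sup>+s. ennreal (indicator {0<..} s * (cmod (\<Phi>N m s - \<Phi>N n s))\<^sup>2) \<partial>lborel) \<le> ennreal (pi / 2) * h_tail n"
proof -
  have "(\<integral>\<^sup>+s. ennreal (indicator {0<..} s * (cmod (\<Phi>N m s - \<Phi>N n s))\<^sup>2) \<partial>lborel) =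
      ennreal (pi / 2) * (\<integral>\<^sup>+l. ennreal ((cmod (hN m l - hN n l))\<^sup>2) \<partial>lborel)"
    using nn_sine_transform_plancherel[OF tame_hN_diff, of m n] by (simp only: sine_transform_hN_diff(1)[OF assms])
  also have "\<dots> \<le> ennreal (pi / 2) * h_tail n"
    unfolding h_tail_def
    by (intro mult_left_mono nn_integral_mono ennreal_leI)
       (auto simp: sine_transform_hN_diff(2)[OF assms] indicator_def)
  finally show ?thesis .
qed

text \<open>Plancherel bounds the distance between two cut-offs, and Fatou passes to the pointwise
  limit. The limit in the mean is thereby identified with \<open>\<Phi>\<close> itself.\<close>

lemma \<Phi>_diff_le:
  "(\<integral>\<^sup>+s. ennreal (indicator {0<..} s * (cmod (\<Phi> s - \<Phi>N n s))\<^sup>2) \<partial>lborel) \<le> ennreal (pi / 2) * h_tail n"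
proof (rule nn_integral_Fatou_le)
  show "(\<lambda>s. ennreal (indicator {0<..} s * (cmod (\<Phi>N (m + n) s - \<Phi>N n s))\<^sup>2)) \<in> borel_measurable lborel" for m
    by measurable
  show "(\<lambda>m. ennreal (indicator {0<..} s * (cmod (\<Phi>N (m + n) s - \<Phi>N n s))\<^sup>2)) \<longlonglongrightarrow>
      ennreal (indicator {0<..} s * (cmod (\<Phi> s - \<Phi>N n s))\<^sup>2)" for s
    by (intro tendsto_ennrealI tendsto_intros LIMSEQ_ignore_initial_segment \<Phi>N_tendsto)
  show "(\<integral>\<^sup>+s. ennreal (indicator {0<..} s * (cmod (\<Phi>N (m + n) s - \<Phi>N n s))\<^sup>2) \<partial>lborel) \<le> ennreal (pi / 2) * h_tail n" for m
    by (rule \<Phi>N_diff_le) simp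
qed simp

lemma \<Phi>_L2: "(\<integral>\<^sup>+s. ennreal (indicator {0<..} s * (cmod (\<Phi> s))\<^sup>2) \<partial>lborel) < \<infinity>"
proof -
  have "(\<integral>\<^sup>+s. ennreal (indicator {0<..} s * (cmod (\<Phi> s))\<^sup>2) \<partial>lborel)
      \<le> ennreal (pi / 2) * (\<integral>\<^sup>+l. ennreal ((cmod (h l))\<^sup>2) \<partial>lborel)"
  proof (rule nn_integral_Fatou_le)
    show "(\<lambda>s. ennreal (indicator {0<..} s * (cmod (\<Phi>N m s))\<^sup>2)) \<in> borel_measurable lborel" for m
      by measurable
    show "(\<lambda>m. ennreal (indicator {0<..} s * (cmod (\<Phi>N m s))\<^sup>2)) \<longlonglongrightarrow>
        ennreal (indicator {0<..} s * (cmod (\<Phi> s))\<^sup>2)" for s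
      by (intro tendsto_ennrealI tendsto_intros \<Phi>N_tendsto)
    show "(\<integral>\<^sup>+s. ennreal (indicator {0<..} s * (cmod (\<Phi>N m s))\<^sup>2) \<partial>lborel)
        \<le> ennreal (pi / 2) * (\<integral>\<^sup>+l. ennreal ((cmod (h l))\<^sup>2) \<partial>lborel)" for m
      unfolding nn_sine_transform_plancherel[OF tame_hN, unfolded sine_transform_hN]
      by (intro mult_left_mono nn_integral_mono ennreal_leI) (auto simp: hN_def indicator_def)
  qed simp
  also have "\<dots> < \<infinity>" using h_L2 by (simp add: ennreal_mult_less_top)
  finally show ?thesis .
qed

definition \<Phi>_tail :: "real \<Rightarrow> ennreal" where
  "\<Phi>_tail T = (\<integral>\<^sup>+s. ennreal (indicator {T<..} s * (indicator {0<..} s * (cmod (\<Phi> s))\<^sup>2)) \<partial>lborel)"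

lemma \<Phi>_tail_tendsto: "(\<lambda>n. \<Phi>_tail (real n)) \<longlonglongrightarrow> 0"
  unfolding \<Phi>_tail_def
  by (intro nn_integral_tail_tendsto_0 filterlim_real_sequentially \<Phi>_L2) measurable

text \<open>A cut-off in radius, in contrast to the frequency cut-off \<open>\<Phi>N\<close>:
  bounded with bounded support, it leads to the integrable approximants that the definition of the
  transform asks for.\<close>

definition \<Psi> :: "real \<Rightarrow> real \<Rightarrow> complex" where
  "\<Psi> T s = indicator {0..T} s *\<^sub>R \<Phi> s"

lemma measurable_\<Psi> [measurable]: "\<Psi> T \<in> borel_measurable borel"
  unfolding \<Psi>_def by measurable

lemma \<Psi>_bounded:
  "\<exists>B. (\<forall>s. cmod (\<Psi> T s) \<le> B * indicator {0..T} s) \<and>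
       (\<forall>n s. cmod (indicator {0..T} s *\<^sub>R \<Phi>N n s) \<le> B * indicator {0..T} s)"
proof -
  obtain B where B: "\<And>n s. \<bar>s\<bar> \<le> T \<Longrightarrow> cmod (\<Phi>N n s) \<le> B" using \<Phi>N_bounded by blast
  have "cmod (\<Phi> s) \<le> B" if "\<bar>s\<bar> \<le> T" for s
    by (rule tendsto_upperbound[OF tendsto_norm[OF \<Phi>N_tendsto]]) (use B[OF that] in auto)
  hence "cmod (\<Psi> T s) \<le> B * indicator {0..T} s" "cmod (indicator {0..T} s *\<^sub>R \<Phi>N n s) \<le> B * indicator {0..T} s" for n s
    using B by (auto simp: \<Psi>_def indicator_def)
  thus ?thesis by blast
qed

lemma \<Psi>_integrable: "integrable lborel (\<Psi> T)"
proof -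
  obtain B where B: "\<And>s. cmod (\<Psi> T s) \<le> B * indicator {0..T} s" using \<Psi>_bounded by blast
  show ?thesis
  proof (rule integrableI_bounded_set[where A = "{0..T}" and B = B])
    show "AE s in lborel. s \<in> {0..T} \<longrightarrow> norm (\<Psi> T s) \<le> B"
    proof (intro AE_I2 impI)
      show "norm (\<Psi> T s) \<le> B" if "s \<in> {0..T}" for s using B[of s] that by simp
    qed
    show "AE s in lborel. s \<notin> {0..T} \<longrightarrow> \<Psi> T s = 0" by (simp add: \<Psi>_def)
  qed (auto simp: emeasure_lborel_Icc_eq)
qed

lemma measurable_sine_transform_\<Psi> [measurable]: "sine_transform (\<Psi> T) \<in> borel_measurable borel"
  by (rule measurable_sine_transform[OF \<Psi>_integrable])

lemma sine_transform_\<Psi>_tendsto: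
  "(\<lambda>m. sine_transform (\<lambda>s. indicator {0..T} s *\<^sub>R \<Phi>N m s) l) \<longlonglongrightarrow> sine_transform (\<Psi> T) l"
proof -
  obtain B where B: "\<And>n s. cmod (indicator {0..T} s *\<^sub>R \<Phi>N n s) \<le> B * indicator {0..T} s"
    using \<Psi>_bounded by blast
  show ?thesis
    unfolding sine_transform_def
  proof (rule integral_dominated_convergence)
    show "integrable lborel (\<lambda>s. B * indicator {0..T} s :: real)"
      by (intro integrable_mult_right integrable_real_indicator) (auto simp: emeasure_lborel_Icc_eq)
    show "AE s in lborel. (\<lambda>m. indicator {0..T} s *\<^sub>R \<Phi>N m s * complex_of_real (sin (s * l))) \<longlonglongrightarrow>
        \<Psi> T s * complex_of_real (sin (s * l))"
      unfolding \<Psi>_def by (intro AE_I2 tendsto_intros \<Phi>N_tendsto)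
    show "AE s in lborel. cmod (indicator {0..T} s *\<^sub>R \<Phi>N m s * complex_of_real (sin (s * l))) \<le> B * indicator {0..T} s" for m
    proof (rule AE_I2)
      fix s
      have "cmod (indicator {0..T} s *\<^sub>R \<Phi>N m s * complex_of_real (sin (s * l))) \<le> cmod (indicator {0..T} s *\<^sub>R \<Phi>N m s)"
        using mult_left_mono[OF abs_sin_le_one[of "s * l"], of "cmod (indicator {0..T} s *\<^sub>R \<Phi>N m s)"]
        unfolding norm_mult by simp
      thus "cmod (indicator {0..T} s *\<^sub>R \<Phi>N m s * complex_of_real (sin (s * l))) \<le> B * indicator {0..T} s"
        using B[of s m] by linarith
    qed
  qed measurable
qed

lemma hN_tendsto: "0 < l \<Longrightarrow> (\<lambda>n. hN n l) \<longlonglongrightarrow> h l"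
proof (rule tendsto_eventually)
  assume "0 < l"
  have "eventually (\<lambda>n. l \<le> N n) sequentially" using filterlim_N by (simp add: filterlim_at_top)
  thus "eventually (\<lambda>n. hN n l = h l) sequentially"
    by eventually_elim (use \<open>0 < l\<close> in \<open>simp add: hN_def\<close>)
qed

text \<open>The inversion error is known for the tame profiles \<open>hN m\<close>, in terms of the
  tail of \<open>\<Phi>N m\<close> beyond \<open>T\<close>. That tail is at most twice the tail of
  \<open>\<Phi>\<close> plus twice the square distance of \<open>\<Phi>N m\<close> from
  \<open>\<Phi>\<close>. With \<open>T\<close> fixed, \<open>m\<close> tends to infinity: the
  distance disappears, Fatou treats the left side, and \<open>pi / 2\<close> doubled gives
  \<open>pi\<close>.\<close>

lemma sine_transform_\<Psi>_error:
  assumes "0 \<le> T"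
  shows "(\<integral>\<^sup>+l. ennreal (indicator {0<..} l * (cmod (sine_transform (\<Psi> T) l - of_real (pi / 2) * h l))\<^sup>2) \<partial>lborel)
    \<le> ennreal pi * \<Phi>_tail T"
proof -
  let ?\<Psi> = "\<lambda>m s. indicator {0..T} s *\<^sub>R \<Phi>N m s"
  let ?u = "\<lambda>m l. ennreal (indicator {0<..} l * (cmod (sine_transform (?\<Psi> m) l - of_real (pi / 2) * hN m l))\<^sup>2)"
  have [measurable]: "sine_transform (?\<Psi> m) \<in> borel_measurable borel" for m
    using tame_truncated_sine_transform[OF tame_integrable(1)[OF tame_hN[of m]], of T]
    unfolding sine_transform_hN by (intro measurable_sine_transform tame_integrable)
  have 1: "?u m \<in> borel_measurable lborel" for m by measurable
  have 2: "(\<lambda>m. ?u m l) \<longlonglongrightarrow> ennreal (indicator {0<..} l * (cmod (sine_transform (\<Psi> T) l - of_real (pi / 2) * h l))\<^sup>2)" for l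
  proof (cases "0 < l")
    case True
    thus ?thesis
      by (intro tendsto_ennrealI tendsto_intros sine_transform_\<Psi>_tendsto hN_tendsto)
  qed simp
  have 3: "(\<integral>\<^sup>+l. ?u m l \<partial>lborel) \<le> ennreal pi * \<Phi>_tail T + ennreal pi * (ennreal (pi / 2) * h_tail m)" for m
  proof -
    have "(\<integral>\<^sup>+s. ennreal (indicator {T<..} s * (cmod (\<Phi>N m s))\<^sup>2) \<partial>lborel) \<le>
      (\<integral>\<^sup>+s. ennreal 2 * ennreal (indicator {T<..} s * (indicator {0<..} s * (cmod (\<Phi> s))\<^sup>2)) +
         ennreal 2 * ennreal (indicator {0<..} s * (cmod (\<Phi> s - \<Phi>N m s))\<^sup>2) \<partial>lborel)"
    proof (rule nn_integral_mono)
      fix s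
      let ?A = "indicator {T<..} s * (indicator {0<..} s * (cmod (\<Phi> s))\<^sup>2)"
        and ?B = "indicator {0<..} s * (cmod (\<Phi> s - \<Phi>N m s))\<^sup>2"
      have "(cmod (\<Phi>N m s))\<^sup>2 \<le> 2 * (cmod (\<Phi> s))\<^sup>2 + 2 * (cmod (\<Phi> s - \<Phi>N m s))\<^sup>2"
        using cmod_diff_square_le[of "\<Phi> s" "\<Phi> s - \<Phi>N m s"] by simp
      hence "ennreal (indicator {T<..} s * (cmod (\<Phi>N m s))\<^sup>2) \<le> ennreal (2 * ?A + 2 * ?B)"
        using assms by (intro ennreal_leI) (auto simp: indicator_def)
      also have "\<dots> = ennreal 2 * ennreal ?A + ennreal 2 * ennreal ?B"
        by (subst ennreal_plus) (auto simp only: ennreal_mult' indicator_pos_le zero_le_power2 mult_nonneg_nonneg zero_le_numeral)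
      finally show "ennreal (indicator {T<..} s * (cmod (\<Phi>N m s))\<^sup>2) \<le>
         ennreal 2 * ennreal (indicator {T<..} s * (indicator {0<..} s * (cmod (\<Phi> s))\<^sup>2)) +
         ennreal 2 * ennreal (indicator {0<..} s * (cmod (\<Phi> s - \<Phi>N m s))\<^sup>2)" .
    qed
    also have "\<dots> = ennreal 2 * \<Phi>_tail T + ennreal 2 * (\<integral>\<^sup>+s. ennreal (indicator {0<..} s * (cmod (\<Phi> s - \<Phi>N m s))\<^sup>2) \<partial>lborel)"
    proof -
      define f where "f = (\<lambda>s. ennreal (indicator {T<..} s * (indicator {0<..} s * (cmod (\<Phi> s))\<^sup>2)))"
      define g where "g = (\<lambda>s. ennreal (indicator {0<..} s * (cmod (\<Phi> s - \<Phi>N m s))\<^sup>2))"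
      have [measurable]: "f \<in> borel_measurable lborel" "g \<in> borel_measurable lborel"
        unfolding f_def g_def by measurable
      have "(\<integral>\<^sup>+s. ennreal 2 * f s + ennreal 2 * g s \<partial>lborel) = (\<integral>\<^sup>+s. ennreal 2 * f s \<partial>lborel) + (\<integral>\<^sup>+s. ennreal 2 * g s \<partial>lborel)"
        by (rule nn_integral_add) measurable
      also have "\<dots> = ennreal 2 * (\<integral>\<^sup>+s. f s \<partial>lborel) + ennreal 2 * (\<integral>\<^sup>+s. g s \<partial>lborel)"
        by (subst (1 2) nn_integral_cmult) measurable
      finally show ?thesis unfolding \<Phi>_tail_def f_def g_def .
    qed
    also have "\<dots> \<le> ennreal 2 * \<Phi>_tail T + ennreal 2 * (ennreal (pi / 2) * h_tail m)"
      by (intro add_left_mono mult_left_mono \<Phi>_diff_le) auto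
    finally have "(\<integral>\<^sup>+s. ennreal (indicator {T<..} s * (cmod (\<Phi>N m s))\<^sup>2) \<partial>lborel) \<le>
        ennreal 2 * \<Phi>_tail T + ennreal 2 * (ennreal (pi / 2) * h_tail m)" .
    note bound = this
    show ?thesis
      by (rule half_pi_mult_le[OF _ bound])
         (use sine_transform_inversion_error[OF tame_hN assms, of m] in \<open>simp only: sine_transform_hN\<close>)
  qed
  have "(\<lambda>m. ennreal pi * \<Phi>_tail T + ennreal pi * (ennreal (pi / 2) * h_tail m)) \<longlonglongrightarrow>
      ennreal pi * \<Phi>_tail T + ennreal pi * (ennreal (pi / 2) * 0)"
    by (intro tendsto_add[OF tendsto_const] ennreal_tendsto_cmult[OF ennreal_less_top] h_tail_tendsto)
  hence 4: "(\<lambda>m. ennreal pi * \<Phi>_tail T + ennreal pi * (ennreal (pi / 2) * h_tail m)) \<longlonglongrightarrow> ennreal pi * \<Phi>_tail T"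
    by (simp only: mult_zero_right add_0_right)
  show ?thesis by (rule nn_integral_Fatou_le[OF 1 2 3 4])
qed

end

section \<open>The radial datum and its propagation\<close>

lemma nn_integral_H3_radial:
  assumes [measurable]: "G \<in> borel_measurable borel"
  shows "(\<integral>\<^sup>+x. G (H3_dist H3_base x) \<partial>H3_measure) =
     (\<integral>\<^sup>+s. ennreal (4 * pi * (sinh s)\<^sup>2 * indicator {0<..} s) * G s \<partial>lborel)"
proof -
  have "(\<integral>\<^sup>+x. G (H3_dist H3_base x) \<partial>H3_measure) = (\<integral>\<^sup>+s. G s \<partial>distr H3_measure borel (H3_dist H3_base))"
    by (rule nn_integral_distr[symmetric, OF H3_dist_measurable]) simp
  thus ?thesis unfolding distr_H3_dist by (simp add: nn_integral_density)
qed

lemma integral_H3_radial: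
  fixes G :: "real \<Rightarrow> complex"
  assumes [measurable]: "G \<in> borel_measurable borel"
  shows "(LINT x|H3_measure. G (H3_dist H3_base x)) =
     (LINT s|lborel. (4 * pi * (sinh s)\<^sup>2 * indicator {0<..} s) *\<^sub>R G s)"
proof -
  have "(LINT x|H3_measure. G (H3_dist H3_base x)) = (LINT s|distr H3_measure borel (H3_dist H3_base). G s)"
    by (rule integral_distr[symmetric, OF H3_dist_measurable]) simp
  thus ?thesis unfolding distr_H3_dist by (simp add: integral_density)
qed

lemma nn_integral_plancherel:
  assumes [measurable]: "G \<in> borel_measurable borel"
  shows "(\<integral>\<^sup>+l. G l \<partial>plancherel_measure) = (\<integral>\<^sup>+l. ennreal (indicator {0<..} l * l\<^sup>2) * G l \<partial>lborel)"
proof -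
  have "(\<integral>\<^sup>+l. G l \<partial>plancherel_measure) = (\<integral>\<^sup>+l. ennreal (l\<^sup>2) * G l \<partial>restrict_space lborel {0<..})"
    unfolding plancherel_measure_def by (subst nn_integral_density) (auto intro!: measurable_restrict_space1)
  also have "\<dots> = (\<integral>\<^sup>+l. ennreal (l\<^sup>2) * G l * indicator {0<..} l \<partial>lborel)"
    by (rule nn_integral_restrict_space) simp
  also have "\<dots> = (\<integral>\<^sup>+l. ennreal (indicator {0<..} l * l\<^sup>2) * G l \<partial>lborel)"
    by (intro nn_integral_cong) (auto simp: indicator_def)
  finally show ?thesis .
qed

lemma measurable_plancherel:
  "G \<in> borel_measurable borel \<Longrightarrow> G \<in> borel_measurable plancherel_measure"
  unfolding plancherel_measure_def by (auto intro!: measurable_restrict_space1)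

lemma square_integrableI:
  assumes "f \<in> borel_measurable M" "(\<integral>\<^sup>+x. ennreal ((cmod (f x))\<^sup>2) \<partial>M) < \<infinity>"
  shows "square_integrable M f"
  unfolding square_integrable_def using assms by (auto intro!: integrableI_nonneg)

lemma tanh_artanh:
  fixes x :: real
  assumes "\<bar>x\<bar> < 1"
  shows "tanh (artanh x) = x"
proof -
  have "0 < (1 + x) / (1 - x)" using assms by auto
  hence e: "exp (- 2 * artanh x) = (1 - x) / (1 + x)"
    by (simp add: artanh_def exp_minus)
  show ?thesis unfolding tanh_real_altdef e using assms by (simp add: field_simps)
qed

text \<open>The function \<open>x - tanh x\<close> has derivative \<open>(tanh x)\<^sup>2\<close>
  and increases. On a ray this transfers closeness of geodesic radii to the Euclidean topology of
  the ball.\<close>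

lemma tanh_lipschitz:
  fixes a b :: real
  shows "\<bar>tanh a - tanh b\<bar> \<le> \<bar>a - b\<bar>"
proof -
  have "b - tanh b \<le> a - tanh a" if "b \<le> a" for a b :: real
  proof (rule DERIV_nonneg_imp_nondecreasing[OF that])
    fix x :: real
    have "((\<lambda>x. x - tanh x) has_real_derivative (tanh x)\<^sup>2) (at x)"
      by (auto intro!: derivative_eq_intros)
    thus "\<exists>y. ((\<lambda>x. x - tanh x) has_real_derivative y) (at x) \<and> 0 \<le> y" by auto
  qed
  from this[of a b] this[of b a] show ?thesis
    using tanh_real_le_iff[of a b] tanh_real_le_iff[of b a] by (cases "a \<le> b") auto
qed

section \<open>The datum and its spherical transform\<close>

context focusing
begin

definition g :: "real \<Rightarrow> complex" where
  "g l = h l / of_real l"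

lemma measurable_g [measurable]: "g \<in> borel_measurable borel"
  unfolding g_def by measurable

lemma g_weight: "indicator {0<..} l * l\<^sup>2 * (cmod (g l))\<^sup>2 = (cmod (h l))\<^sup>2"
proof (cases "0 < l")
  case True
  thus ?thesis by (simp add: g_def norm_divide power_divide)
next
  case False
  hence "h l = 0" using N_pos[of 0] by (simp add: h_def)
  thus ?thesis by (simp add: g_def)
qed

lemma sobolev_g:
  "(\<integral>\<^sup>+l. ennreal ((l\<^sup>2 + 1) powr (1/2) * (cmod (g l))\<^sup>2) \<partial>plancherel_measure) < \<infinity>"
proof -
  have "(\<integral>\<^sup>+l. ennreal ((l\<^sup>2 + 1) powr (1/2) * (cmod (g l))\<^sup>2) \<partial>plancherel_measure) =
      (\<integral>\<^sup>+l. ennreal (indicator {0<..} l * l\<^sup>2) * ennreal ((l\<^sup>2 + 1) powr (1/2) * (cmod (g l))\<^sup>2) \<partial>lborel)"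
    by (rule nn_integral_plancherel) measurable
  also have "\<dots> = (\<integral>\<^sup>+l. ennreal ((l\<^sup>2 + 1) powr (1/2) * (cmod (h l))\<^sup>2) \<partial>lborel)"
  proof (rule nn_integral_cong)
    fix l :: real
    have "indicator {0<..} l * l\<^sup>2 * ((l\<^sup>2 + 1) powr (1/2) * (cmod (g l))\<^sup>2) = (l\<^sup>2 + 1) powr (1/2) * (cmod (h l))\<^sup>2"
      unfolding g_weight[symmetric] by simp
    thus "ennreal (indicator {0<..} l * l\<^sup>2) * ennreal ((l\<^sup>2 + 1) powr (1/2) * (cmod (g l))\<^sup>2) =
        ennreal ((l\<^sup>2 + 1) powr (1/2) * (cmod (h l))\<^sup>2)"
      by (subst ennreal_mult'[symmetric]) auto
  qed
  also have "\<dots> < \<infinity>" by (rule sobolev_finite)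
  finally show ?thesis .
qed

lemma g_L2: "square_integrable plancherel_measure g"
proof (rule square_integrableI)
  have "(\<integral>\<^sup>+l. ennreal ((cmod (g l))\<^sup>2) \<partial>plancherel_measure) \<le>
     (\<integral>\<^sup>+l. ennreal ((l\<^sup>2 + 1) powr (1/2) * (cmod (g l))\<^sup>2) \<partial>plancherel_measure)"
  proof (intro nn_integral_mono ennreal_leI)
    fix l :: real
    have "1 \<le> (l\<^sup>2 + 1) powr (1/2)" by (intro ge_one_powr_ge_zero) auto
    thus "(cmod (g l))\<^sup>2 \<le> (l\<^sup>2 + 1) powr (1/2) * (cmod (g l))\<^sup>2"
      using mult_right_mono[of 1 "(l\<^sup>2 + 1) powr (1/2)" "(cmod (g l))\<^sup>2"] by simp
  qed
  thus "(\<integral>\<^sup>+l. ennreal ((cmod (g l))\<^sup>2) \<partial>plancherel_measure) < \<infinity>"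
    using sobolev_g by (rule le_less_trans)
qed (simp add: measurable_plancherel)

text \<open>The factor is \<open>(2/\<pi>) / (4\<pi> sinh s)\<close>: the sine transform has inverse \<open>2/\<pi>\<close> times itself, and
  \<open>4\<pi> sinh\<^sup>2 s\<close> is the area of the geodesic sphere of radius \<open>s\<close>.\<close>

definition rad :: "(real \<Rightarrow> complex) \<Rightarrow> real^3 \<Rightarrow> complex" where
  "rad \<phi> x = of_real (1 / (2 * pi\<^sup>2 * sinh (H3_dist H3_base x))) * \<phi> (H3_dist H3_base x)"

lemma radial_rad: "radial (rad \<phi>)"
  by (simp add: radial_def rad_def)

lemma measurable_rad:
  assumes [measurable]: "\<phi> \<in> borel_measurable borel"
  shows "rad \<phi> \<in> borel_measurable H3_measure"
proof -
  have "(\<lambda>s. of_real (1 / (2 * pi\<^sup>2 * sinh s)) * \<phi> s) \<in> borel_measurable borel" by measurable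
  from measurable_compose[OF H3_dist_measurable this] show ?thesis
    by (simp add: rad_def[abs_def])
qed

lemma rad_diff: "rad \<phi> x - rad \<psi> x = rad (\<lambda>s. \<phi> s - \<psi> s) x"
  by (simp add: rad_def right_diff_distrib)

text \<open>The area \<open>4 * pi * (sinh s)\<^sup>2\<close> cancels the hyperbolic sine in the
  square of \<open>1 / (2 * pi\<^sup>2 * sinh s)\<close> and leaves \<open>1 / pi ^ 3\<close>, so
  \<open>rad\<close> is a multiple of an isometry from the half-line.\<close>

lemma nn_integral_rad:
  assumes [measurable]: "\<phi> \<in> borel_measurable borel"
  shows "(\<integral>\<^sup>+x. ennreal ((cmod (rad \<phi> x))\<^sup>2) \<partial>H3_measure) =
     ennreal (1 / pi ^ 3) * (\<integral>\<^sup>+s. ennreal (indicator {0<..} s * (cmod (\<phi> s))\<^sup>2) \<partial>lborel)"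
proof -
  have "(\<integral>\<^sup>+x. ennreal ((cmod (rad \<phi> x))\<^sup>2) \<partial>H3_measure) =
      (\<integral>\<^sup>+s. ennreal (4 * pi * (sinh s)\<^sup>2 * indicator {0<..} s) *
        ennreal ((cmod (of_real (1 / (2 * pi\<^sup>2 * sinh s)) * \<phi> s))\<^sup>2) \<partial>lborel)"
    unfolding rad_def by (rule nn_integral_H3_radial) measurable
  also have "\<dots> = (\<integral>\<^sup>+s. ennreal (1 / pi ^ 3) * ennreal (indicator {0<..} s * (cmod (\<phi> s))\<^sup>2) \<partial>lborel)"
  proof (rule nn_integral_cong)
    fix s :: real
    have "4 * pi * (sinh s)\<^sup>2 * indicator {0<..} s * (cmod (of_real (1 / (2 * pi\<^sup>2 * sinh s)) * \<phi> s))\<^sup>2 =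
        1 / pi ^ 3 * (indicator {0<..} s * (cmod (\<phi> s))\<^sup>2)"
    proof (cases "0 < s")
      case True
      hence cm: "cmod (of_real (1 / (2 * pi\<^sup>2 * sinh s)) * \<phi> s) = cmod (\<phi> s) / (2 * pi\<^sup>2 * sinh s)"
        unfolding norm_mult norm_of_real by simp
      show ?thesis unfolding cm using True by (simp add: field_simps eval_nat_numeral)
    qed simp
    thus "ennreal (4 * pi * (sinh s)\<^sup>2 * indicator {0<..} s) * ennreal ((cmod (of_real (1 / (2 * pi\<^sup>2 * sinh s)) * \<phi> s))\<^sup>2) =
        ennreal (1 / pi ^ 3) * ennreal (indicator {0<..} s * (cmod (\<phi> s))\<^sup>2)"
      by (simp only: ennreal_mult'[symmetric] ennreal_mult''[symmetric] zero_le_power2)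
         (subst ennreal_mult'[symmetric], auto)
  qed
  also have "\<dots> = ennreal (1 / pi ^ 3) * (\<integral>\<^sup>+s. ennreal (indicator {0<..} s * (cmod (\<phi> s))\<^sup>2) \<partial>lborel)"
    by (rule nn_integral_cmult) measurable
  finally show ?thesis .
qed

lemma rad_\<Phi>_L2: "square_integrable H3_measure (rad \<Phi>)"
  by (rule square_integrableI)
     (auto simp: nn_integral_rad measurable_rad ennreal_mult_less_top intro: \<Phi>_L2[unfolded infinity_ennreal_def])

lemma rad_\<Psi>_L2: "square_integrable H3_measure (rad (\<Psi> T))"
proof (rule square_integrableI)
  have "(\<integral>\<^sup>+x. ennreal ((cmod (rad (\<Psi> T) x))\<^sup>2) \<partial>H3_measure) \<le> (\<integral>\<^sup>+x. ennreal ((cmod (rad \<Phi> x))\<^sup>2) \<partial>H3_measure)"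
    by (intro nn_integral_mono ennreal_leI) (auto simp: rad_def \<Psi>_def indicator_def)
  also have "\<dots> < \<infinity>"
    by (auto simp: nn_integral_rad ennreal_mult_less_top intro: \<Phi>_L2[unfolded infinity_ennreal_def])
  finally show "(\<integral>\<^sup>+x. ennreal ((cmod (rad (\<Psi> T) x))\<^sup>2) \<partial>H3_measure) < \<infinity>" .
qed (simp add: measurable_rad)

text \<open>Without the square one factor \<open>sinh s\<close> of the area survives; it is bounded,
  by \<open>sinh T\<close>, only thanks to the cut-off in radius.\<close>

lemma rad_\<Psi>_L1: "integrable H3_measure (rad (\<Psi> T))"
proof (rule integrableI_bounded)
  show "rad (\<Psi> T) \<in> borel_measurable H3_measure" by (simp add: measurable_rad)
  obtain B where B: "\<And>s. cmod (\<Psi> T s) \<le> B * indicator {0..T} s" using \<Psi>_bounded by blast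
  have "(\<integral>\<^sup>+x. ennreal (norm (rad (\<Psi> T) x)) \<partial>H3_measure) =
      (\<integral>\<^sup>+s. ennreal (4 * pi * (sinh s)\<^sup>2 * indicator {0<..} s) *
        ennreal (norm (of_real (1 / (2 * pi\<^sup>2 * sinh s)) * \<Psi> T s)) \<partial>lborel)"
    unfolding rad_def by (rule nn_integral_H3_radial) measurable
  also have "\<dots> \<le> (\<integral>\<^sup>+s. ennreal (2 / pi * sinh T * \<bar>B\<bar>) * indicator {0..T} s \<partial>lborel)"
  proof (rule nn_integral_mono)
    fix s :: real
    show "ennreal (4 * pi * (sinh s)\<^sup>2 * indicator {0<..} s) * ennreal (norm (of_real (1 / (2 * pi\<^sup>2 * sinh s)) * \<Psi> T s))
        \<le> ennreal (2 / pi * sinh T * \<bar>B\<bar>) * indicator {0..T} s"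
    proof (cases "0 < s \<and> s \<le> T")
      case True
      hence sh: "0 < sinh s" "sinh s \<le> sinh T" by auto
      have "4 * pi * (sinh s)\<^sup>2 * norm (of_real (1 / (2 * pi\<^sup>2 * sinh s)) * \<Psi> T s) = 2 / pi * sinh s * cmod (\<Psi> T s)"
        using sh by (simp add: norm_mult norm_divide field_simps power2_eq_square)
      also have "\<dots> \<le> 2 / pi * sinh T * \<bar>B\<bar>"
        using sh B[of s] True by (intro mult_mono mult_left_mono) auto
      finally show ?thesis using True by (simp add: ennreal_mult''[symmetric] ennreal_leI)
    qed (auto simp: \<Psi>_def indicator_def)
  qed
  also have "\<dots> = ennreal (2 / pi * sinh T * \<bar>B\<bar>) * emeasure lborel {0..T}"
    by (rule nn_integral_cmult_indicator) simp
  also have "\<dots> < \<infinity>" by (simp add: ennreal_mult_less_top emeasure_lborel_Icc_eq)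
  finally show "(\<integral>\<^sup>+x. ennreal (norm (rad (\<Psi> T) x)) \<partial>H3_measure) < \<infinity>" .
qed

lemma rad_\<Psi>_tendsto:
  "(\<lambda>n. \<integral>\<^sup>+x. ennreal ((cmod (rad (\<Psi> (real n)) x - rad \<Phi> x))\<^sup>2) \<partial>H3_measure) \<longlonglongrightarrow> 0"
proof -
  have "(\<integral>\<^sup>+x. ennreal ((cmod (rad (\<Psi> (real n)) x - rad \<Phi> x))\<^sup>2) \<partial>H3_measure) = ennreal (1 / pi ^ 3) * \<Phi>_tail (real n)" for n
  proof -
    have "(\<integral>\<^sup>+s. ennreal (indicator {0<..} s * (cmod (\<Psi> (real n) s - \<Phi> s))\<^sup>2) \<partial>lborel) = \<Phi>_tail (real n)"
      unfolding \<Phi>_tail_def by (intro nn_integral_cong) (auto simp: \<Psi>_def indicator_def)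
    thus ?thesis unfolding rad_diff by (subst nn_integral_rad) auto
  qed
  moreover have "(\<lambda>n. ennreal (1 / pi ^ 3) * \<Phi>_tail (real n)) \<longlonglongrightarrow> ennreal (1 / pi ^ 3) * 0"
    by (intro ennreal_tendsto_cmult[OF ennreal_less_top] \<Phi>_tail_tendsto)
  ultimately show ?thesis by simp
qed

text \<open>The datum and the spherical function each contribute one \<open>1 / sinh s\<close>,
  which together cancel the area. The exceptional value of the spherical function at
  \<open>s = 0\<close> sits on a null set.\<close>

lemma spherical_transform_rad_\<Psi>:
  assumes "0 < l"
  shows "spherical_transform_L1 (rad (\<Psi> T)) l = of_real (2 / (pi * l)) * sine_transform (\<Psi> T) l"
proof -
  have [measurable]: "(\<lambda>s. spherical_function l s) \<in> borel_measurable borel"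
    unfolding spherical_function_def by measurable
  have "spherical_transform_L1 (rad (\<Psi> T)) l =
      (LINT s|lborel. (4 * pi * (sinh s)\<^sup>2 * indicator {0<..} s) *\<^sub>R
         (of_real (1 / (2 * pi\<^sup>2 * sinh s)) * \<Psi> T s * of_real (spherical_function l s)))"
    unfolding spherical_transform_L1_def rad_def by (rule integral_H3_radial) measurable
  also have "\<dots> = (LINT s|lborel. of_real (2 / (pi * l)) * (\<Psi> T s * of_real (sin (s * l))))"
  proof (rule integral_cong_AE)
    have "(4 * pi * (sinh s)\<^sup>2 * indicator {0<..} s) *\<^sub>R
         (of_real (1 / (2 * pi\<^sup>2 * sinh s)) * \<Psi> T s * of_real (spherical_function l s)) =
        of_real (2 / (pi * l)) * (\<Psi> T s * of_real (sin (s * l)))" if "s \<noteq> 0" for s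
    proof (cases "0 < s")
      case True
      have "4 * pi * (sinh s)\<^sup>2 * (1 / (2 * pi\<^sup>2 * sinh s)) * (sin (l * s) / (l * sinh s)) = 2 / (pi * l) * sin (s * l)"
        using True assms by (simp add: power2_eq_square mult.commute)
      hence "complex_of_real (4 * pi * (sinh s)\<^sup>2) * of_real (1 / (2 * pi\<^sup>2 * sinh s)) * of_real (sin (l * s) / (l * sinh s)) =
          of_real (2 / (pi * l)) * of_real (sin (s * l))"
        by (simp only: of_real_mult[symmetric])
      thus ?thesis using True
        by (simp add: spherical_function_def scaleR_conv_of_real mult_ac del: of_real_mult of_real_divide of_real_power)
    next
      case False
      thus ?thesis using that by (simp add: \<Psi>_def)
    qed
    thus "AE s in lborel. (4 * pi * (sinh s)\<^sup>2 * indicator {0<..} s) *\<^sub>R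
         (of_real (1 / (2 * pi\<^sup>2 * sinh s)) * \<Psi> T s * of_real (spherical_function l s)) =
        of_real (2 / (pi * l)) * (\<Psi> T s * of_real (sin (s * l)))"
      using AE_lborel_singleton[of 0] by (auto elim!: eventually_mono)
  qed measurable
  also have "\<dots> = of_real (2 / (pi * l)) * sine_transform (\<Psi> T) l"
    unfolding sine_transform_def by (rule integral_mult_right_zero)
  finally show ?thesis .
qed

text \<open>The Plancherel weight \<open>l\<^sup>2\<close> cancels the factor \<open>1 / l\<close>
  common to both transforms, so the error is \<open>4 / pi\<^sup>2\<close> times the inversion error
  of the sine transform.\<close>

lemma spherical_transform_rad_\<Psi>_tendsto:
  "(\<lambda>n. \<integral>\<^sup>+l. ennreal ((cmod (spherical_transform_L1 (rad (\<Psi> (real n))) l - g l))\<^sup>2) \<partial>plancherel_measure) \<longlonglongrightarrow> 0"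
proof (rule tendsto_sandwich[OF _ _ tendsto_const])
  have le: "(\<integral>\<^sup>+l. ennreal ((cmod (spherical_transform_L1 (rad (\<Psi> (real n))) l - g l))\<^sup>2) \<partial>plancherel_measure)
      \<le> ennreal (4 / pi\<^sup>2) * (ennreal pi * \<Phi>_tail (real n))" for n
  proof -
    let ?S = "sine_transform (\<Psi> (real n))"
    have "(\<integral>\<^sup>+l. ennreal ((cmod (spherical_transform_L1 (rad (\<Psi> (real n))) l - g l))\<^sup>2) \<partial>plancherel_measure) =
        (\<integral>\<^sup>+l. ennreal ((cmod (of_real (2 / (pi * l)) * ?S l - g l))\<^sup>2) \<partial>plancherel_measure)"
      by (intro nn_integral_cong)
         (simp add: plancherel_measure_def space_restrict_space spherical_transform_rad_\<Psi>)
    also have "\<dots> = (\<integral>\<^sup>+l. ennreal (indicator {0<..} l * l\<^sup>2) * ennreal ((cmod (of_real (2 / (pi * l)) * ?S l - g l))\<^sup>2) \<partial>lborel)"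
      by (rule nn_integral_plancherel) measurable
    also have "\<dots> = (\<integral>\<^sup>+l. ennreal (4 / pi\<^sup>2) * ennreal (indicator {0<..} l * (cmod (?S l - of_real (pi / 2) * h l))\<^sup>2) \<partial>lborel)"
    proof (rule nn_integral_cong)
      fix l :: real
      have "indicator {0<..} l * l\<^sup>2 * (cmod (of_real (2 / (pi * l)) * ?S l - g l))\<^sup>2 =
          4 / pi\<^sup>2 * (indicator {0<..} l * (cmod (?S l - of_real (pi / 2) * h l))\<^sup>2)"
      proof (cases "0 < l")
        case True
        have "of_real (2 / (pi * l)) * ?S l - g l = of_real (2 / (pi * l)) * (?S l - of_real (pi / 2) * h l)"
          using True by (simp add: g_def field_simps)
        hence "cmod (of_real (2 / (pi * l)) * ?S l - g l) = 2 / (pi * l) * cmod (?S l - of_real (pi / 2) * h l)"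
          using True by (simp only: norm_mult norm_of_real) simp
        thus ?thesis using True by (simp add: power_mult_distrib power_divide)
      qed simp
      thus "ennreal (indicator {0<..} l * l\<^sup>2) * ennreal ((cmod (of_real (2 / (pi * l)) * ?S l - g l))\<^sup>2) =
          ennreal (4 / pi\<^sup>2) * ennreal (indicator {0<..} l * (cmod (?S l - of_real (pi / 2) * h l))\<^sup>2)"
        by (simp only: ennreal_mult''[symmetric] zero_le_power2)
           (subst ennreal_mult'[symmetric], auto)
    qed
    also have "\<dots> = ennreal (4 / pi\<^sup>2) * (\<integral>\<^sup>+l. ennreal (indicator {0<..} l * (cmod (?S l - of_real (pi / 2) * h l))\<^sup>2) \<partial>lborel)"
      by (rule nn_integral_cmult) measurable
    also have "\<dots> \<le> ennreal (4 / pi\<^sup>2) * (ennreal pi * \<Phi>_tail (real n))"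
      by (intro mult_left_mono sine_transform_\<Psi>_error) auto
    finally show ?thesis .
  qed
  show "\<forall>\<^sub>F n in sequentially. (\<integral>\<^sup>+l. ennreal ((cmod (spherical_transform_L1 (rad (\<Psi> (real n))) l - g l))\<^sup>2) \<partial>plancherel_measure)
      \<le> ennreal (4 / pi\<^sup>2) * (ennreal pi * \<Phi>_tail (real n))"
    using le by simp
  have "(\<lambda>n. ennreal (4 / pi\<^sup>2) * (ennreal pi * \<Phi>_tail (real n))) \<longlonglongrightarrow> ennreal (4 / pi\<^sup>2) * (ennreal pi * 0)"
    by (intro ennreal_tendsto_cmult[OF ennreal_less_top] \<Phi>_tail_tendsto)
  thus "(\<lambda>n. ennreal (4 / pi\<^sup>2) * (ennreal pi * \<Phi>_tail (real n))) \<longlonglongrightarrow> 0" by simp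
qed simp

lemma has_spherical_transform_rad_\<Phi>: "has_spherical_transform (rad \<Phi>) g"
  unfolding has_spherical_transform_def
  using radial_rad rad_\<Phi>_L2 g_L2 rad_\<Psi>_L1 rad_\<Psi>_L2 rad_\<Psi>_tendsto spherical_transform_rad_\<Psi>_tendsto
  by (intro conjI exI[of _ "\<lambda>n. rad (\<Psi> (real n))"]) auto

lemma rad_\<Phi>_H_half: "rad \<Phi> \<in> H_half_radial"
  unfolding H_half_radial_def using has_spherical_transform_rad_\<Phi> sobolev_g by blast

text \<open>The spectral shift by 1 contributes only the unimodular factor \<open>cis T\<close>. Of
  the weight \<open>l\<^sup>2\<close>, one factor turns \<open>g\<close> into \<open>h\<close> and
  the other cancels the denominator of the spherical function.\<close>

lemma propagation_upto_eq:
  assumes s: "0 < H3_dist H3_base x"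
  shows "propagation_upto g x T R =
     of_real (1 / sinh (H3_dist H3_base x)) * cis T * E (H3_dist H3_base x) T R"
proof -
  let ?s = "H3_dist H3_base x"
  have "propagation_upto g x T R =
      (LINT l:{0<..R}|lborel. (of_real (1 / sinh ?s) * cis T) * (h l * of_real (sin (l * ?s)) * cis (T * l\<^sup>2)))"
    unfolding propagation_upto_def set_lebesgue_integral_def
  proof (rule Bochner_Integration.integral_cong[OF refl])
    fix l :: real
    show "indicator {0<..R} l *\<^sub>R (of_real (spherical_function l ?s) * exp (\<i> * of_real (T * (l\<^sup>2 + 1))) * g l * of_real (l\<^sup>2)) =
       indicator {0<..R} l *\<^sub>R ((of_real (1 / sinh ?s) * cis T) * (h l * of_real (sin (l * ?s)) * cis (T * l\<^sup>2)))"
    proof (cases "0 < l")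
      case True
      have e: "exp (\<i> * of_real (T * (l\<^sup>2 + 1))) = cis (T * l\<^sup>2) * cis T"
        by (simp add: cis_conv_exp distrib_left exp_add)
      have "of_real (spherical_function l ?s) * exp (\<i> * of_real (T * (l\<^sup>2 + 1))) * g l * of_real (l\<^sup>2) =
          (of_real (spherical_function l ?s) * g l * of_real (l\<^sup>2)) * exp (\<i> * of_real (T * (l\<^sup>2 + 1)))"
        by (simp only: mult_ac)
      also have "of_real (spherical_function l ?s) * g l * of_real (l\<^sup>2) = of_real (1 / sinh ?s) * (h l * of_real (sin (l * ?s)))"
        using True s by (simp add: spherical_function_def g_def power2_eq_square)
      finally show ?thesis unfolding e by (simp only: mult_ac)
    qed simp
  qed
  thus ?thesis unfolding E_def by (simp only: set_integral_mult_right)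
qed

section \<open>Convergence and continuity of the propagation\<close>

lemma propagation_tendsto:
  assumes "0 < H3_dist H3_base x" and "unfocused j (H3_dist H3_base x) T"
  shows "(propagation_upto g x T \<longlongrightarrow>
     of_real (1 / sinh (H3_dist H3_base x)) * cis T * U (H3_dist H3_base x) T) at_top"
  unfolding propagation_upto_eq[OF assms(1), abs_def]
  by (intro tendsto_intros E_tendsto[OF assms(2)])

lemma propagation_eq:
  assumes "0 < H3_dist H3_base x" and "unfocused j (H3_dist H3_base x) T"
  shows "propagation_converges g x T"
    "propagation g x T = of_real (1 / sinh (H3_dist H3_base x)) * cis T * U (H3_dist H3_base x) T"
proof -
  show *: "propagation_converges g x T"
    unfolding propagation_converges_def using propagation_tendsto[OF assms] by blast
  show "propagation g x T = of_real (1 / sinh (H3_dist H3_base x)) * cis T * U (H3_dist H3_base x) T"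
    unfolding propagation_def using * propagation_tendsto[OF assms] by (simp add: tendsto_Lim)
qed

lemma unfocused_annulus:
  assumes "x \<in> H3_annulus c1 c2" "0 < T"
  obtains j where "unfocused j (H3_dist H3_base x) T"
proof -
  have "\<bar>H3_dist H3_base x\<bar> \<le> c2" using assms(1) c1 by (simp add: H3_annulus_def)
  thus thesis using unfocused_ex[OF assms(2)] that by (metis order_refl)
qed

lemma annulus_dist_pos: "x \<in> H3_annulus c1 c2 \<Longrightarrow> 0 < H3_dist H3_base x"
  using c1 by (simp add: H3_annulus_def)

lemma propagation_converges_annulus:
  "x \<in> H3_annulus c1 c2 \<Longrightarrow> 0 < T \<Longrightarrow> propagation_converges g x T"
  by (metis unfocused_annulus annulus_dist_pos propagation_eq(1))

lemma continuous_on_propagation: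
  "continuous_on (H3_annulus c1 c2 \<times> {0<..}) (\<lambda>(x, T). propagation g x T)"
proof -
  let ?A = "H3_annulus c1 c2 \<times> {0<..} :: ((real^3) \<times> real) set"
  have H3: "x \<in> H3" "norm x < 1" if "x \<in> H3_annulus c1 c2" for x
    using that by (auto simp: H3_annulus_def H3_def)
  have d: "continuous_on ?A (\<lambda>p. 2 * artanh (norm (fst p)))"
  proof -
    have "norm (fst p) \<in> {-1<..<1}" if "p \<in> ?A" for p
    proof -
      have "norm (fst p) < 1" using H3 that by auto
      thus ?thesis using norm_ge_zero[of "fst p"] unfolding greaterThanLessThan_iff by linarith
    qed
    hence "continuous_on ?A (\<lambda>p. artanh (norm (fst p)))"
      by (intro continuous_on_compose2[OF continuous_on_artanh[OF order_refl]] continuous_intros) auto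
    thus ?thesis by (intro continuous_intros)
  qed
  hence "continuous_on ?A (\<lambda>p. H3_dist H3_base (fst p))"
    by (rule continuous_on_eq) (use H3 in \<open>auto simp: H3_dist_base\<close>)
  note d = this
  have "continuous_on ?A (\<lambda>p. (\<lambda>(s, T). U s T) (H3_dist H3_base (fst p), snd p))"
  proof (rule continuous_on_compose2[OF continuous_on_U])
    show "continuous_on ?A (\<lambda>p. (H3_dist H3_base (fst p), snd p))"
      by (intro continuous_intros d)
    show "(\<lambda>p. (H3_dist H3_base (fst p), snd p)) ` ?A \<subseteq> {- c2..c2} \<times> {0<..}"
      using c1 by (auto simp: H3_annulus_def)
  qed
  hence "continuous_on ?A (\<lambda>p. of_real (1 / sinh (H3_dist H3_base (fst p))) * cis (snd p) * U (H3_dist H3_base (fst p)) (snd p))"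
    by (intro continuous_intros d) (auto dest: annulus_dist_pos)
  thus ?thesis
  proof (rule continuous_on_eq)
    fix p assume p: "p \<in> ?A"
    hence "fst p \<in> H3_annulus c1 c2" "0 < snd p" by auto
    then obtain j where "unfocused j (H3_dist H3_base (fst p)) (snd p)"
      by (rule unfocused_annulus)
    with p show "of_real (1 / sinh (H3_dist H3_base (fst p))) * cis (snd p) * U (H3_dist H3_base (fst p)) (snd p) =
        (case p of (x, T) \<Rightarrow> propagation g x T)"
      using propagation_eq(2)[of "fst p" j "snd p"] annulus_dist_pos[of "fst p"] by (auto simp: case_prod_beta)
  qed
qed

section \<open>Blow-up in the approach regions\<close>

lemma propagation_peak:
  assumes "y \<in> H3" "H3_dist H3_base y = \<sigma> k"
  shows "real k / sinh c2 \<le> cmod (propagation g y (t k))"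
proof -
  have s: "0 < \<sigma> k" "\<sigma> k \<le> c2" using \<sigma>[of k] c1 by auto
  have "real k / sinh c2 \<le> real k / sinh (\<sigma> k)"
    using s by (intro divide_left_mono) auto
  also have "\<dots> \<le> cmod (U (\<sigma> k) (t k)) / sinh (\<sigma> k)"
    using s U_peak[of k] by (intro divide_right_mono) auto
  also have "\<dots> = cmod (propagation g y (t k))"
    using propagation_eq(2)[of y "Suc k" "t k"] unfocused_focal_time[of "\<sigma> k" k] s
    by (simp add: assms norm_mult norm_divide)
  finally show ?thesis .
qed

text \<open>The witnesses lie on the ray through \<open>x\<close> at geodesic radius
  \<open>\<sigma> k\<close>, where their distance from \<open>x\<close> is at most the difference of
  the radii and so below \<open>\<gamma> (t k)\<close>. Continuity of \<open>\<gamma>\<close> forces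
  this bound to 0, so that they tend to \<open>(x, 0)\<close> in the topology of the ball while the
  peaks exceed every \<open>M\<close>.\<close>

lemma Limsup_propagation:
  fixes \<gamma> :: "real \<Rightarrow> real"
  assumes x: "x \<in> H3_annulus c1 c2"
    and \<gamma>0: "continuous_on {0..} \<gamma>" "\<gamma> 0 = 0"
    and hit: "\<And>s K. s \<in> {c1..c2} \<Longrightarrow> \<exists>k\<ge>K. \<bar>\<sigma> k - s\<bar> < \<gamma> (t k)"
  shows "Limsup (at (x, 0) within approach_region \<gamma> x) (\<lambda>(y, T). ereal (cmod (propagation g y T))) = \<infinity>"
proof (rule ereal_top, rule Limsup_greatest)
  fix M :: real and P
  assume "eventually P (at (x, 0) within approach_region \<gamma> x)"
  then obtain d where d: "0 < d"
    and P: "\<And>z. z \<in> approach_region \<gamma> x \<Longrightarrow> z \<noteq> (x, 0) \<Longrightarrow> dist z (x, 0) < d \<Longrightarrow> P z"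
    by (auto simp: eventually_at)
  let ?s = "H3_dist H3_base x"
  have xH: "norm x < 1" and s: "?s \<in> {c1..c2}" "?s = 2 * artanh (norm x)"
    using x by (auto simp: H3_annulus_def H3_def H3_dist_base)
  have nx: "norm x = tanh (?s / 2)"
    using xH by (simp add: s(2) tanh_artanh)
  have "x \<noteq> 0" using s c1 by auto
  define u where "u = x /\<^sub>R norm x"
  have u: "norm u = 1" "x = norm x *\<^sub>R u" using \<open>x \<noteq> 0\<close> by (auto simp: u_def)
  have "(\<lambda>k. \<gamma> (t k)) \<longlonglongrightarrow> \<gamma> 0"
    by (rule continuous_on_tendsto_compose[OF \<gamma>0(1) t_lim])
       (auto intro!: always_eventually less_imp_le t_pos)
  hence "eventually (\<lambda>k. \<gamma> (t k) < d / 2) sequentially"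
    by (rule order_tendstoD(2)) (use d \<gamma>0(2) in auto)
  moreover have "eventually (\<lambda>k. t k < d / 2) sequentially"
    using t_lim d by (intro order_tendstoD(2)) auto
  moreover have "eventually (\<lambda>k. M \<le> real k / sinh c2) sequentially"
  proof -
    have "0 < sinh c2" using \<sigma>[of 0] c1 by simp
    hence "filterlim (\<lambda>k. real k / sinh c2) at_top sequentially" by real_asymp
    thus ?thesis by (simp add: filterlim_at_top)
  qed
  ultimately have "eventually (\<lambda>k. \<gamma> (t k) < d / 2 \<and> t k < d / 2 \<and> M \<le> real k / sinh c2) sequentially"
    by eventually_elim auto
  then obtain K where K: "\<And>k. K \<le> k \<Longrightarrow> \<gamma> (t k) < d / 2 \<and> t k < d / 2 \<and> M \<le> real k / sinh c2"
    by (auto simp: eventually_sequentially)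
  obtain k where k: "K \<le> k" "\<bar>\<sigma> k - ?s\<bar> < \<gamma> (t k)" using hit[OF s(1), of K] by blast
  define b where "b = tanh (\<sigma> k / 2)"
  have b: "0 \<le> b" "b < 1" "2 * artanh b = \<sigma> k"
    using \<sigma>[of k] c1 by (auto simp: b_def artanh_tanh_real tanh_real_lt_1)
  define y where "y = b *\<^sub>R u"
  have y: "y \<in> H3" "H3_dist H3_base y = \<sigma> k"
    using b u by (auto simp: y_def H3_def H3_dist_base)
  have "H3_dist x y \<le> \<bar>2 * artanh b - 2 * artanh (norm x)\<bar>"
    using H3_dist_ray_le[OF u(1), of "norm x" b] xH b u(2) by (simp add: y_def)
  hence near: "H3_dist x y < \<gamma> (t k)" using k(2) b(3) s(2) by simp
  hence A: "(y, t k) \<in> approach_region \<gamma> x"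
    using y t_pos by (simp add: approach_region_def)
  have "dist y x = \<bar>b - norm x\<bar>"
  proof -
    have "y - x = (b - norm x) *\<^sub>R u" using u(2) by (simp add: y_def scaleR_diff_left)
    thus ?thesis using u(1) by (simp add: dist_norm)
  qed
  also have "\<dots> \<le> \<bar>\<sigma> k / 2 - ?s / 2\<bar>"
    unfolding nx b_def by (rule tanh_lipschitz)
  finally have "dist y x < d / 2" using k K[of k] by linarith
  moreover have "dist (y, t k) (x, 0) \<le> dist y x + \<bar>t k\<bar>"
    using sqrt_sum_squares_le_sum[of "dist y x" "\<bar>t k\<bar>"] by (simp add: dist_Pair_Pair)
  ultimately have "dist (y, t k) (x, 0) < d"
    using K[OF k(1)] t_pos[of k] by linarith
  hence "P (y, t k)" using P[OF A] t_pos[of k] by auto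
  have "ereal M \<le> ereal (cmod (propagation g y (t k)))"
    using propagation_peak[OF y] K[OF k(1)] by simp
  also have "\<dots> \<le> (SUP z\<in>Collect P. case z of (y, T) \<Rightarrow> ereal (cmod (propagation g y T)))"
    using \<open>P (y, t k)\<close> by (intro SUP_upper2[of "(y, t k)"]) auto
  finally show "ereal M \<le> (SUP z\<in>Collect P. case z of (y, T) \<Rightarrow> ereal (cmod (propagation g y T)))" .
qed

end

theorem theorem1p1:
  fixes \<gamma> :: "real \<Rightarrow> real" and c1 c2 :: real
  assumes "\<gamma> \<in> {0..} \<rightarrow> {0..}"
    and "strict_mono_on {0..} \<gamma>"
    and "continuous_on {0..} \<gamma>"
    and "\<gamma> 0 = 0"
    and "0 < c1" and "c1 < c2"
  shows "\<exists>f\<in>H_half_radial. \<exists>g. has_spherical_transform f g \<and>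
    (\<forall>x\<in>H3_annulus c1 c2. \<forall>t>0. propagation_converges g x t) \<and>
    continuous_on (H3_annulus c1 c2 \<times> {0<..}) (\<lambda>(x, t). propagation g x t) \<and>
    (\<forall>x\<in>H3_annulus c1 c2.
       Limsup (at (x, 0) within approach_region \<gamma> x)
         (\<lambda>(y, t). ereal (cmod (propagation g y t))) = \<infinity>)"
proof -
  obtain \<sigma> t :: "nat \<Rightarrow> real" where \<sigma>: "\<And>k. c1 \<le> \<sigma> k" "\<And>k. \<sigma> k \<le> c2"
    and t: "\<And>k. 0 < t k" "\<And>k. t (Suc k) < t k" "t \<longlonglongrightarrow> 0"
    and hit: "\<And>s K. s \<in> {c1..c2} \<Longrightarrow> \<exists>k\<ge>K. \<bar>\<sigma> k - s\<bar> < \<gamma> (t k)"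
    using focusing_sequence[OF assms(2,4,6)] by metis
  \<comment> \<open>The times are fixed by now and their gaps are positive, so \<open>N_gap\<close>
    is a plain lower bound on \<open>N k\<close>.\<close>
  obtain N :: "nat \<Rightarrow> real" where N: "exp 1 \<le> N 0" "\<And>k. N k < N (Suc k)"
    "\<And>k. (2 ^ Suc k + 2 * c2 + real k) / gap t k \<le> N k"
    "\<And>k. 3 * ln (ln (N k)) + 2 * real k + (2 + 1 / c1) \<le> ln (ln (N (Suc k)))"
    using rapid_growth[of "\<lambda>k. (2 ^ Suc k + 2 * c2 + real k) / gap t k" "2 + 1 / c1"] by metis
  have gap: "0 < gap t k" for k
    using t(1,2) by (simp add: gap_def split: nat.split)
  interpret focusing c1 c2 \<sigma> t N
  proof
    show "2 ^ Suc k + 2 * c2 + real k \<le> N k * gap t k" for k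
      using N(3)[of k] gap[of k] by (simp add: pos_divide_le_eq)
  qed (fact assms(5) \<sigma> t N)+
  show ?thesis
    using rad_\<Phi>_H_half has_spherical_transform_rad_\<Phi> propagation_converges_annulus
      continuous_on_propagation Limsup_propagation[OF _ assms(3,4) hit]
    by (intro bexI[of _ "rad \<Phi>"] exI[of _ g] conjI ballI allI impI) auto
qed

end
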